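(* Let $J\subset S_0$, let $z\in{}^JW_0$, and let $\tilde w\in\tilde W$ be a $(J,z)$-alcove element. Then $$T_{\tilde w}\in\mathcal H_J+[\mathcal H,\mathcal H].$$
   Context: Root data. Let $(X,R,Y,R^\vee,F_0)$ be a based root datum with roots $R\subset X$, coroots $R^\vee\subset Y$, perfect pairing $\langle\,,\rangle:X\times Y\to\mathbb Z$, simple roots $F_0$, positive roots $R^+$, $R^-=-R^+$. $W_0$ is the Weyl group with simple reflections $S_0=\{s_\alpha:\alpha\in F_0\}$; subsets of $S_0$ are identified with subsets of $F_0$. $\Gamma$ is a group of automorphisms of the based root datum (automorphisms $\delta$ of $X$ with $\delta(F_0)=F_0$). Put $V=X\otimes_{\mathbb Z}\mathbb R$, $H_{\alpha,k}=\{v\in V:\langle v,\alpha^\vee\rangle=k\}$ for $\alpha\in R,k\in\mathbb Z$, and $\mathfrak H=\{H_{\alpha,k}\}$; alcoves are the connected components of $V-\bigcup_{H\in\mathfrak H}H$, and $C_0=\{v:0<\langle v,\alpha^\vee\rangle<1\ \forall\alpha\in R^+\}$. $W=\mathbb ZR\rtimes W_0$ is the affine Weyl group, with simple reflections $S\supset S_0$ (reflections in the walls of $C_0$). $\tilde W=X\rtimes(W_0\rtimes\Gamma)$ acts on $V$ by affine transformations; $t^\lambda$ is translation by $\lambda\in X$. $\ell(\tilde w)$ is the number of $H\in\mathfrak H$ separating $C_0$ from $\tilde wC_0$. For $J\subset S_0$: $R_J$ is the set of roots spanned by $J$, $R_J^+=R_J\cap R^+$, $W_J=\langle J\rangle$,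 $\Gamma_J=\{\delta\in\Gamma:\delta(R_J)=R_J\}$, $\tilde W_J=(X\rtimes W_J)\rtimes\Gamma_J$; ${}^JW_0$ is the set of minimal length representatives of $W_J\backslash W_0$. Hecke algebra. Let $q_s^{1/2}$ ($s\in S$) be indeterminates with $q_s^{1/2}=q_t^{1/2}$ whenever $s,t$ are conjugate in $\tilde W$, and $\mathcal A=\mathbb Z[q_s^{1/2},q_s^{-1/2}]_{s\in S}$. $\mathcal H$ is the $\mathcal A$-algebra with basis $\{T_{\tilde w}\}_{\tilde w\in\tilde W}$ and relations $T_{\tilde x}T_{\tilde y}=T_{\tilde x\tilde y}$ if $\ell(\tilde x)+\ell(\tilde y)=\ell(\tilde x\tilde y)$, and $(T_s-q_s^{1/2})(T_s+q_s^{-1/2})=0$ for $s\in S$. $[\mathcal H,\mathcal H]$ is the $\mathcal A$-submodule generated by all $hh'-h'h$. For $\lambda=\chi-\chi'\in X$ with $\chi,\chi'$ dominant, $\theta_\lambda=T_{t^\chi}T_{t^{\chi'}}^{-1}$ (independent of choices). $\mathcal H_J\subset\mathcal H$ is the subalgebra generated by $\theta_\lambda$ ($\lambda\in X$) and $T_w$ ($w\in W_J\rtimes\Gamma_J$). Alcove elements. For $\alpha\in R$ and an alcove $C$, let $k(\alpha,C)$ be the unique integer $k$ such that $C$ lies between $H_{\alpha,k}$ and $H_{\alpha,k-1}$; write $C\geqslant_\alpha C'$ if $k(\alpha,C)\ge k(\alpha,C')$. For $J\subset S_0$, $z\in W_0$, an element $\tilde w\in\tilde W$ is a $(J,z)$-alcove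 element (also called a $P$-alcove element for the semistandard parabolic $P=z^{-1}P_Jz$) if (1) $z\tilde wz^{-1}\in\tilde W_J$ and (2) $\tilde wC_0\geqslant_\alpha C_0$ for all $\alpha\in z^{-1}(R^+-R_J^+)$. *)

theory Defs
  imports "HOL-Analysis.Analysis" "HOL-Library.Poly_Mapping"
begin

section \<open>Based root data\<close>

text \<open>
  The lattice \<open>X\<close> is given inside the real vector space \<open>V = X \<otimes> \<real>\<close> (the type \<open>'v\<close>), and
  \<open>Y\<close> inside \<open>Y \<otimes> \<real>\<close> (the type \<open>'u\<close>); the pairing is the \<open>\<real>\<close>-bilinear extension of
  \<open>X \<times> Y \<rightarrow> \<int>\<close>. The norm on \<open>'v\<close> only serves to provide the topology of the
  finite-dimensional space \<open>V\<close>.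
\<close>

record ('v, 'u) root_datum =
  latX :: "'v set"
  roots :: "'v set"
  latY :: "'u set"
  coroot :: "'v \<Rightarrow> 'u"
  pairing :: "'v \<Rightarrow> 'u \<Rightarrow> real"
  simples :: "'v set"

definition full_lattice :: "'a::real_vector set \<Rightarrow> bool" where
  "full_lattice L \<longleftrightarrow> (\<exists>B. finite B \<and> independent B \<and> span B = UNIV \<and>
     L = {\<Sum>b\<in>B. of_int (n b) *\<^sub>R b | n :: 'a \<Rightarrow> int. True})"

definition perfect_pairing ::
  "'v::real_vector set \<Rightarrow> 'u::real_vector set \<Rightarrow> ('v \<Rightarrow> 'u \<Rightarrow> real) \<Rightarrow> bool" where
  "perfect_pairing L M p \<longleftrightarrow>
     (\<forall>x\<in>L. \<forall>y\<in>M. p x y \<in> \<int>) \<and>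
     (\<forall>f :: 'v \<Rightarrow> int. (\<forall>x\<in>L. \<forall>x'\<in>L. f (x + x') = f x + f x') \<longrightarrow>
        (\<exists>!y. y \<in> M \<and> (\<forall>x\<in>L. p x y = of_int (f x)))) \<and>
     (\<forall>g :: 'u \<Rightarrow> int. (\<forall>y\<in>M. \<forall>y'\<in>M. g (y + y') = g y + g y') \<longrightarrow>
        (\<exists>!x. x \<in> L \<and> (\<forall>y\<in>M. p x y = of_int (g y))))"

definition pair_coroot :: "('v, 'u) root_datum \<Rightarrow> 'v \<Rightarrow> 'v \<Rightarrow> real" where
  "pair_coroot \<Phi> v \<alpha> = pairing \<Phi> v (coroot \<Phi> \<alpha>)"

definition reflection :: "('v::real_vector, 'u) root_datum \<Rightarrow> 'v \<Rightarrow> int \<Rightarrow> 'v \<Rightarrow> 'v" where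
  "reflection \<Phi> \<alpha> k v = v - (pair_coroot \<Phi> v \<alpha> - of_int k) *\<^sub>R \<alpha>"

locale based_root_datum =
  fixes \<Phi> :: "('v::real_normed_vector, 'u::real_vector) root_datum"
  assumes latX: "full_lattice (latX \<Phi>)"
    and latY: "full_lattice (latY \<Phi>)"
    and bilinear: "bilinear (pairing \<Phi>)"
    and perfect: "perfect_pairing (latX \<Phi>) (latY \<Phi>) (pairing \<Phi>)"
    and finite_roots: "finite (roots \<Phi>)"
    and roots_lattice: "roots \<Phi> \<subseteq> latX \<Phi>"
    and coroots_lattice: "coroot \<Phi> ` roots \<Phi> \<subseteq> latY \<Phi>"
    and coroot_inj: "inj_on (coroot \<Phi>) (roots \<Phi>)"
    and pair_root_coroot: "\<And>\<alpha>. \<alpha> \<in> roots \<Phi> \<Longrightarrow> pair_coroot \<Phi> \<alpha> \<alpha> = 2"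
    and reflection_roots: "\<And>\<alpha> \<beta>. \<alpha> \<in> roots \<Phi> \<Longrightarrow> \<beta> \<in> roots \<Phi> \<Longrightarrow> reflection \<Phi> \<alpha> 0 \<beta> \<in> roots \<Phi>"
    and reflection_coroots: "\<And>\<alpha> y. \<alpha> \<in> roots \<Phi> \<Longrightarrow> y \<in> coroot \<Phi> ` roots \<Phi> \<Longrightarrow>
          y - pairing \<Phi> \<alpha> y *\<^sub>R coroot \<Phi> \<alpha> \<in> coroot \<Phi> ` roots \<Phi>"
    and simples_roots: "simples \<Phi> \<subseteq> roots \<Phi>"
    and simples_independent: "independent (simples \<Phi>)"
    and simples_base: "\<And>\<beta>. \<beta> \<in> roots \<Phi> \<Longrightarrow> \<exists>n :: 'v \<Rightarrow> nat.
          \<beta> = (\<Sum>\<alpha>\<in>simples \<Phi>. of_nat (n \<alpha>) *\<^sub>R \<alpha>) \<or>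
          \<beta> = - (\<Sum>\<alpha>\<in>simples \<Phi>. of_nat (n \<alpha>) *\<^sub>R \<alpha>)"

definition pos_roots :: "('v::real_vector, 'u) root_datum \<Rightarrow> 'v set" where
  "pos_roots \<Phi> = {\<beta> \<in> roots \<Phi>. \<exists>n :: 'v \<Rightarrow> nat. \<beta> = (\<Sum>\<alpha>\<in>simples \<Phi>. of_nat (n \<alpha>) *\<^sub>R \<alpha>)}"

definition roots_on :: "('v::real_vector, 'u) root_datum \<Rightarrow> 'v set \<Rightarrow> 'v set" where
  "roots_on \<Phi> J = roots \<Phi> \<inter> span J"

definition pos_roots_on :: "('v::real_vector, 'u) root_datum \<Rightarrow> 'v set \<Rightarrow> 'v set" where
  "pos_roots_on \<Phi> J = roots_on \<Phi> J \<inter> pos_roots \<Phi>"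

text \<open>The generators \<open>s\<^sub>\<alpha>\<close> are involutions, so closure under products gives the generated group.\<close>

inductive_set refl_group :: "('v::real_vector, 'u) root_datum \<Rightarrow> 'v set \<Rightarrow> ('v \<Rightarrow> 'v) set"
  for \<Phi> :: "('v::real_vector, 'u) root_datum" and J :: "'v set" where
  "id \<in> refl_group \<Phi> J"
| "\<alpha> \<in> J \<Longrightarrow> w \<in> refl_group \<Phi> J \<Longrightarrow> reflection \<Phi> \<alpha> 0 \<circ> w \<in> refl_group \<Phi> J"

abbreviation weyl_group :: "('v::real_vector, 'u) root_datum \<Rightarrow> ('v \<Rightarrow> 'v) set" where
  "weyl_group \<Phi> \<equiv> refl_group \<Phi> (roots \<Phi>)"

text \<open>An automorphism of \<open>X\<close> is represented by its unique \<open>\<real>\<close>-linear extension to \<open>V\<close>.\<close>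

definition based_automorphism ::
  "('v::real_vector, 'u) root_datum \<Rightarrow> ('v \<Rightarrow> 'v) \<Rightarrow> bool" where
  "based_automorphism \<Phi> \<delta> \<longleftrightarrow> linear \<delta> \<and> bij \<delta> \<and> \<delta> ` latX \<Phi> = latX \<Phi> \<and>
     \<delta> ` roots \<Phi> = roots \<Phi> \<and> \<delta> ` simples \<Phi> = simples \<Phi> \<and>
     (\<forall>\<alpha>\<in>roots \<Phi>. \<forall>v. pair_coroot \<Phi> (\<delta> v) (\<delta> \<alpha>) = pair_coroot \<Phi> v \<alpha>)"

locale root_datum_with_automorphisms = based_root_datum +
  fixes \<Gamma> :: "('v::real_normed_vector \<Rightarrow> 'v) set"
  assumes automorphisms: "\<And>\<delta>. \<delta> \<in> \<Gamma> \<Longrightarrow> based_automorphism \<Phi> \<delta>"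
    and id_automorphism: "id \<in> \<Gamma>"
    and comp_automorphism: "\<And>\<delta> \<epsilon>. \<delta> \<in> \<Gamma> \<Longrightarrow> \<epsilon> \<in> \<Gamma> \<Longrightarrow> \<delta> \<circ> \<epsilon> \<in> \<Gamma>"
    and inv_automorphism: "\<And>\<delta>. \<delta> \<in> \<Gamma> \<Longrightarrow> inv \<delta> \<in> \<Gamma>"

section \<open>The extended affine Weyl group and alcoves\<close>

definition translation :: "'v::real_vector \<Rightarrow> 'v \<Rightarrow> 'v" where
  "translation x = (\<lambda>v. x + v)"

definition aut_on ::
  "('v::real_vector, 'u) root_datum \<Rightarrow> ('v \<Rightarrow> 'v) set \<Rightarrow> 'v set \<Rightarrow> ('v \<Rightarrow> 'v) set" where
  "aut_on \<Phi> \<Gamma> J = {\<delta> \<in> \<Gamma>. \<delta> ` roots_on \<Phi> J = roots_on \<Phi> J}"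

text \<open>
  No nontrivial element of \<open>W\<^sub>0\<close> stabilises the base, so \<open>X \<rtimes> (W\<^sub>0 \<rtimes> \<Gamma>)\<close> acts faithfully on \<open>V\<close>.
  It is identified with its image: the group law is composition, and \<open>translation x \<circ> w \<circ> \<delta>\<close>
  is the element \<open>(x, (w, \<delta>))\<close>.
\<close>

definition ext_affine_weyl ::
  "('v::real_vector, 'u) root_datum \<Rightarrow> ('v \<Rightarrow> 'v) set \<Rightarrow> ('v \<Rightarrow> 'v) set" where
  "ext_affine_weyl \<Phi> \<Gamma> =
     {translation x \<circ> w \<circ> \<delta> | x w \<delta>. x \<in> latX \<Phi> \<and> w \<in> weyl_group \<Phi> \<and> \<delta> \<in> \<Gamma>}"

definition ext_affine_weyl_on ::
  "('v::real_vector, 'u) root_datum \<Rightarrow> ('v \<Rightarrow> 'v) set \<Rightarrow> 'v set \<Rightarrow> ('v \<Rightarrow> 'v) set" where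
  "ext_affine_weyl_on \<Phi> \<Gamma> J =
     {translation x \<circ> w \<circ> \<delta> | x w \<delta>. x \<in> latX \<Phi> \<and> w \<in> refl_group \<Phi> J \<and> \<delta> \<in> aut_on \<Phi> \<Gamma> J}"

definition hyperplane :: "('v, 'u) root_datum \<Rightarrow> 'v \<Rightarrow> int \<Rightarrow> 'v set" where
  "hyperplane \<Phi> \<alpha> k = {v. pair_coroot \<Phi> v \<alpha> = of_int k}"

definition hyperplanes :: "('v, 'u) root_datum \<Rightarrow> 'v set set" where
  "hyperplanes \<Phi> = {hyperplane \<Phi> \<alpha> k | \<alpha> k. \<alpha> \<in> roots \<Phi>}"

definition base_alcove :: "('v::real_vector, 'u) root_datum \<Rightarrow> 'v set" where
  "base_alcove \<Phi> = {v. \<forall>\<alpha>\<in>pos_roots \<Phi>. 0 < pair_coroot \<Phi> v \<alpha> \<and> pair_coroot \<Phi> v \<alpha> < 1}"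

definition separates :: "('v, 'u) root_datum \<Rightarrow> 'v set \<Rightarrow> 'v set \<Rightarrow> 'v set \<Rightarrow> bool" where
  "separates \<Phi> H C C' \<longleftrightarrow> (\<exists>\<alpha>\<in>roots \<Phi>. \<exists>k. H = hyperplane \<Phi> \<alpha> k \<and>
     ((\<forall>v\<in>C. pair_coroot \<Phi> v \<alpha> < of_int k) \<and> (\<forall>v\<in>C'. of_int k < pair_coroot \<Phi> v \<alpha>) \<or>
      (\<forall>v\<in>C'. pair_coroot \<Phi> v \<alpha> < of_int k) \<and> (\<forall>v\<in>C. of_int k < pair_coroot \<Phi> v \<alpha>)))"

definition len :: "('v::real_vector, 'u) root_datum \<Rightarrow> ('v \<Rightarrow> 'v) \<Rightarrow> nat" where
  "len \<Phi> w = card {H \<in> hyperplanes \<Phi>. separates \<Phi> H (base_alcove \<Phi>) (w ` base_alcove \<Phi>)}"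

text \<open>A wall of the alcove is a hyperplane spanned by a face of it.\<close>

definition affine_simple_refls :: "('v::real_normed_vector, 'u) root_datum \<Rightarrow> ('v \<Rightarrow> 'v) set" where
  "affine_simple_refls \<Phi> = {reflection \<Phi> \<alpha> k | \<alpha> k. \<alpha> \<in> roots \<Phi> \<and>
     affine hull (hyperplane \<Phi> \<alpha> k \<inter> closure (base_alcove \<Phi>)) = hyperplane \<Phi> \<alpha> k}"

definition min_coset_reps :: "('v::real_vector, 'u) root_datum \<Rightarrow> 'v set \<Rightarrow> ('v \<Rightarrow> 'v) set" where
  "min_coset_reps \<Phi> J = {z \<in> weyl_group \<Phi>. \<forall>w\<in>refl_group \<Phi> J. len \<Phi> z \<le> len \<Phi> (w \<circ> z)}"

definition alcove_index :: "('v, 'u) root_datum \<Rightarrow> 'v \<Rightarrow> 'v set \<Rightarrow> int" where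
  "alcove_index \<Phi> \<alpha> C =
     (THE k. \<forall>v\<in>C. of_int (k - 1) < pair_coroot \<Phi> v \<alpha> \<and> pair_coroot \<Phi> v \<alpha> < of_int k)"

definition alcove_ge :: "('v, 'u) root_datum \<Rightarrow> 'v \<Rightarrow> 'v set \<Rightarrow> 'v set \<Rightarrow> bool" where
  "alcove_ge \<Phi> \<alpha> C C' \<longleftrightarrow> alcove_index \<Phi> \<alpha> C' \<le> alcove_index \<Phi> \<alpha> C"

definition alcove_element ::
  "('v::real_vector, 'u) root_datum \<Rightarrow> ('v \<Rightarrow> 'v) set \<Rightarrow> 'v set \<Rightarrow> ('v \<Rightarrow> 'v) \<Rightarrow> ('v \<Rightarrow> 'v) \<Rightarrow> bool" where
  "alcove_element \<Phi> \<Gamma> J z w \<longleftrightarrow> w \<in> ext_affine_weyl \<Phi> \<Gamma> \<and>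
     z \<circ> w \<circ> inv z \<in> ext_affine_weyl_on \<Phi> \<Gamma> J \<and>
     (\<forall>\<alpha> \<in> inv z ` (pos_roots \<Phi> - pos_roots_on \<Phi> J).
        alcove_ge \<Phi> \<alpha> (w ` base_alcove \<Phi>) (base_alcove \<Phi>))"

section \<open>The affine Hecke algebra with generic parameters\<close>

text \<open>
  There is one indeterminate for each conjugacy class of \<open>ext_affine_weyl \<Phi> \<Gamma>\<close> meeting
  \<open>affine_simple_refls \<Phi>\<close>, indexed by the class itself. Laurent polynomials in indeterminates
  indexed by \<open>'c\<close> are the elements of the group ring over \<open>\<int>\<close> of the exponent group
  \<open>'c \<Rightarrow>\<^sub>0 int\<close>; the coefficient ring is the subring of those in which only
  the relevant indeterminates occur.
\<close>

type_synonym 'c laurent = "('c \<Rightarrow>\<^sub>0 int) \<Rightarrow>\<^sub>0 int"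

definition conj_class ::
  "('v::real_vector, 'u) root_datum \<Rightarrow> ('v \<Rightarrow> 'v) set \<Rightarrow> ('v \<Rightarrow> 'v) \<Rightarrow> ('v \<Rightarrow> 'v) set" where
  "conj_class \<Phi> \<Gamma> s = {g \<circ> s \<circ> inv g | g. g \<in> ext_affine_weyl \<Phi> \<Gamma>}"

definition coeff_ring ::
  "('v::real_normed_vector, 'u) root_datum \<Rightarrow> ('v \<Rightarrow> 'v) set \<Rightarrow> ('v \<Rightarrow> 'v) set laurent set" where
  "coeff_ring \<Phi> \<Gamma> =
     {p. \<forall>m \<in> Poly_Mapping.keys p. Poly_Mapping.keys m \<subseteq> conj_class \<Phi> \<Gamma> ` affine_simple_refls \<Phi>}"

definition sqrt_q ::
  "('v::real_vector, 'u) root_datum \<Rightarrow> ('v \<Rightarrow> 'v) set \<Rightarrow> ('v \<Rightarrow> 'v) \<Rightarrow> ('v \<Rightarrow> 'v) set laurent" where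
  "sqrt_q \<Phi> \<Gamma> s = Poly_Mapping.single (Poly_Mapping.single (conj_class \<Phi> \<Gamma> s) 1) 1"

definition sqrt_q_inv ::
  "('v::real_vector, 'u) root_datum \<Rightarrow> ('v \<Rightarrow> 'v) set \<Rightarrow> ('v \<Rightarrow> 'v) \<Rightarrow> ('v \<Rightarrow> 'v) set laurent" where
  "sqrt_q_inv \<Phi> \<Gamma> s = Poly_Mapping.single (Poly_Mapping.single (conj_class \<Phi> \<Gamma> s) (-1)) 1"

lemma sqrt_q_inverse: "sqrt_q \<Phi> \<Gamma> s * sqrt_q_inv \<Phi> \<Gamma> s = 1"
  by (simp add: sqrt_q_def sqrt_q_inv_def mult_single flip: single_add)

text \<open>
  The Hecke algebra is the type \<open>'h\<close> with scalar multiplication \<open>sc\<close> (relevant only for scalars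
  in \<open>coeff_ring \<Phi> \<Gamma>\<close>) and basis \<open>T\<close>. The basis property and the relations determine it
  up to isomorphism.
\<close>

locale affine_hecke_algebra = root_datum_with_automorphisms \<Phi> \<Gamma>
  for \<Phi> :: "('v::real_normed_vector, 'u::real_vector) root_datum"
    and \<Gamma> :: "('v \<Rightarrow> 'v) set" +
  fixes sc :: "('v \<Rightarrow> 'v) set laurent \<Rightarrow> 'h::ring_1 \<Rightarrow> 'h"
    and T :: "('v \<Rightarrow> 'v) \<Rightarrow> 'h"
  assumes sc_add_right: "\<And>a h h'. a \<in> coeff_ring \<Phi> \<Gamma> \<Longrightarrow> sc a (h + h') = sc a h + sc a h'"
    and sc_add_left: "\<And>a b h. a \<in> coeff_ring \<Phi> \<Gamma> \<Longrightarrow> b \<in> coeff_ring \<Phi> \<Gamma> \<Longrightarrow>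
          sc (a + b) h = sc a h + sc b h"
    and sc_sc: "\<And>a b h. a \<in> coeff_ring \<Phi> \<Gamma> \<Longrightarrow> b \<in> coeff_ring \<Phi> \<Gamma> \<Longrightarrow>
          sc (a * b) h = sc a (sc b h)"
    and sc_one: "\<And>h. sc 1 h = h"
    and sc_mult_left: "\<And>a h h'. a \<in> coeff_ring \<Phi> \<Gamma> \<Longrightarrow> sc a h * h' = sc a (h * h')"
    and sc_mult_right: "\<And>a h h'. a \<in> coeff_ring \<Phi> \<Gamma> \<Longrightarrow> h * sc a h' = sc a (h * h')"
    and T_basis: "\<And>h. \<exists>!c. {w. c w \<noteq> 0} \<subseteq> ext_affine_weyl \<Phi> \<Gamma> \<and> finite {w. c w \<noteq> 0} \<and>
          range c \<subseteq> coeff_ring \<Phi> \<Gamma> \<and> h = (\<Sum>w | c w \<noteq> 0. sc (c w) (T w))"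
    and T_mult: "\<And>x y. x \<in> ext_affine_weyl \<Phi> \<Gamma> \<Longrightarrow> y \<in> ext_affine_weyl \<Phi> \<Gamma> \<Longrightarrow>
          len \<Phi> x + len \<Phi> y = len \<Phi> (x \<circ> y) \<Longrightarrow> T x * T y = T (x \<circ> y)"
    and T_quadratic: "\<And>s. s \<in> affine_simple_refls \<Phi> \<Longrightarrow>
          (T s - sc (sqrt_q \<Phi> \<Gamma> s) 1) * (T s + sc (sqrt_q_inv \<Phi> \<Gamma> s) 1) = 0"

inductive_set module_generated :: "'a set \<Rightarrow> ('a \<Rightarrow> 'h \<Rightarrow> 'h) \<Rightarrow> 'h::ring_1 set \<Rightarrow> 'h set"
  for A :: "'a set" and sc :: "'a \<Rightarrow> 'h::ring_1 \<Rightarrow> 'h" and G :: "'h set" where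
  "0 \<in> module_generated A sc G"
| "g \<in> G \<Longrightarrow> g \<in> module_generated A sc G"
| "x \<in> module_generated A sc G \<Longrightarrow> y \<in> module_generated A sc G \<Longrightarrow>
     x + y \<in> module_generated A sc G"
| "a \<in> A \<Longrightarrow> x \<in> module_generated A sc G \<Longrightarrow> sc a x \<in> module_generated A sc G"

inductive_set algebra_generated :: "'a set \<Rightarrow> ('a \<Rightarrow> 'h \<Rightarrow> 'h) \<Rightarrow> 'h::ring_1 set \<Rightarrow> 'h set"
  for A :: "'a set" and sc :: "'a \<Rightarrow> 'h::ring_1 \<Rightarrow> 'h" and G :: "'h set" where
  "1 \<in> algebra_generated A sc G"
| "g \<in> G \<Longrightarrow> g \<in> algebra_generated A sc G"
| "x \<in> algebra_generated A sc G \<Longrightarrow> y \<in> algebra_generated A sc G \<Longrightarrow>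
     x + y \<in> algebra_generated A sc G"
| "x \<in> algebra_generated A sc G \<Longrightarrow> y \<in> algebra_generated A sc G \<Longrightarrow>
     x * y \<in> algebra_generated A sc G"
| "a \<in> A \<Longrightarrow> x \<in> algebra_generated A sc G \<Longrightarrow> sc a x \<in> algebra_generated A sc G"

definition commutator_module ::
  "('v::real_normed_vector, 'u) root_datum \<Rightarrow> ('v \<Rightarrow> 'v) set \<Rightarrow>
   (('v \<Rightarrow> 'v) set laurent \<Rightarrow> 'h::ring_1 \<Rightarrow> 'h) \<Rightarrow> 'h set" where
  "commutator_module \<Phi> \<Gamma> sc =
     module_generated (coeff_ring \<Phi> \<Gamma>) sc {h * h' - h' * h | h h'. True}"

definition dominant :: "('v::real_vector, 'u) root_datum \<Rightarrow> 'v \<Rightarrow> bool" where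
  "dominant \<Phi> x \<longleftrightarrow> x \<in> latX \<Phi> \<and> (\<forall>\<alpha>\<in>pos_roots \<Phi>. 0 \<le> pair_coroot \<Phi> x \<alpha>)"

definition ring_inverse :: "'h::ring_1 \<Rightarrow> 'h" where
  "ring_inverse h = (THE h'. h * h' = 1 \<and> h' * h = 1)"

definition theta ::
  "('v::real_vector, 'u) root_datum \<Rightarrow> (('v \<Rightarrow> 'v) \<Rightarrow> 'h::ring_1) \<Rightarrow> 'v \<Rightarrow> 'h" where
  "theta \<Phi> T l = (THE h. \<exists>x x'. dominant \<Phi> x \<and> dominant \<Phi> x' \<and> l = x - x' \<and>
     h = T (translation x) * ring_inverse (T (translation x')))"

definition hecke_on ::
  "('v::real_normed_vector, 'u) root_datum \<Rightarrow> ('v \<Rightarrow> 'v) set \<Rightarrow>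
   (('v \<Rightarrow> 'v) set laurent \<Rightarrow> 'h::ring_1 \<Rightarrow> 'h) \<Rightarrow> (('v \<Rightarrow> 'v) \<Rightarrow> 'h) \<Rightarrow> 'v set \<Rightarrow> 'h set" where
  "hecke_on \<Phi> \<Gamma> sc T J = algebra_generated (coeff_ring \<Phi> \<Gamma>) sc
     (theta \<Phi> T ` latX \<Phi> \<union>
      {T (w \<circ> \<delta>) | w \<delta>. w \<in> refl_group \<Phi> J \<and> \<delta> \<in> aut_on \<Phi> \<Gamma> J})"

end

theory Submission
  imports Defs
begin

text \<open>
  For \<open>c\<close> and \<open>w\<close> in the extended affine Weyl group, consider the element
  \<open>E\<^sub>c(w) = T\<^sub>c\<inverse> T\<^bsub>cw\<^esub>\<close> (\<open>walk c w\<close> below). Along a minimal gallery from \<open>C\<^sub>0\<close> to \<open>wC\<^sub>0\<close> it is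
  a product of factors \<open>T\<^sub>s\<close> and \<open>T\<^sub>s\<inverse>\<close>, ending in \<open>T\<close> of an element of length zero; the sign is positive exactly when the crossed hyperplane
  is crossed away from the alcove \<open>c\<inverse>C\<^sub>0\<close>. Hence \<open>E\<^sub>c(w)\<close> depends on \<open>c\<close> only through the side on which
  \<open>c\<inverse>C\<^sub>0\<close> lies of each hyperplane separating \<open>C\<^sub>0\<close> from \<open>wC\<^sub>0\<close> (\<open>walk_cong\<close>).
  The family satisfies the cocycle rule
  \<open>E\<^sub>c(vw) = E\<^sub>c(v) E\<^bsub>cv\<^esub>(w)\<close>, and it contains both standard bases: \<open>E\<^sub>1(w) = T\<^sub>w\<close>, while
  \<open>E\<^sub>c(t\<^sup>\<lambda>) = \<theta>\<^sub>\<lambda>\<close> if \<open>c\<close> is a sufficiently dominant translation.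

  Call the roots in \<open>R\<^sup>+ - R\<^sub>J\<^sup>+\<close> outer, and let \<open>a\<close> be the translation by a large multiple of their
  sum \<open>\<rho>\<^sub>J\<close>. This vector is orthogonal to \<open>R\<^sub>J\<close> and pairs positively with every outer coroot, so
  \<open>a\<inverse>C\<^sub>0\<close> is far below \<open>C\<^sub>0\<close> in the outer directions and is not separated from \<open>C\<^sub>0\<close> by a hyperplane
  of \<open>R\<^sub>J\<close>. Put \<open>y = zwz\<inverse>\<close>, which lies in the parabolic subgroup attached to \<open>J\<close>.

  \<^item> The alcove condition says that a gallery from \<open>C\<^sub>0\<close> to \<open>wC\<^sub>0\<close> crosses the hyperplanes of
    \<open>z\<inverse>(R\<^sup>+ - R\<^sub>J\<^sup>+)\<close> upwards, that is, away from \<open>(az)\<inverse>C\<^sub>0\<close>. Since \<open>z\<close> is minimal in its coset,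
    no hyperplane of \<open>z\<inverse>R\<^sub>J\<close> separates \<open>(az)\<inverse>C\<^sub>0\<close> from \<open>C\<^sub>0\<close>. So \<open>E\<^bsub>az\<^esub>(w) = T\<^sub>w\<close>
    (\<open>walk_alcove_element\<close>).

  \<^item> Minimality of \<open>z\<close> also shows that only outer hyperplanes separate \<open>C\<^sub>0\<close> from \<open>zC\<^sub>0\<close>. The
    parabolic subgroup permutes the outer roots, so \<open>a\<inverse>C\<^sub>0\<close> and \<open>(ay)\<inverse>C\<^sub>0\<close> lie on the same side of
    these hyperplanes, and \<open>E\<^sub>a(z) = E\<^bsub>ay\<^esub>(z)\<close> (\<open>walk_outer_cong\<close>). Writing \<open>e\<close> for this unit, the
    cocycle rule applied to \<open>azw = ayz\<close> gives \<open>E\<^bsub>az\<^esub>(w) = e\<inverse> E\<^sub>a(y) e\<close>, which is congruent to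
    \<open>E\<^sub>a(y)\<close> modulo commutators.

  \<^item> Write \<open>y = v\<inverse> t\<^sup>\<nu> u \<delta>\<close> with \<open>v, u \<in> W\<^sub>J\<close>, \<open>\<delta> \<in> \<Gamma>\<^sub>J\<close> and \<open>\<nu>\<close> dominant for \<open>R\<^sub>J\<close>. By the cocycle
    rule \<open>E\<^sub>a(y)\<close> is a product of a factor for \<open>v\<inverse>\<close>, a factor for \<open>t\<^sup>\<nu>\<close> equal to \<open>\<theta>\<^sub>\<nu>\<close>, and factors
    for \<open>u\<close> and \<open>\<delta>\<close>. All of them lie in the parabolic subalgebra (\<open>walk_parabolic\<close>).

  Galleries are followed one step at a time. This rests on the existence of a wall of \<open>C\<^sub>0\<close> among the
  hyperplanes separating \<open>C\<^sub>0\<close> from another alcove (\<open>wall_exists\<close>). The axioms admit a root together with its double, so a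
  hyperplane is treated as a set of points and not as a pair of a root and a level.
\<close>

section \<open>The invariant form and reflections\<close>

context based_root_datum
begin

abbreviation "pc \<equiv> pair_coroot \<Phi>"
abbreviation "R \<equiv> roots \<Phi>"
abbreviation "Rp \<equiv> pos_roots \<Phi>"
abbreviation "F0 \<equiv> simples \<Phi>"
abbreviation "X \<equiv> latX \<Phi>"
abbreviation "lrefl \<alpha> \<equiv> reflection \<Phi> \<alpha> 0"

lemma pairing_linear_left: "linear (\<lambda>x. pairing \<Phi> x \<eta>)"
  and pairing_linear_right: "linear (pairing \<Phi> x)"
  using bilinear by (auto simp: bilinear_def)

lemma pc_linear: "linear (\<lambda>v. pc v \<alpha>)"
  unfolding pair_coroot_def by (rule pairing_linear_left)

lemma pc_add [simp]: "pc (v + w) \<alpha> = pc v \<alpha> + pc w \<alpha>"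
  and pc_diff [simp]: "pc (v - w) \<alpha> = pc v \<alpha> - pc w \<alpha>"
  and pc_scale [simp]: "pc (c *\<^sub>R v) \<alpha> = c * pc v \<alpha>"
  and pc_minus [simp]: "pc (- v) \<alpha> = - pc v \<alpha>"
  and pc_zero [simp]: "pc 0 \<alpha> = 0"
  using linear_add[OF pc_linear] linear_diff[OF pc_linear] linear_scale[OF pc_linear]
    linear_neg[OF pc_linear] linear_0[OF pc_linear]
  by simp_all

lemma pc_self [simp]: "\<alpha> \<in> R \<Longrightarrow> pc \<alpha> \<alpha> = 2"
  by (rule pair_root_coroot)

lemma root_nonzero: "\<alpha> \<in> R \<Longrightarrow> \<alpha> \<noteq> 0"
  by (metis pair_root_coroot pc_zero zero_neq_numeral)

lemma pc_integral: "x \<in> X \<Longrightarrow> \<alpha> \<in> R \<Longrightarrow> pc x \<alpha> \<in> \<int>"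
  using conjunct1[OF perfect[unfolded perfect_pairing_def]] coroots_lattice
  unfolding pair_coroot_def by (simp add: image_subset_iff)

lemma refl_eq: "lrefl \<alpha> v = v - pc v \<alpha> *\<^sub>R \<alpha>"
  by (simp add: reflection_def)

lemma refl_linear: "linear (lrefl \<alpha>)"
  by (rule linearI) (simp_all add: refl_eq algebra_simps)

lemma reflection_involution: "\<alpha> \<in> R \<Longrightarrow> reflection \<Phi> \<alpha> k (reflection \<Phi> \<alpha> k v) = v"
  by (simp add: reflection_def algebra_simps)

lemma refl_root: "\<alpha> \<in> R \<Longrightarrow> \<beta> \<in> R \<Longrightarrow> lrefl \<alpha> \<beta> \<in> R"
  by (rule reflection_roots)

lemma refl_self: "\<alpha> \<in> R \<Longrightarrow> lrefl \<alpha> \<alpha> = - \<alpha>"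
  by (simp add: refl_eq scaleR_2)

lemma minus_root: "\<alpha> \<in> R \<Longrightarrow> - \<alpha> \<in> R"
  using refl_root[of \<alpha> \<alpha>] refl_self by simp

text \<open>
  The form \<open>\<Sum>\<^sub>\<eta> \<langle>x, \<eta>\<rangle> \<langle>y, \<eta>\<rangle>\<close>, summed over all coroots. It is positive on roots, invariant under
  the Weyl group, and it expresses every coroot through its root (\<open>pc_eq_ip\<close>); it may be degenerate
  when the roots do not span \<open>V\<close>.
\<close>

definition ip :: "'v \<Rightarrow> 'v \<Rightarrow> real" where
  "ip x y = (\<Sum>\<eta>\<in>coroot \<Phi> ` R. pairing \<Phi> x \<eta> * pairing \<Phi> y \<eta>)"

lemma ip_commute: "ip x y = ip y x"
  by (simp add: ip_def mult.commute)

lemma ip_linear_right: "linear (ip x)"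
  by (intro linearI)
     (simp_all add: ip_def linear_add[OF pairing_linear_left] linear_scale[OF pairing_linear_left]
        distrib_left sum.distrib sum_distrib_left mult.left_commute)

lemma ip_linear_left: "linear (\<lambda>x. ip x y)"
  using ip_linear_right[of y] by (simp add: ip_commute[of _ y])

lemma ip_add [simp]: "ip x (y + z) = ip x y + ip x z" "ip (x + y) z = ip x z + ip y z"
  and ip_diff [simp]: "ip x (y - z) = ip x y - ip x z" "ip (x - y) z = ip x z - ip y z"
  and ip_scale [simp]: "ip x (c *\<^sub>R y) = c * ip x y" "ip (c *\<^sub>R x) y = c * ip x y"
  and ip_minus [simp]: "ip x (- y) = - ip x y" "ip (- x) y = - ip x y"
  and ip_sum_right: "ip x (sum f A) = (\<Sum>a\<in>A. ip x (f a))"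
  and ip_sum_left: "ip (sum f A) x = (\<Sum>a\<in>A. ip (f a) x)"
  using linear_add[OF ip_linear_right] linear_diff[OF ip_linear_right]
    linear_scale[OF ip_linear_right] linear_neg[OF ip_linear_right]
    linear_sum[OF ip_linear_right]
    linear_add[OF ip_linear_left] linear_diff[OF ip_linear_left]
    linear_scale[OF ip_linear_left] linear_neg[OF ip_linear_left]
    linear_sum[OF ip_linear_left]
  by simp_all

text \<open>
  The dual reflection permutes the coroots, so it only permutes the terms of the defining sum.
\<close>

lemma ip_refl: 
  assumes \<alpha>: "\<alpha> \<in> R"
  shows "ip (lrefl \<alpha> x) (lrefl \<alpha> y) = ip x y"
proof -
  define r where "r \<eta> = \<eta> - pairing \<Phi> \<alpha> \<eta> *\<^sub>R coroot \<Phi> \<alpha>" for \<eta>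
  have pr: "pairing \<Phi> v (r \<eta>) = pairing \<Phi> v \<eta> - pairing \<Phi> \<alpha> \<eta> * pc v \<alpha>" for v \<eta>
    using pairing_linear_right[of v]
    by (simp add: r_def pair_coroot_def linear_diff linear_scale)
  have p: "pairing \<Phi> (lrefl \<alpha> v) \<eta> = pairing \<Phi> v (r \<eta>)" for v \<eta>
    using linear_diff[OF pairing_linear_left, of v _ \<eta>] linear_scale[OF pairing_linear_left]
    by (simp add: refl_eq pr)
  have rr: "r (r \<eta>) = \<eta>" for \<eta>
  proof -
    have "pairing \<Phi> \<alpha> (r \<eta>) = - pairing \<Phi> \<alpha> \<eta>"
      using \<alpha> by (simp add: pr)
    then show ?thesis
      by (simp add: r_def)
  qed
  have rC: "r \<eta> \<in> coroot \<Phi> ` R" if "\<eta> \<in> coroot \<Phi> ` R" for \<eta>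
    using reflection_coroots[OF \<alpha> that] by (simp add: r_def)
  show ?thesis
    unfolding ip_def p
    by (rule sum.reindex_bij_witness[of _ r r]) (simp_all add: rr rC)
qed

lemma ip_self_pos: 
  assumes "\<alpha> \<in> R"
  shows "ip \<alpha> \<alpha> > 0"
  unfolding ip_def
proof (rule sum_pos2[of _ "coroot \<Phi> \<alpha>"])
  show "0 < pairing \<Phi> \<alpha> (coroot \<Phi> \<alpha>) * pairing \<Phi> \<alpha> (coroot \<Phi> \<alpha>)"
    using pc_self[OF assms] by (simp add: pair_coroot_def)
qed (use assms finite_roots in auto)

text \<open>
  Invariance under the reflection in \<open>\<alpha>\<close> reads \<open>(x - \<langle>x, \<alpha>\<^sup>\<or>\<rangle> \<alpha>, - \<alpha>) = (x, \<alpha>)\<close>; solve for the pairing.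
\<close>

lemma ip_root: 
  assumes "\<alpha> \<in> R"
  shows "2 * ip x \<alpha> = pc x \<alpha> * ip \<alpha> \<alpha>"
  using ip_refl[OF assms, of x \<alpha>] assms
  by (simp add: refl_self) (simp add: refl_eq)

text \<open>
  As a functional on \<open>V\<close>, the coroot is determined by the root and the invariant form. This yields the
  equivariance of the pairing under reflections, and that proportional roots have the same
  hyperplane through the origin.
\<close>

lemma pc_eq_ip: 
  assumes "\<alpha> \<in> R"
  shows "pc x \<alpha> = 2 * ip x \<alpha> / ip \<alpha> \<alpha>"
  using ip_root[OF assms, of x] ip_self_pos[OF assms] by (simp add: field_simps)

lemma pc_pos_iff: "\<alpha> \<in> R \<Longrightarrow> 0 < pc x \<alpha> \<longleftrightarrow> 0 < ip x \<alpha>"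
  and pc_neg_iff: "\<alpha> \<in> R \<Longrightarrow> pc x \<alpha> < 0 \<longleftrightarrow> ip x \<alpha> < 0"
  and pc_zero_iff: "\<alpha> \<in> R \<Longrightarrow> pc x \<alpha> = 0 \<longleftrightarrow> ip x \<alpha> = 0"
  using ip_self_pos[of \<alpha>] by (auto simp: pc_eq_ip zero_less_divide_iff divide_less_0_iff)

lemma pc_minus_root: "\<alpha> \<in> R \<Longrightarrow> pc x (- \<alpha>) = - pc x \<alpha>"
  by (simp add: pc_eq_ip minus_root)

lemma pc_refl: "\<alpha> \<in> R \<Longrightarrow> \<beta> \<in> R \<Longrightarrow> pc (lrefl \<alpha> x) (lrefl \<alpha> \<beta>) = pc x \<beta>"
  by (simp add: pc_eq_ip refl_root ip_refl)

lemma pc_refl': "\<alpha> \<in> R \<Longrightarrow> \<beta> \<in> R \<Longrightarrow> pc (lrefl \<alpha> x) \<beta> = pc x (lrefl \<alpha> \<beta>)"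
  using pc_refl[of \<alpha> "lrefl \<alpha> \<beta>" x] by (simp add: refl_root reflection_involution)

lemma ip_refl': "\<alpha> \<in> R \<Longrightarrow> ip (lrefl \<alpha> x) y = ip x (lrefl \<alpha> y)"
  using ip_refl[of \<alpha> x "lrefl \<alpha> y"] by (simp add: reflection_involution)

section \<open>Positive roots\<close>

abbreviation "coef \<equiv> representation F0"

lemma finite_simples: "finite F0"
  using finite_roots simples_roots by (rule rev_finite_subset)

lemma root_in_span: "\<beta> \<in> R \<Longrightarrow> \<beta> \<in> span F0"
  using simples_base[of \<beta>] by (auto intro!: span_neg span_sum span_scale intro: span_base)

lemma root_expansion: "\<beta> \<in> R \<Longrightarrow> (\<Sum>\<gamma>\<in>F0. coef \<beta> \<gamma> *\<^sub>R \<gamma>) = \<beta>"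
  using real_vector.sum_representation_eq[OF simples_independent root_in_span finite_simples]
  by auto

lemma coef_sum: 
  assumes "\<gamma> \<in> F0" 
  shows "coef (\<Sum>\<alpha>\<in>F0. c \<alpha> *\<^sub>R \<alpha>) \<gamma> = c \<gamma>"
proof -
  have "coef (\<Sum>\<alpha>\<in>F0. c \<alpha> *\<^sub>R \<alpha>) \<gamma> = (\<Sum>\<alpha>\<in>F0. c \<alpha> * (if \<gamma> = \<alpha> then 1 else 0))"
    by (subst real_vector.representation_sum[OF simples_independent])
       (auto intro!: span_scale sum.cong simp: span_base
         real_vector.representation_scale[OF simples_independent]
           real_vector.representation_basis[OF simples_independent])
  then show ?thesis
    using assms finite_simples by (simp add: if_distrib[of "(*) _"] cong: if_cong)
qed

lemma pos_root: "\<beta> \<in> Rp \<Longrightarrow> \<beta> \<in> R"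
  by (simp add: pos_roots_def)

lemma coef_nonneg: "\<beta> \<in> Rp \<Longrightarrow> \<gamma> \<in> F0 \<Longrightarrow> 0 \<le> coef \<beta> \<gamma>"
  by (auto simp: pos_roots_def coef_sum)

lemma pos_or_neg: "\<beta> \<in> R \<Longrightarrow> \<beta> \<in> Rp \<or> - \<beta> \<in> Rp"
  using simples_base[of \<beta>] minus_root[of \<beta>] by (auto simp: pos_roots_def)

lemma coef_minus: "\<beta> \<in> R \<Longrightarrow> coef (- \<beta>) \<gamma> = - coef \<beta> \<gamma>"
  by (simp add: real_vector.representation_neg[OF simples_independent] root_in_span)

text \<open>
  The coefficients of a root are all nonnegative or all nonpositive, so one positive coefficient decides.
\<close>

lemma pos_if_coef_pos: "\<beta> \<in> R \<Longrightarrow> \<gamma> \<in> F0 \<Longrightarrow> 0 < coef \<beta> \<gamma> \<Longrightarrow> \<beta> \<in> Rp"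
  using pos_or_neg[of \<beta>] coef_nonneg[of "-\<beta>" \<gamma>] by (auto simp: coef_minus)

lemma coef_refl: 
  assumes "\<alpha> \<in> F0" "\<beta> \<in> R"
  shows "coef (lrefl \<alpha> \<beta>) \<gamma> = coef \<beta> \<gamma> - (if \<gamma> = \<alpha> then pc \<beta> \<alpha> else 0)"
  using assms simples_roots
  by (auto simp: refl_eq real_vector.representation_diff[OF simples_independent] root_in_span
      span_scale span_base real_vector.representation_scale[OF simples_independent]
           real_vector.representation_basis[OF simples_independent])

lemma simple_root: "\<alpha> \<in> F0 \<Longrightarrow> \<alpha> \<in> R"
  using simples_roots by blast

lemma coef_simple: "\<alpha> \<in> F0 \<Longrightarrow> coef \<alpha> \<gamma> = (if \<gamma> = \<alpha> then 1 else 0)"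
  by (simp add: real_vector.representation_basis[OF simples_independent])

lemma simple_pos: "\<alpha> \<in> F0 \<Longrightarrow> \<alpha> \<in> Rp"
  using pos_if_coef_pos[of \<alpha> \<alpha>] by (simp add: simple_root coef_simple)

lemma ip_expansion: "\<beta> \<in> R \<Longrightarrow> ip x \<beta> = (\<Sum>\<gamma>\<in>F0. coef \<beta> \<gamma> * ip x \<gamma>)"
  using arg_cong[OF root_expansion[of \<beta>], of "ip x"] by (simp add: ip_sum_right)

lemma pos_coef_exists: 
  assumes "\<beta> \<in> Rp" 
  obtains \<gamma> where "\<gamma> \<in> F0" "0 < coef \<beta> \<gamma>"
proof -
  have "\<exists>\<gamma>\<in>F0. coef \<beta> \<gamma> \<noteq> 0"
    using root_expansion[of \<beta>] root_nonzero[of \<beta>] pos_root[OF assms]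
    by (metis (no_types, lifting) scaleR_eq_0_iff sum.neutral)
  then show thesis
    using coef_nonneg[OF assms] that by (metis less_eq_real_def)
qed

text \<open>
  A simple reflection changes only the coefficient of its own simple root, so a positive root with
  another nonzero coefficient stays positive. The multiple \<open>c\<close> need not be 1, because the double of
  a simple root may be a root.
\<close>

lemma refl_pos_or_multiple:
  assumes \<alpha>: "\<alpha> \<in> F0" and \<beta>: "\<beta> \<in> Rp" and neg: "lrefl \<alpha> \<beta> \<notin> Rp"
  obtains c where "c > 0" "\<beta> = c *\<^sub>R \<alpha>"
proof -
  have R: "\<beta> \<in> R" "lrefl \<alpha> \<beta> \<in> R" using \<alpha> \<beta> by (auto intro: refl_root simple_root pos_root)
  have z: "coef \<beta> \<gamma> = 0" if "\<gamma> \<in> F0" "\<gamma> \<noteq> \<alpha>" for \<gamma>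
  proof (rule ccontr)
    assume "coef \<beta> \<gamma> \<noteq> 0"
    then have "0 < coef (lrefl \<alpha> \<beta>) \<gamma>"
      using coef_nonneg[OF \<beta> that(1)] coef_refl[OF \<alpha> R(1), of \<gamma>] that by simp
    then show False
      using pos_if_coef_pos[OF R(2) that(1)] neg by blast
  qed
  have "0 < coef \<beta> \<alpha>" by (metis pos_coef_exists[OF \<beta>] z less_irrefl)
  moreover have "\<beta> = coef \<beta> \<alpha> *\<^sub>R \<alpha>"
  proof -
    have "(\<Sum>\<gamma>\<in>F0. coef \<beta> \<gamma> *\<^sub>R \<gamma>) = (\<Sum>\<gamma>\<in>{\<alpha>}. coef \<beta> \<gamma> *\<^sub>R \<gamma>)"
      using \<alpha> z finite_simples by (intro sum.mono_neutral_right) auto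
    then show ?thesis
      using root_expansion[OF R(1)] by simp
  qed
  ultimately show thesis by (rule that)
qed

definition outer :: "'v set \<Rightarrow> 'v set" where
  "outer J = Rp - pos_roots_on \<Phi> J"

lemma in_span_iff: 
  assumes "J \<subseteq> F0" "\<beta> \<in> R"
  shows "\<beta> \<in> span J \<longleftrightarrow> (\<forall>\<gamma>\<in>F0 - J. coef \<beta> \<gamma> = 0)"
proof
  assume "\<beta> \<in> span J"
  then show "\<forall>\<gamma>\<in>F0 - J. coef \<beta> \<gamma> = 0"
    using real_vector.representation_extend[OF simples_independent _ assms(1), of \<beta>]
      real_vector.representation_ne_zero[of J \<beta>]
    by auto
next
  assume z: "\<forall>\<gamma>\<in>F0 - J. coef \<beta> \<gamma> = 0"
  have "(\<Sum>\<gamma>\<in>F0. coef \<beta> \<gamma> *\<^sub>R \<gamma>) = (\<Sum>\<gamma>\<in>J. coef \<beta> \<gamma> *\<^sub>R \<gamma>)"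
    using assms(1) z finite_simples by (intro sum.mono_neutral_right) auto
  then show "\<beta> \<in> span J"
    using root_expansion[OF assms(2)] span_sum[of J "\<lambda>\<gamma>. coef \<beta> \<gamma> *\<^sub>R \<gamma>" J]
    by (simp add: span_scale span_base)
qed

text \<open>
  An outer root is recognised by a single positive coefficient outside \<open>J\<close>; reflections in \<open>J\<close> do not
  change that coefficient, which is why they preserve the outer roots.
\<close>

lemma outer_iff:
  assumes "J \<subseteq> F0" 
  shows "\<beta> \<in> outer J \<longleftrightarrow> \<beta> \<in> R \<and> (\<exists>\<gamma>\<in>F0 - J. 0 < coef \<beta> \<gamma>)"
  using in_span_iff[OF assms, of \<beta>] pos_if_coef_pos[of \<beta>] coef_nonneg[of \<beta>] pos_root[of \<beta>]
  unfolding outer_def pos_roots_on_def roots_on_def by force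

lemma refl_outer: "J \<subseteq> F0 \<Longrightarrow> \<alpha> \<in> J \<Longrightarrow> \<beta> \<in> outer J \<Longrightarrow> lrefl \<alpha> \<beta> \<in> outer J"
  by (auto simp: outer_iff subset_iff coef_refl simple_root intro!: refl_root)

lemma finite_outer: "finite (outer J)"
  using finite_roots by (auto simp: outer_def pos_roots_def)

text \<open>
  For \<open>J = \<emptyset>\<close> this is the sum of all positive roots. In general it is a vector of \<open>X\<close> that
  points strictly into the directions outside \<open>J\<close> and is orthogonal to those inside.
\<close>

definition rho :: "'v set \<Rightarrow> 'v" where
  "rho J = \<Sum>(outer J)"

text \<open>
  The reflection in \<open>\<alpha> \<in> J\<close> permutes the outer roots and negates their products with \<open>\<alpha>\<close>.
\<close>

lemma rho_inner:
  assumes J: "J \<subseteq> F0" and \<alpha>: "\<alpha> \<in> J"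
  shows "ip (rho J) \<alpha> = 0"
proof -
  have \<alpha>R: "\<alpha> \<in> R" using J \<alpha> simple_root by blast
  have "ip (rho J) \<alpha> = (\<Sum>\<beta>\<in>outer J. ip \<beta> \<alpha>)"
    by (simp add: rho_def ip_sum_left)
  also have "\<dots> = (\<Sum>\<beta>\<in>outer J. ip (lrefl \<alpha> \<beta>) \<alpha>)"
    by (rule sum.reindex_bij_witness[of _ "lrefl \<alpha>" "lrefl \<alpha>"])
       (use \<alpha>R refl_outer[OF J \<alpha>] in \<open>simp_all add: reflection_involution\<close>)
  also have "\<dots> = - (\<Sum>\<beta>\<in>outer J. ip \<beta> \<alpha>)"
    using \<alpha>R by (simp add: ip_refl' refl_self sum_negf)
  finally show ?thesis
    by (simp add: rho_def ip_sum_left)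
qed

text \<open>
  The reflection in \<open>\<gamma>\<close> no longer permutes the outer roots. Those that it keeps among the outer roots
  cancel in the sum of the products with \<open>\<gamma>\<close>; each of the remaining ones is a multiple of \<open>\<gamma>\<close> or is
  sent into \<open>R\<^sub>J\<close>, and in both cases its product with \<open>\<gamma>\<close> is nonnegative. One of them is \<open>\<gamma>\<close> itself.
\<close>

lemma rho_simple_pos:
  assumes J: "J \<subseteq> F0" and \<gamma>: "\<gamma> \<in> F0 - J"
  shows "ip (rho J) \<gamma> > 0"
proof -
  have \<gamma>R: "\<gamma> \<in> R" and \<gamma>F: "\<gamma> \<in> F0" using \<gamma> simple_root by auto
  define A where "A = {\<beta> \<in> outer J. lrefl \<gamma> \<beta> \<in> outer J}"
  have "(\<Sum>\<beta>\<in>A. ip \<beta> \<gamma>) = (\<Sum>\<beta>\<in>A. ip (lrefl \<gamma> \<beta>) \<gamma>)"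
    by (rule sum.reindex_bij_witness[of _ "lrefl \<gamma>" "lrefl \<gamma>"])
       (use \<gamma>R in \<open>auto simp: reflection_involution A_def\<close>)
  also have "\<dots> = - (\<Sum>\<beta>\<in>A. ip \<beta> \<gamma>)"
    using \<gamma>R by (simp add: ip_refl' refl_self sum_negf)
  finally have A0: "(\<Sum>\<beta>\<in>A. ip \<beta> \<gamma>) = 0" by simp
  have rest: "0 \<le> ip \<beta> \<gamma>" if "\<beta> \<in> outer J - A" for \<beta>
  proof -
    have \<beta>: "\<beta> \<in> Rp" "\<beta> \<in> R" and nA: "lrefl \<gamma> \<beta> \<notin> outer J"
      using that by (auto simp: A_def outer_def pos_root)
    show ?thesis
    proof (cases "lrefl \<gamma> \<beta> \<in> Rp")
      case True
      then have "lrefl \<gamma> \<beta> \<in> span J"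
        using nA by (auto simp: outer_def pos_roots_on_def roots_on_def pos_root)
      then have "coef (lrefl \<gamma> \<beta>) \<gamma> = 0"
        using in_span_iff[OF J, of "lrefl \<gamma> \<beta>"] \<gamma> \<beta> \<gamma>R by (simp add: refl_root)
      then have "pc \<beta> \<gamma> \<ge> 0"
        using coef_refl[OF \<gamma>F \<beta>(2), of \<gamma>] coef_nonneg[OF \<beta>(1) \<gamma>F] by simp
      then show ?thesis
        using pc_neg_iff[OF \<gamma>R, of \<beta>] by linarith
    next
      case False
      then obtain c where "c > 0" "\<beta> = c *\<^sub>R \<gamma>"
        using refl_pos_or_multiple[OF \<gamma>F \<beta>(1)] by blast
      then show ?thesis using ip_self_pos[OF \<gamma>R] by simp
    qed
  qed
  \<comment> \<open>The root \<open>\<gamma>\<close> is not among those that cancel, and makes the sum strictly positive.\<close>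
  have "- \<gamma> \<notin> outer J"
    using coef_nonneg[of "-\<gamma>" \<gamma>] coef_minus[OF \<gamma>R, of \<gamma>] coef_simple[OF \<gamma>F, of \<gamma>] \<gamma>F
    by (auto simp: outer_def)
  then have mem: "\<gamma> \<in> outer J - A"
    using \<gamma> \<gamma>R by (auto simp: outer_iff[OF J] A_def coef_simple refl_self)
  have "ip (rho J) \<gamma> = (\<Sum>\<beta>\<in>outer J - A. ip \<beta> \<gamma>) + (\<Sum>\<beta>\<in>A. ip \<beta> \<gamma>)"
    unfolding rho_def ip_sum_left
    by (rule sum.subset_diff) (auto simp: A_def finite_outer)
  also have "\<dots> > 0"
    using A0 sum_pos2[of "outer J - A" \<gamma> "\<lambda>\<beta>. ip \<beta> \<gamma>"] mem rest finite_outer ip_self_pos[OF \<gamma>R]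
    by simp
  finally show ?thesis .
qed

lemma latX_add: "x \<in> X \<Longrightarrow> y \<in> X \<Longrightarrow> x + y \<in> X"
  and latX_scale: "x \<in> X \<Longrightarrow> of_int k *\<^sub>R x \<in> X"
proof -
  obtain B where X: "X = {\<Sum>b\<in>B. of_int (n b) *\<^sub>R b | n :: 'v \<Rightarrow> int. True}"
    using latX unfolding full_lattice_def by blast
  show "x + y \<in> X" if "x \<in> X" "y \<in> X"
  proof -
    obtain n m where "x = (\<Sum>b\<in>B. of_int (n b) *\<^sub>R b)" "y = (\<Sum>b\<in>B. of_int (m b) *\<^sub>R b)"
      using \<open>x \<in> X\<close> \<open>y \<in> X\<close> unfolding X by auto
    then have "x + y = (\<Sum>b\<in>B. of_int (n b + m b) *\<^sub>R b)"
      by (simp add: sum.distrib scaleR_add_left)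
    then show ?thesis unfolding X by (intro CollectI exI conjI TrueI)
  qed
  show "of_int k *\<^sub>R x \<in> X" if "x \<in> X"
  proof -
    obtain n where "x = (\<Sum>b\<in>B. of_int (n b) *\<^sub>R b)" using \<open>x \<in> X\<close> unfolding X by auto
    then have "of_int k *\<^sub>R x = (\<Sum>b\<in>B. of_int (k * n b) *\<^sub>R b)"
      by (simp add: scaleR_sum_right)
    then show ?thesis unfolding X by (intro CollectI exI conjI TrueI)
  qed
qed

lemma latX_zero: "0 \<in> X"
proof -
  obtain B where X: "X = {\<Sum>b\<in>B. of_int (n b) *\<^sub>R b | n :: 'v \<Rightarrow> int. True}"
    using latX unfolding full_lattice_def by blast
  have "0 = (\<Sum>b\<in>B. of_int ((\<lambda>_. 0) b) *\<^sub>R b)" by simp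
  then show ?thesis unfolding X by (intro CollectI exI conjI TrueI)
qed

lemma latX_minus: "x \<in> X \<Longrightarrow> - x \<in> X"
  using latX_scale[of x "-1"] by simp

lemma latX_diff: "x \<in> X \<Longrightarrow> y \<in> X \<Longrightarrow> x - y \<in> X"
  using latX_add[of x "-y"] latX_minus by simp

lemma rho_latX: "rho J \<in> X"
proof -
  have *: "sum f A \<in> X" if "\<And>a. a \<in> A \<Longrightarrow> f a \<in> X" for f :: "'v \<Rightarrow> 'v" and A
    using that by (induction A rule: infinite_finite_induct) (auto simp: latX_zero latX_add)
  show ?thesis
    unfolding rho_def
  proof (rule *)
    fix a assume "a \<in> outer J"
    then show "a \<in> X" using roots_lattice pos_root[of a] by (auto simp: outer_def)
  qed
qed

text \<open>
  Positivity on simple roots extends to all outer roots by expansion; integrality of the pairing on \<open>X\<close>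
  then gives the bound 1.
\<close>

lemma pc_rho_outer: 
  assumes J: "J \<subseteq> F0" and \<beta>: "\<beta> \<in> outer J"
  shows "1 \<le> pc (rho J) \<beta>"
proof -
  have \<beta>R: "\<beta> \<in> R" "\<beta> \<in> Rp" using \<beta> by (auto simp: outer_def pos_root)
  obtain \<gamma> where \<gamma>: "\<gamma> \<in> F0 - J" "0 < coef \<beta> \<gamma>" using \<beta> outer_iff[OF J] by blast
  have nonneg: "0 \<le> ip (rho J) \<delta>" if "\<delta> \<in> F0" for \<delta>
    using rho_inner[OF J, of \<delta>] rho_simple_pos[OF J, of \<delta>] that by (cases "\<delta> \<in> J") auto
  have "0 < ip (rho J) \<beta>"
    unfolding ip_expansion[OF \<beta>R(1)]
  proof (rule sum_pos2[OF finite_simples, of \<gamma>])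
    show "0 < coef \<beta> \<gamma> * ip (rho J) \<gamma>" using \<gamma> rho_simple_pos[OF J, of \<gamma>] by simp
  qed (use \<gamma> nonneg coef_nonneg[OF \<beta>R(2)] in auto)
  then have "0 < pc (rho J) \<beta>" using pc_pos_iff \<beta>R(1) by blast
  moreover obtain k where "pc (rho J) \<beta> = of_int k"
    using pc_integral[OF rho_latX \<beta>R(1)] by (auto elim: Ints_cases)
  ultimately show ?thesis by simp
qed

lemma pc_rho_inner: 
  assumes J: "J \<subseteq> F0" and \<beta>: "\<beta> \<in> R" "\<beta> \<in> span J"
  shows "pc (rho J) \<beta> = 0"
proof -
  have "coef \<beta> \<gamma> * ip (rho J) \<gamma> = 0" if "\<gamma> \<in> F0" for \<gamma>
    using in_span_iff[OF J \<beta>(1)] \<beta>(2) rho_inner[OF J] that by (cases "\<gamma> \<in> J") auto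
  then show ?thesis
    using \<beta>(1) sum.neutral[of F0 "\<lambda>\<gamma>. coef \<beta> \<gamma> * ip (rho J) \<gamma>"]
    by (simp add: pc_zero_iff ip_expansion)
qed

lemma outer_empty: "outer {} = Rp"
  using root_nonzero by (auto simp: outer_def pos_roots_on_def roots_on_def)

section \<open>The base alcove\<close>

text \<open>
  A small positive multiple of the sum of the positive roots lies in the alcove.
\<close>

lemma base_alcove_nonempty: "base_alcove \<Phi> \<noteq> {}"
proof -
  define M where "M = 1 + (\<Sum>\<beta>\<in>R. \<bar>pc (rho {}) \<beta>\<bar>)"
  have M: "\<bar>pc (rho {}) \<beta>\<bar> < M" "M > 0" if "\<beta> \<in> R" for \<beta>
    using member_le_sum[of \<beta> R "\<lambda>\<beta>. \<bar>pc (rho {}) \<beta>\<bar>"] that finite_roots by (auto simp: M_def)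
  have "(1 / M) *\<^sub>R rho {} \<in> base_alcove \<Phi>"
    unfolding base_alcove_def
  proof (intro CollectI ballI)
    fix \<beta> assume \<beta>: "\<beta> \<in> Rp"
    have "1 \<le> pc (rho {}) \<beta>" using pc_rho_outer[of "{}" \<beta>] \<beta> by (simp add: outer_empty)
    then have "0 < pc (rho {}) \<beta>" "pc (rho {}) \<beta> < M" "0 < M"
      using M[OF pos_root[OF \<beta>]] by linarith+
    then show "0 < pc ((1 / M) *\<^sub>R rho {}) \<beta> \<and> pc ((1 / M) *\<^sub>R rho {}) \<beta> < 1"
      by simp
  qed
  then show ?thesis by blast
qed

text \<open>
  A base point of the alcove. Every element of the extended affine Weyl group maps hyperplanes to
  hyperplanes, so the position of an alcove \<open>gC\<^sub>0\<close> can be read off from the single point \<open>g v0\<close>.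
\<close>

definition v0 :: 'v where "v0 = (SOME v. v \<in> base_alcove \<Phi>)"

lemma v0_alcove: "v0 \<in> base_alcove \<Phi>"
  unfolding v0_def using base_alcove_nonempty by (simp add: some_in_eq)

lemma v0_pos: "\<beta> \<in> Rp \<Longrightarrow> 0 < pc v0 \<beta>" and v0_less: "\<beta> \<in> Rp \<Longrightarrow> pc v0 \<beta> < 1"
  using v0_alcove by (auto simp: base_alcove_def)

end

section \<open>The extended affine Weyl group\<close>

lemma comp_inv_bij: "bij g \<Longrightarrow> g \<circ> inv g = id" "bij g \<Longrightarrow> inv g \<circ> g = id"
  by (simp_all add: bij_is_surj bij_is_inj flip: surj_iff inj_iff)

lemma inv_app: "bij g \<Longrightarrow> g (inv g v) = v" "bij g \<Longrightarrow> inv g (g v) = v"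
  by (simp_all add: bij_is_surj bij_is_inj surj_f_inv_f)

context based_root_datum
begin

text \<open>
  Automorphisms of the root datum that need not preserve the base. This group contains the Weyl group
  as well as \<open>\<Gamma>\<close>, so the linear parts of all elements of \<open>X \<rtimes> (W\<^sub>0 \<rtimes> \<Gamma>)\<close> can be treated alike.
\<close>

definition aut :: "('v \<Rightarrow> 'v) set" where
  "aut = {g. linear g \<and> bij g \<and> g ` X = X \<and> g ` R = R \<and> (\<forall>\<alpha>\<in>R. \<forall>v. pc (g v) (g \<alpha>) = pc v \<alpha>)}"

lemma aut_linear: "g \<in> aut \<Longrightarrow> linear g"
  and aut_bij: "g \<in> aut \<Longrightarrow> bij g"
  and aut_latX: "g \<in> aut \<Longrightarrow> x \<in> X \<Longrightarrow> g x \<in> X"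
  and aut_root: "g \<in> aut \<Longrightarrow> \<alpha> \<in> R \<Longrightarrow> g \<alpha> \<in> R"
  and pc_aut: "g \<in> aut \<Longrightarrow> \<alpha> \<in> R \<Longrightarrow> pc (g v) (g \<alpha>) = pc v \<alpha>"
  by (auto simp: aut_def)

lemma autI: "linear g \<Longrightarrow> bij g \<Longrightarrow> g ` X = X \<Longrightarrow> g ` R = R \<Longrightarrow>
    (\<And>\<alpha> v. \<alpha> \<in> R \<Longrightarrow> pc (g v) (g \<alpha>) = pc v \<alpha>) \<Longrightarrow> g \<in> aut"
  by (simp add: aut_def)

lemma aut_comp: 
  assumes g: "g \<in> aut" and h: "h \<in> aut"
  shows "g \<circ> h \<in> aut"
proof (rule autI)
  show "linear (g \<circ> h)" by (rule linear_compose) (fact aut_linear[OF h] aut_linear[OF g])+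
  show "bij (g \<circ> h)" by (rule bij_comp) (fact aut_bij[OF h] aut_bij[OF g])+
  show "(g \<circ> h) ` X = X" "(g \<circ> h) ` R = R"
    using g h by (simp_all add: aut_def flip: image_image)
  show "pc ((g \<circ> h) v) ((g \<circ> h) \<alpha>) = pc v \<alpha>" if "\<alpha> \<in> R" for v \<alpha>
    using that by (simp add: pc_aut[OF g] pc_aut[OF h] aut_root[OF h])
qed

lemma aut_inv: 
  assumes g: "g \<in> aut"
  shows "inv g \<in> aut"
proof -
  note b = aut_bij[OF g]
  have l: "linear (inv g)"
    by (rule linearI; rule injD[OF bij_is_inj[OF b]])
      (simp_all add: linear_add[OF aut_linear[OF g]] linear_scale[OF aut_linear[OF g]] inv_app[OF b])
  have im: "inv g ` A = A" if "g ` A = A" for A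
    using image_inv_f_f[OF bij_is_inj[OF b], of A] that by simp
  have pc: "pc (inv g v) (inv g \<alpha>) = pc v \<alpha>" if "\<alpha> \<in> R" for v \<alpha>
  proof -
    have "g ` R = R" using g by (simp add: aut_def)
    then have "inv g \<alpha> \<in> R" using that im[of R] by blast
    from pc_aut[OF g this, of "inv g v"] show ?thesis by (simp add: inv_app[OF b])
  qed
  have "g ` X = X" "g ` R = R" using g by (simp_all add: aut_def)
  then show ?thesis
    by (intro autI l bij_imp_bij_inv[OF b] im pc)
qed

lemma pc_aut': "g \<in> aut \<Longrightarrow> \<alpha> \<in> R \<Longrightarrow> pc (g v) \<alpha> = pc v (inv g \<alpha>)"
  using pc_aut[of "inv g" \<alpha> "g v"] by (simp add: aut_inv inv_app(2)[OF aut_bij])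

lemma lrefl_aut: 
  assumes \<alpha>: "\<alpha> \<in> R"
  shows "lrefl \<alpha> \<in> aut"
proof -
  have inv: "lrefl \<alpha> (lrefl \<alpha> v) = v" for v using reflection_involution[OF \<alpha>] .
  have "lrefl \<alpha> x \<in> X" if x: "x \<in> X" for x
  proof -
    obtain k where k: "pc x \<alpha> = of_int k"
      using pc_integral[OF x \<alpha>] by (auto elim: Ints_cases)
    have "\<alpha> \<in> X" using \<alpha> roots_lattice by blast
    then show ?thesis using x by (simp add: refl_eq k latX_diff latX_scale)
  qed
  then have "lrefl \<alpha> ` X = X" by (metis (no_types, lifting) inv image_eqI image_subset_iff subset_antisym subsetI)
  moreover have "lrefl \<alpha> ` R = R" 
    using refl_root[OF \<alpha>] by (metis (no_types, lifting) inv image_eqI image_subset_iff subset_antisym subsetI)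
  moreover have "bij (lrefl \<alpha>)" by (rule o_bij[of "lrefl \<alpha>"]) (auto simp: inv)
  ultimately show ?thesis
    using refl_linear pc_refl[OF \<alpha>] by (intro autI)
qed

lemma refl_group_aut: "w \<in> refl_group \<Phi> J \<Longrightarrow> J \<subseteq> R \<Longrightarrow> w \<in> aut"
proof (induction rule: refl_group.induct)
  case 1
  show ?case using linear_id bij_id by (simp add: aut_def id_def)
next
  case (2 \<alpha> w)
  then show ?case by (intro aut_comp lrefl_aut) blast+
qed

lemma refl_group_comp: "w \<in> refl_group \<Phi> J \<Longrightarrow> u \<in> refl_group \<Phi> J \<Longrightarrow> w \<circ> u \<in> refl_group \<Phi> J"
  by (induction rule: refl_group.induct) (auto simp: comp_assoc intro: refl_group.intros)

lemma lrefl_refl_group: "\<alpha> \<in> J \<Longrightarrow> lrefl \<alpha> \<in> refl_group \<Phi> J"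
  using refl_group.intros(2)[OF _ refl_group.intros(1)] by fastforce

lemma inv_lrefl: "\<alpha> \<in> R \<Longrightarrow> inv (lrefl \<alpha>) = lrefl \<alpha>"
  by (rule inv_equality) (simp_all add: reflection_involution)

lemma refl_group_inv: "w \<in> refl_group \<Phi> J \<Longrightarrow> J \<subseteq> R \<Longrightarrow> inv w \<in> refl_group \<Phi> J"
proof (induction rule: refl_group.induct)
  case 1
  show ?case unfolding inv_id by (rule refl_group.intros)
next
  case (2 \<alpha> w)
  then have "inv (lrefl \<alpha> \<circ> w) = inv w \<circ> lrefl \<alpha>"
    by (subst o_inv_distrib) (auto intro: aut_bij lrefl_aut refl_group_aut simp: inv_lrefl subset_iff)
  then show ?case using 2 by (simp only: refl_group_comp lrefl_refl_group)
qed

lemma refl_group_mono: "w \<in> refl_group \<Phi> J \<Longrightarrow> J \<subseteq> K \<Longrightarrow> w \<in> refl_group \<Phi> K"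
  by (induction rule: refl_group.induct) (auto intro: refl_group.intros)

lemma aut_lrefl: "g \<in> aut \<Longrightarrow> \<alpha> \<in> R \<Longrightarrow> g (lrefl \<alpha> v) = lrefl (g \<alpha>) (g v)"
  by (simp add: refl_eq pc_aut linear_diff linear_scale aut_linear)

lemma aut_conj_weyl: 
  assumes "w \<in> weyl_group \<Phi>" "g \<in> aut"
  shows "g \<circ> w \<circ> inv g \<in> weyl_group \<Phi>"
  using assms
proof (induction rule: refl_group.induct)
  case 1
  then have "g \<circ> id \<circ> inv g = id" by (simp add: comp_inv_bij(1)[OF aut_bij])
  then show ?case by (simp only: refl_group.intros)
next
  case (2 \<alpha> w)
  have "g \<circ> (lrefl \<alpha> \<circ> w) \<circ> inv g = lrefl (g \<alpha>) \<circ> (g \<circ> w \<circ> inv g)"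
    using aut_lrefl 2 by (auto simp: fun_eq_iff)
  then show ?case using 2 by (simp only: refl_group.intros(2)[OF aut_root])
qed

end

context root_datum_with_automorphisms
begin

abbreviation "W \<equiv> ext_affine_weyl \<Phi> \<Gamma>"

lemma Gamma_aut: "\<delta> \<in> \<Gamma> \<Longrightarrow> \<delta> \<in> aut"
  using automorphisms by (auto simp: based_automorphism_def aut_def)

lemma W_intro: "x \<in> X \<Longrightarrow> w \<in> weyl_group \<Phi> \<Longrightarrow> \<delta> \<in> \<Gamma> \<Longrightarrow> translation x \<circ> w \<circ> \<delta> \<in> W"
  unfolding ext_affine_weyl_def by blast

lemma translation_W: "x \<in> X \<Longrightarrow> translation x \<in> W"
  using W_intro[of x id id] by (simp add: refl_group.intros id_automorphism)

lemma weyl_W: "w \<in> weyl_group \<Phi> \<Longrightarrow> w \<in> W"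
  using W_intro[of 0 w id] by (simp add: latX_zero id_automorphism translation_def o_def)

lemma Gamma_W: "\<delta> \<in> \<Gamma> \<Longrightarrow> \<delta> \<in> W"
  using W_intro[of 0 id \<delta>] by (simp add: latX_zero refl_group.intros translation_def o_def)

lemma id_W: "id \<in> W"
  using Gamma_W id_automorphism by blast

lemma W_cases:
  assumes "w \<in> W"
  obtains x g where "x \<in> X" "g \<in> aut" "w = translation x \<circ> g"
proof -
  obtain x a \<delta> where w: "w = translation x \<circ> a \<circ> \<delta>" "x \<in> X" "a \<in> weyl_group \<Phi>" "\<delta> \<in> \<Gamma>"
    using assms unfolding ext_affine_weyl_def by blast
  show thesis
  proof (rule that[of x "a \<circ> \<delta>"])
    show "a \<circ> \<delta> \<in> aut" using w by (intro aut_comp refl_group_aut[OF _ subset_refl] Gamma_aut)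
  qed (simp_all only: w comp_assoc)
qed

lemma W_comp:
  assumes "v \<in> W" "w \<in> W"
  shows "v \<circ> w \<in> W"
proof -
  obtain x a \<delta> where v: "v = translation x \<circ> a \<circ> \<delta>" "x \<in> X" "a \<in> weyl_group \<Phi>" "\<delta> \<in> \<Gamma>"
    using assms(1) unfolding ext_affine_weyl_def by blast
  obtain y b \<epsilon> where w: "w = translation y \<circ> b \<circ> \<epsilon>" "y \<in> X" "b \<in> weyl_group \<Phi>" "\<epsilon> \<in> \<Gamma>"
    using assms(2) unfolding ext_affine_weyl_def by blast
  have a: "a \<in> aut" and \<delta>: "\<delta> \<in> aut"
    using refl_group_aut[OF v(3) subset_refl] Gamma_aut[OF v(4)] .
  have "v \<circ> w = translation (x + a (\<delta> y)) \<circ> (a \<circ> (\<delta> \<circ> b \<circ> inv \<delta>)) \<circ> (\<delta> \<circ> \<epsilon>)"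
    by (simp add: v(1) w(1) fun_eq_iff translation_def inv_app[OF aut_bij[OF \<delta>]] add.assoc
        linear_add[OF aut_linear[OF \<delta>]] linear_add[OF aut_linear[OF a]])
  also have "\<dots> \<in> W"
  proof (rule W_intro)
    show "x + a (\<delta> y) \<in> X"
      by (rule latX_add[OF v(2) aut_latX[OF a aut_latX[OF \<delta> w(2)]]])
    show "a \<circ> (\<delta> \<circ> b \<circ> inv \<delta>) \<in> weyl_group \<Phi>"
      by (rule refl_group_comp[OF v(3) aut_conj_weyl[OF w(3) \<delta>]])
  qed (rule comp_automorphism[OF v(4) w(4)])
  finally show ?thesis .
qed

lemma W_bij: "w \<in> W \<Longrightarrow> bij w"
proof (erule W_cases)
  fix x g assume "g \<in> aut" and w: "w = translation x \<circ> g"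
  moreover have "bij (translation x)"
    by (rule o_bij[of "translation (- x)"]) (simp_all add: translation_def fun_eq_iff)
  ultimately show "bij w" unfolding w by (metis bij_comp aut_bij)
qed

lemma W_inv: 
  assumes "w \<in> W"
  shows "inv w \<in> W"
proof -
  obtain x a \<delta> where v: "w = translation x \<circ> a \<circ> \<delta>" "x \<in> X" "a \<in> weyl_group \<Phi>" "\<delta> \<in> \<Gamma>"
    using assms unfolding ext_affine_weyl_def by blast
  have a: "a \<in> aut" and \<delta>: "\<delta> \<in> aut"
    using refl_group_aut[OF v(3) subset_refl] Gamma_aut[OF v(4)] .
  have "inv w = inv \<delta> \<circ> (inv a \<circ> translation (- x))"
    by (rule inv_equality)
       (simp_all add: v translation_def inv_app[OF aut_bij[OF \<delta>]] inv_app[OF aut_bij[OF a]])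
  also have "\<dots> \<in> W"
    by (intro W_comp Gamma_W weyl_W translation_W inv_automorphism refl_group_inv[OF _ subset_refl]
        latX_minus v)
  finally show ?thesis .
qed

lemma W_inv_app: "w \<in> W \<Longrightarrow> w (inv w v) = v" "w \<in> W \<Longrightarrow> inv w (w v) = v"
  using inv_app[OF W_bij] by blast+

lemma W_inv_comp: "v \<in> W \<Longrightarrow> w \<in> W \<Longrightarrow> inv (v \<circ> w) = inv w \<circ> inv v"
  by (simp add: o_inv_distrib W_bij)

lemma reflection_eq: "reflection \<Phi> \<alpha> k = translation (of_int k *\<^sub>R \<alpha>) \<circ> lrefl \<alpha>"
  by (auto simp: reflection_def translation_def fun_eq_iff algebra_simps)

lemma reflection_W: 
  assumes "\<alpha> \<in> R"
  shows "reflection \<Phi> \<alpha> k \<in> W"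
  by (subst reflection_eq) (rule W_comp[OF translation_W[OF latX_scale[OF subsetD[OF roots_lattice assms]]]
        weyl_W[OF lrefl_refl_group[OF assms]]])

lemma inv_reflection: "\<alpha> \<in> R \<Longrightarrow> inv (reflection \<Phi> \<alpha> k) = reflection \<Phi> \<alpha> k"
  by (rule inv_equality) (simp_all add: reflection_involution)

text \<open>
  The level functions \<open>v \<mapsto> \<langle>v, \<alpha>\<^sup>\<or>\<rangle> - k\<close> are permuted by the extended affine Weyl group, because
  the pairing is integral on \<open>X\<close> and invariant under linear parts.
\<close>

lemma W_pull:
  assumes g: "g \<in> W" and \<alpha>: "\<alpha> \<in> R"
  obtains \<beta> c where "\<beta> \<in> R" "\<And>v. pc (g v) \<alpha> = pc v \<beta> + of_int c"
proof -
  obtain x h where x: "x \<in> X" "h \<in> aut" "g = translation x \<circ> h" using W_cases[OF g] .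
  obtain c where "pc x \<alpha> = of_int c" using pc_integral[OF x(1) \<alpha>] by (auto elim: Ints_cases)
  then show thesis
    using that[of "inv h \<alpha>" c] x \<alpha> by (simp add: translation_def pc_aut' aut_root aut_inv)
qed

lemma W_affine:
  assumes "g \<in> W"
  shows "g (v + t *\<^sub>R (w - v)) = g v + t *\<^sub>R (g w - g v)"
  by (rule W_cases[OF assms])
     (simp add: translation_def linear_add linear_scale linear_diff aut_linear)

section \<open>Separating hyperplanes and length\<close>

definition regular :: "'v \<Rightarrow> bool" where
  "regular p \<longleftrightarrow> (\<forall>\<alpha>\<in>R. \<forall>k. pc p \<alpha> \<noteq> of_int k)"

text \<open>
  For regular points, the hyperplanes that separate \<open>p\<close> from \<open>q\<close>. A hyperplane may be the zero set of
  several level functions; formulating separation by segments refers to the set alone, and makes the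
  equivariance under affine maps evident.
\<close>

definition sep :: "'v \<Rightarrow> 'v \<Rightarrow> 'v set set" where
  "sep p q = {H \<in> hyperplanes \<Phi>. closed_segment p q \<inter> H \<noteq> {}}"

lemma hyperplanes_cases:
  assumes "H \<in> hyperplanes \<Phi>"
  obtains \<alpha> k where "\<alpha> \<in> R" "H = hyperplane \<Phi> \<alpha> k"
  using assms unfolding hyperplanes_def by blast

lemma hyperplane_minus: "\<alpha> \<in> R \<Longrightarrow> hyperplane \<Phi> (- \<alpha>) (- k) = hyperplane \<Phi> \<alpha> k"
  by (auto simp: hyperplane_def pc_minus_root)

lemma hyperplanes_cases_pos:
  assumes "H \<in> hyperplanes \<Phi>"
  obtains \<alpha> k where "\<alpha> \<in> Rp" "H = hyperplane \<Phi> \<alpha> k"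
  using hyperplanes_cases[OF assms] pos_or_neg hyperplane_minus by metis

lemma regular_side: 
  assumes "regular p" "\<alpha> \<in> R"
  shows "of_int k < pc p \<alpha> \<longleftrightarrow> \<not> pc p \<alpha> < of_int k"
proof -
  have "pc p \<alpha> \<noteq> of_int k" using assms by (simp add: regular_def)
  then show ?thesis by linarith
qed

lemma mem_sep_iff:
  assumes p: "regular p" and q: "regular q" and \<alpha>: "\<alpha> \<in> R"
  shows "hyperplane \<Phi> \<alpha> k \<in> sep p q \<longleftrightarrow> (pc p \<alpha> < of_int k) \<noteq> (pc q \<alpha> < of_int k)"
proof
  assume "hyperplane \<Phi> \<alpha> k \<in> sep p q"
  then obtain u where u: "0 \<le> u" "u \<le> 1" "pc ((1 - u) *\<^sub>R p + u *\<^sub>R q) \<alpha> = of_int k"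
    by (auto simp: sep_def hyperplane_def closed_segment_def)
  have ne: "pc p \<alpha> \<noteq> of_int k" "pc q \<alpha> \<noteq> of_int k" using p q \<alpha> by (auto simp: regular_def)
  have "(1 - u) * (pc p \<alpha> - of_int k) + u * (pc q \<alpha> - of_int k) = 0"
    using u(3) by (simp add: algebra_simps)
  moreover have "(1 - u) * a + u * b > 0" if "a > 0" "b > 0" for a b :: real
    using u that by (cases "u = 0") (auto intro: add_nonneg_pos)
  ultimately show "(pc p \<alpha> < of_int k) \<noteq> (pc q \<alpha> < of_int k)"
    using ne 
    by (smt (verit) mult_minus_right)
next
  assume d: "(pc p \<alpha> < of_int k) \<noteq> (pc q \<alpha> < of_int k)"
  define a where "a = pc p \<alpha> - of_int k" define b where "b = pc q \<alpha> - of_int k"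
  define u where "u = a / (a - b)"
  have "a \<noteq> 0" "b \<noteq> 0" using p q \<alpha> by (auto simp: regular_def a_def b_def)
  with d have ab: "a < 0 \<and> 0 < b \<or> b < 0 \<and> 0 < a" by (auto simp: a_def b_def)
  then have u: "0 \<le> u" "u \<le> 1" by (auto simp: u_def divide_le_eq zero_le_divide_iff)
  have "a - u * (a - b) = 0" using ab by (auto simp: u_def)
  then have "pc ((1 - u) *\<^sub>R p + u *\<^sub>R q) \<alpha> = of_int k" by (simp add: a_def b_def algebra_simps)
  then show "hyperplane \<Phi> \<alpha> k \<in> sep p q"
    using u \<alpha> by (auto simp: sep_def hyperplane_def hyperplanes_def closed_segment_def)
qed

lemma sep_sym: "sep p q = sep q p"
  by (simp add: sep_def closed_segment_commute)

lemma sep_hyperplane: "H \<in> sep p q \<Longrightarrow> H \<in> hyperplanes \<Phi>"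
  by (simp add: sep_def)

lemma sep_diff:
  assumes "regular p" "regular q" "regular r" "H \<in> hyperplanes \<Phi>"
  shows "H \<in> sep p r \<longleftrightarrow> (H \<in> sep p q) \<noteq> (H \<in> sep q r)"
  by (rule hyperplanes_cases[OF assms(4)]) (use assms(1-3) in \<open>auto simp: mem_sep_iff\<close>)

lemma regular_W: "g \<in> W \<Longrightarrow> regular p \<Longrightarrow> regular (g p)"
  unfolding regular_def
  by (metis W_pull add_diff_cancel_right' of_int_diff)

lemma hyperplane_W_image:
  assumes g: "g \<in> W" and H: "H \<in> hyperplanes \<Phi>"
  shows "g ` H \<in> hyperplanes \<Phi>"
proof -
  obtain \<alpha> k where \<alpha>: "\<alpha> \<in> R" "H = hyperplane \<Phi> \<alpha> k" using hyperplanes_cases[OF H] .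
  obtain \<beta> c where \<beta>: "\<beta> \<in> R" "\<And>v. pc (inv g v) \<alpha> = pc v \<beta> + of_int c"
    using W_pull[OF W_inv[OF g] \<alpha>(1)] by blast
  have "g ` H = {v. inv g v \<in> H}"
    using W_inv_app[OF g] by (auto simp: image_iff) metis
  also have "\<dots> = hyperplane \<Phi> \<beta> (k - c)"
    by (auto simp: \<alpha>(2) hyperplane_def \<beta>)
  finally show ?thesis using \<beta>(1) unfolding hyperplanes_def by blast
qed

lemma closed_segment_W_image:
  assumes "g \<in> W" 
  shows "closed_segment (g p) (g q) = g ` closed_segment p q"
  unfolding closed_segment_image_interval image_image
proof (rule image_cong[OF HOL.refl])
  fix u :: real
  show "(1 - u) *\<^sub>R g p + u *\<^sub>R g q = g ((1 - u) *\<^sub>R p + u *\<^sub>R q)"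
    using W_affine[OF assms, of p u q] by (simp add: algebra_simps)
qed

lemma image_mem_sep:
  assumes g: "g \<in> W" 
  shows "g ` H \<in> sep (g p) (g q) \<longleftrightarrow> H \<in> sep p q"
proof -
  have "H \<in> hyperplanes \<Phi>" if "g ` H \<in> hyperplanes \<Phi>"
    using hyperplane_W_image[OF W_inv[OF g] that]
    by (simp add: image_image W_inv_app[OF g])
  moreover have "closed_segment (g p) (g q) \<inter> g ` H = g ` (closed_segment p q \<inter> H)"
    using closed_segment_W_image[OF g] image_Int[OF bij_is_inj[OF W_bij[OF g]]] by metis
  ultimately show ?thesis
    using hyperplane_W_image[OF g] by (auto simp: sep_def)
qed

lemma sep_W_image:
  assumes g: "g \<in> W" 
  shows "sep (g p) (g q) = (`) g ` sep p q"
proof (intro equalityI subsetI)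
  fix H assume H: "H \<in> sep (g p) (g q)"
  have "H = g ` (inv g ` H)" by (simp add: image_image W_inv_app[OF g])
  then show "H \<in> (`) g ` sep p q" using H image_mem_sep[OF g] by (metis image_eqI)
qed (auto simp: image_mem_sep[OF g])

lemma card_sep_W: "g \<in> W \<Longrightarrow> card (sep (g p) (g q)) = card (sep p q)"
  unfolding sep_W_image
  by (rule card_image) (auto intro: inj_on_subset[OF inj_on_image_Pow] simp: inj_on_def inj_image_eq_iff[OF bij_is_inj[OF W_bij]])

text \<open>
  For each of the finitely many roots, only levels between the values at \<open>p\<close> and \<open>q\<close> occur.
\<close>

lemma finite_sep_levels:
  assumes "regular p" "regular q"
  shows "finite {(\<alpha>, k). \<alpha> \<in> R \<and> hyperplane \<Phi> \<alpha> k \<in> sep p q}"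
proof (rule finite_subset)
  let ?I = "\<lambda>\<alpha>. {\<lfloor>min (pc p \<alpha>) (pc q \<alpha>)\<rfloor>..\<lceil>max (pc p \<alpha>) (pc q \<alpha>)\<rceil>}"
  show "{(\<alpha>, k). \<alpha> \<in> R \<and> hyperplane \<Phi> \<alpha> k \<in> sep p q} \<subseteq> (SIGMA \<alpha>:R. ?I \<alpha>)"
    by (auto simp: mem_sep_iff[OF assms] floor_le_iff le_ceiling_iff)
  show "finite (SIGMA \<alpha>:R. ?I \<alpha>)"
    using finite_roots by auto
qed

lemma finite_sep:
  assumes "regular p" "regular q"
  shows "finite (sep p q)"
proof (rule finite_surj[OF finite_sep_levels[OF assms]])
  show "sep p q \<subseteq> (\<lambda>(\<alpha>, k). hyperplane \<Phi> \<alpha> k) ` {(\<alpha>, k). \<alpha> \<in> R \<and> hyperplane \<Phi> \<alpha> k \<in> sep p q}"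
    using sep_hyperplane by (force elim!: hyperplanes_cases)
qed

text \<open>
  On the alcove, the values of a positive coroot lie in the interval from 0 to 1 and those of a negative
  coroot in the interval from -1 to 0. So the side depends on the sign of the root and on \<open>k\<close>, but not
  on the point.
\<close>

lemma alcove_side:
  assumes p: "p \<in> base_alcove \<Phi>" and \<alpha>: "\<alpha> \<in> R"
  shows "pc p \<alpha> < of_int k \<longleftrightarrow> (if \<alpha> \<in> Rp then 1 \<le> k else 0 \<le> k)"
    and "of_int k < pc p \<alpha> \<longleftrightarrow> \<not> (if \<alpha> \<in> Rp then 1 \<le> k else 0 \<le> k)"
proof -
  have "(if \<alpha> \<in> Rp then 0 else -1) < pc p \<alpha>" "pc p \<alpha> < (if \<alpha> \<in> Rp then 1 else 0)"
    using p pos_or_neg[OF \<alpha>] by (auto simp: base_alcove_def pc_minus_root \<alpha> dest: bspec[of _ _ "-\<alpha>"])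
  then show "pc p \<alpha> < of_int k \<longleftrightarrow> (if \<alpha> \<in> Rp then 1 \<le> k else 0 \<le> k)"
    and "of_int k < pc p \<alpha> \<longleftrightarrow> \<not> (if \<alpha> \<in> Rp then 1 \<le> k else 0 \<le> k)"
    by (auto split: if_splits)
qed

lemma alcove_regular: "p \<in> base_alcove \<Phi> \<Longrightarrow> regular p"
  unfolding regular_def using alcove_side[of p] by (metis less_irrefl)

lemma v0_regular: "regular v0"
  using alcove_regular v0_alcove by blast

lemma W_v0_regular: "g \<in> W \<Longrightarrow> regular (g v0)"
  using regular_W v0_regular by blast

lemma alcove_W_side:
  assumes g: "g \<in> W" and v: "v \<in> g ` base_alcove \<Phi>" and \<alpha>: "\<alpha> \<in> R"
  shows "pc v \<alpha> < of_int k \<longleftrightarrow> pc (g v0) \<alpha> < of_int k"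
    and "of_int k < pc v \<alpha> \<longleftrightarrow> of_int k < pc (g v0) \<alpha>"
proof -
  obtain p where p: "p \<in> base_alcove \<Phi>" "v = g p" using v by blast
  obtain \<beta> c where \<beta>: "\<beta> \<in> R" "\<And>v. pc (g v) \<alpha> = pc v \<beta> + of_int c"
    using W_pull[OF g \<alpha>] by blast
  have "pc p \<beta> < of_int (k - c) \<longleftrightarrow> pc v0 \<beta> < of_int (k - c)"
       "of_int (k - c) < pc p \<beta> \<longleftrightarrow> of_int (k - c) < pc v0 \<beta>"
    by (simp_all only: alcove_side[OF p(1) \<beta>(1)] alcove_side[OF v0_alcove \<beta>(1)])
  then show "pc v \<alpha> < of_int k \<longleftrightarrow> pc (g v0) \<alpha> < of_int k"
    "of_int k < pc v \<alpha> \<longleftrightarrow> of_int k < pc (g v0) \<alpha>"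
    by (auto simp: p(2) \<beta>(2))
qed

lemma alcove_W_all:
  assumes g: "g \<in> W" and \<alpha>: "\<alpha> \<in> R"
  shows "(\<forall>v\<in>g ` base_alcove \<Phi>. pc v \<alpha> < of_int k) \<longleftrightarrow> pc (g v0) \<alpha> < of_int k"
    and "(\<forall>v\<in>g ` base_alcove \<Phi>. of_int k < pc v \<alpha>) \<longleftrightarrow> of_int k < pc (g v0) \<alpha>"
proof -
  have v: "g v0 \<in> g ` base_alcove \<Phi>" using v0_alcove by (rule imageI)
  note side = alcove_W_side[OF g _ \<alpha>]
  show "(\<forall>v\<in>g ` base_alcove \<Phi>. pc v \<alpha> < of_int k) \<longleftrightarrow> pc (g v0) \<alpha> < of_int k"
    by (rule iffI, erule bspec[OF _ v], rule ballI, erule iffD2[OF side(1)])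
  show "(\<forall>v\<in>g ` base_alcove \<Phi>. of_int k < pc v \<alpha>) \<longleftrightarrow> of_int k < pc (g v0) \<alpha>"
    by (rule iffI, erule bspec[OF _ v], rule ballI, erule iffD2[OF side(2)])
qed

lemma separates_iff:
  assumes g: "g \<in> W"
  shows "separates \<Phi> H (base_alcove \<Phi>) (g ` base_alcove \<Phi>) \<longleftrightarrow> H \<in> sep v0 (g v0)"
proof -
  note 1 = alcove_W_all[OF g] alcove_W_all[OF id_W, unfolded image_id id_apply]
  have 2: "of_int k < pc v0 \<alpha> \<longleftrightarrow> \<not> pc v0 \<alpha> < of_int k" 
    "of_int k < pc (g v0) \<alpha> \<longleftrightarrow> \<not> pc (g v0) \<alpha> < of_int k" if "\<alpha> \<in> R" for \<alpha> k
    using regular_side[OF v0_regular that] regular_side[OF W_v0_regular[OF g] that] by blast+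
  have key: "((\<forall>v\<in>base_alcove \<Phi>. pc v \<alpha> < of_int k) \<and> (\<forall>v\<in>g ` base_alcove \<Phi>. of_int k < pc v \<alpha>) \<or>
      (\<forall>v\<in>g ` base_alcove \<Phi>. pc v \<alpha> < of_int k) \<and> (\<forall>v\<in>base_alcove \<Phi>. of_int k < pc v \<alpha>)) \<longleftrightarrow>
      hyperplane \<Phi> \<alpha> k \<in> sep v0 (g v0)" if "\<alpha> \<in> R" for \<alpha> k
    unfolding 1[OF that] 2[OF that] mem_sep_iff[OF v0_regular W_v0_regular[OF g] that] by argo
  show ?thesis
  proof
    assume "separates \<Phi> H (base_alcove \<Phi>) (g ` base_alcove \<Phi>)"
    then obtain \<alpha> k where "\<alpha> \<in> R" "H = hyperplane \<Phi> \<alpha> k"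
      "hyperplane \<Phi> \<alpha> k \<in> sep v0 (g v0)"
      unfolding separates_def using key by meson
    then show "H \<in> sep v0 (g v0)" by simp
  next
    assume H: "H \<in> sep v0 (g v0)"
    obtain \<alpha> k where \<alpha>: "\<alpha> \<in> R" "H = hyperplane \<Phi> \<alpha> k" 
      using hyperplanes_cases[OF sep_hyperplane[OF H]] .
    show "separates \<Phi> H (base_alcove \<Phi>) (g ` base_alcove \<Phi>)"
      unfolding separates_def
      by (rule bexI[OF _ \<alpha>(1)], rule exI[of _ k], rule conjI[OF \<alpha>(2)])
         (rule iffD2[OF key[OF \<alpha>(1)] H[unfolded \<alpha>(2)]])
  qed
qed

lemma len_eq: "g \<in> W \<Longrightarrow> len \<Phi> g = card (sep v0 (g v0))"
  unfolding len_def using separates_iff sep_hyperplane by (intro arg_cong[of _ _ card]) blast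

text \<open>
  Hyperplanes separating \<open>C\<^sub>0\<close> from \<open>abC\<^sub>0\<close> are those separating exactly one of the pairs \<open>C\<^sub>0, aC\<^sub>0\<close> and
  \<open>aC\<^sub>0, abC\<^sub>0\<close>; the second pair is an image of \<open>C\<^sub>0, bC\<^sub>0\<close>. So lengths add when nothing is crossed twice.
\<close>

lemma len_add:
  assumes a: "a \<in> W" and b: "b \<in> W" 
    and disj: "\<And>H. H \<in> sep v0 (a v0) \<Longrightarrow> H \<in> sep (a v0) (a (b v0)) \<Longrightarrow> False"
  shows "len \<Phi> a + len \<Phi> b = len \<Phi> (a \<circ> b)"
proof -
  note reg = v0_regular W_v0_regular[OF a] regular_W[OF a W_v0_regular[OF b]]
  have "sep v0 (a (b v0)) = sep v0 (a v0) \<union> sep (a v0) (a (b v0))"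
    using sep_diff[OF reg(1,2,3)] disj sep_hyperplane by blast
  moreover have "sep v0 (a v0) \<inter> sep (a v0) (a (b v0)) = {}" using disj by blast
  ultimately have "card (sep v0 (a (b v0))) = card (sep v0 (a v0)) + card (sep (a v0) (a (b v0)))"
    using reg finite_sep by (simp add: card_Un_disjoint)
  then show ?thesis
    using a b by (simp add: len_eq W_comp card_sep_W)
qed

end

section \<open>Walls of the base alcove\<close>

lemma eventually_affine_less:
  fixes a b c :: real
  assumes "a < b"
  shows "\<forall>\<^sub>F t in at_right 0. a + t * c < b"
proof -
  have "((\<lambda>t. a + t * c) \<longlongrightarrow> a + 0 * c) (at_right 0)" by (intro tendsto_intros)
  then show ?thesis using assms by (intro order_tendstoD(2)) simp_all
qed

lemma eventually_affine_neq:
  fixes a c :: real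
  assumes "a \<noteq> 0"
  shows "\<forall>\<^sub>F t in at_right 0. a + t * c \<noteq> 0"
proof -
  have "((\<lambda>t. a + t * c) \<longlongrightarrow> a + 0 * c) (at_right 0)" by (intro tendsto_intros)
  then show ?thesis using assms by (intro tendsto_imp_eventually_ne) simp_all
qed

context root_datum_with_automorphisms
begin

lemma finite_pos_roots: "finite Rp"
  using finite_outer[of "{}"] by (simp add: outer_empty)

lemma eventually_alcove:
  assumes p: "p \<in> base_alcove \<Phi>"
  shows "\<forall>\<^sub>F t in at_right 0. p + t *\<^sub>R (u - p) \<in> base_alcove \<Phi>"
proof -
  have "\<forall>\<^sub>F t in at_right 0. \<forall>\<beta>\<in>Rp. 0 < pc p \<beta> + t * (pc u \<beta> - pc p \<beta>) 
      \<and> pc p \<beta> + t * (pc u \<beta> - pc p \<beta>) < 1"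
    unfolding eventually_ball_finite_distrib[OF finite_pos_roots]
  proof
    fix \<beta> assume "\<beta> \<in> Rp"
    then have b: "- pc p \<beta> < 0" "pc p \<beta> < 1" using p by (simp_all add: base_alcove_def)
    have "\<forall>\<^sub>F t in at_right 0. - pc p \<beta> + t * (pc p \<beta> - pc u \<beta>) < 0"
      by (rule eventually_affine_less[OF b(1)])
    then have "\<forall>\<^sub>F t in at_right 0. 0 < pc p \<beta> + t * (pc u \<beta> - pc p \<beta>)"
      by eventually_elim (simp add: algebra_simps)
    then show "\<forall>\<^sub>F t in at_right 0. 0 < pc p \<beta> + t * (pc u \<beta> - pc p \<beta>) \<and> 
        pc p \<beta> + t * (pc u \<beta> - pc p \<beta>) < 1"
      using eventually_affine_less[OF b(2)] by (rule eventually_conj)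
  qed
  then show ?thesis
    by eventually_elim (simp add: base_alcove_def)
qed

text \<open>
  General position in the open alcove: if an affine function vanishes at a point, then moving a little
  towards a point where it does not vanish makes it nonzero, and destroys none of finitely many strict
  inequalities.
\<close>

lemma alcove_avoids:
  assumes "finite G" 
    and "\<And>g p u t. g \<in> G \<Longrightarrow> g (p + t *\<^sub>R (u - p)) = g p + t * (g u - g p)"
    and "\<And>g. g \<in> G \<Longrightarrow> \<exists>u. g u \<noteq> (0::real)"
  shows "\<exists>p\<in>base_alcove \<Phi>. \<forall>g\<in>G. g p \<noteq> 0"
  using assms
proof (induction G rule: finite_induct)
  case empty
  then show ?case using v0_alcove by blast
next
  case (insert g G)
  have "\<exists>p\<in>base_alcove \<Phi>. \<forall>g\<in>G. g p \<noteq> 0"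
    by (rule insert.IH) (simp_all add: insert.prems)
  then obtain p where p: "p \<in> base_alcove \<Phi>" "\<And>h. h \<in> G \<Longrightarrow> h p \<noteq> 0" by blast
  obtain u where u: "g u \<noteq> 0" using insert.prems(2)[of g] by auto
  show ?case
  proof (cases "g p = 0")
    case True
    have 1: "\<forall>\<^sub>F t in at_right 0. \<forall>h\<in>G. h p + t * (h u - h p) \<noteq> 0"
      unfolding eventually_ball_finite_distrib[OF insert.hyps(1)]
      using p(2) eventually_affine_neq by simp
    have 2: "\<forall>\<^sub>F t :: real in at_right 0. 0 < t"
      by (rule eventually_at_right_less)
    have "\<forall>\<^sub>F t in at_right 0. p + t *\<^sub>R (u - p) \<in> base_alcove \<Phi> \<and>
       (\<forall>h\<in>insert g G. h (p + t *\<^sub>R (u - p)) \<noteq> 0)"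
      using 1 2 eventually_alcove[OF p(1), of u]
    proof eventually_elim
      case (elim t)
      then show ?case using u True by (simp add: insert.prems(1))
    qed
    then show ?thesis using eventually_happens[of _ "at_right (0::real)"] by auto
  next
    case False
    then show ?thesis using p by auto
  qed
qed

text \<open>
  The points between \<open>v\<close> and an interior point belong to the alcove and converge to \<open>v\<close>.
\<close>

lemma mem_closure_alcove:
  assumes v: "\<And>\<beta>. \<beta> \<in> Rp \<Longrightarrow> 0 \<le> pc v \<beta> \<and> pc v \<beta> \<le> 1"
  shows "v \<in> closure (base_alcove \<Phi>)"
  unfolding closure_approachable
proof (intro allI impI)
  fix e :: real assume e: "e > 0"
  define t where "t = e / (e + norm (v0 - v))"
  have t: "0 < t" "t \<le> 1" using e by (auto simp: t_def add_pos_nonneg)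
  have "t * norm (v0 - v) < e"
    using e by (simp add: t_def divide_less_eq add_pos_nonneg algebra_simps)
  then have "dist (v + t *\<^sub>R (v0 - v)) v < e"
    using t by (simp add: dist_norm)
  moreover have "v + t *\<^sub>R (v0 - v) \<in> base_alcove \<Phi>"
    unfolding base_alcove_def
  proof (intro CollectI ballI)
    fix \<beta> assume \<beta>: "\<beta> \<in> Rp"
    have eq: "pc (v + t *\<^sub>R (v0 - v)) \<beta> = (1 - t) * pc v \<beta> + t * pc v0 \<beta>"
      by (simp add: algebra_simps)
    have "0 \<le> (1 - t) * pc v \<beta>" "0 < t * pc v0 \<beta>" "(1 - t) * pc v \<beta> \<le> (1 - t) * 1" "t * pc v0 \<beta> < t * 1"
      using t v[OF \<beta>] v0_pos[OF \<beta>] v0_less[OF \<beta>] 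
      by (simp_all add: mult_left_le)
    then have "0 < (1 - t) * pc v \<beta> + t * pc v0 \<beta>" 
      "(1 - t) * pc v \<beta> + t * pc v0 \<beta> < (1 - t) * 1 + t * 1"
      by (auto intro: add_nonneg_pos add_le_less_mono simp del: mult_1_right)
    then show "0 < pc (v + t *\<^sub>R (v0 - v)) \<beta> \<and> pc (v + t *\<^sub>R (v0 - v)) \<beta> < 1"
      unfolding eq by simp
  qed
  ultimately show "\<exists>y\<in>base_alcove \<Phi>. dist y v < e" by blast
qed

text \<open>
  Join \<open>q\<close> to a general point \<open>p\<close> of the alcove. By the choice of \<open>p\<close>, the segment meets different
  separating hyperplanes at different times, so at the point \<open>r\<close> where it leaves the alcove it lies on a
  single hyperplane \<open>H\<close>. Near \<open>r\<close>, all of \<open>H\<close> belongs to the closed alcove, so \<open>H\<close> is a wall. The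
  reflection in \<open>H\<close> fixes \<open>r\<close>, so the alcove and its mirror image both have \<open>r\<close> in their closure and
  are on the same side of every other hyperplane.
\<close>

lemma wall_exists:
  assumes q: "regular q" and ne: "sep v0 q \<noteq> {}"
  obtains \<alpha> k where "\<alpha> \<in> R" "hyperplane \<Phi> \<alpha> k \<in> sep v0 q"
    "affine hull (hyperplane \<Phi> \<alpha> k \<inter> closure (base_alcove \<Phi>)) = hyperplane \<Phi> \<alpha> k"
    "sep v0 (reflection \<Phi> \<alpha> k v0) = {hyperplane \<Phi> \<alpha> k}"
proof -
  \<comment> \<open>\<open>f\<close> is the level function of a pair \<open>(\<alpha>, k)\<close>, \<open>hyp\<close> its zero set and \<open>K\<close> lists the pairs that
    separate. A function in \<open>G\<close> vanishes at \<open>p\<close> if and only if the segment from \<open>p\<close> to \<open>q\<close> meets the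
    two hyperplanes at the same time.\<close>
  define f where "f = (\<lambda>(\<alpha>, k) v. pc v \<alpha> - of_int k)"
  define hyp where "hyp = (\<lambda>(\<alpha>, k). hyperplane \<Phi> \<alpha> k)"
  define K where "K = {(\<alpha>, k). \<alpha> \<in> R \<and> hyperplane \<Phi> \<alpha> k \<in> sep v0 q}"
  define G where "G = {(\<lambda>v. f a v * f b q - f b v * f a q) | a b. a \<in> K \<and> b \<in> K \<and> hyp a \<noteq> hyp b}"
  have f_affine: "f a (p + t *\<^sub>R (u - p)) = f a p + t * (f a u - f a p)" for a p u t
    by (simp add: f_def split_beta algebra_simps)
  have mem_hyp: "v \<in> hyp a \<longleftrightarrow> f a v = 0" for v a
    by (auto simp: hyp_def f_def hyperplane_def split_beta)
  have q0: "f a q \<noteq> 0" if "fst a \<in> R" for a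
    using q that by (auto simp: regular_def f_def split_beta)
  have finK: "finite K" unfolding K_def by (rule finite_sep_levels[OF v0_regular q])
  have KR: "fst a \<in> R" if "a \<in> K" for a using that by (auto simp: K_def)
  have "\<exists>p\<in>base_alcove \<Phi>. \<forall>g\<in>G. g p \<noteq> 0"
  proof (rule alcove_avoids)
    show "finite G"
    proof (rule finite_subset)
      show "G \<subseteq> (\<lambda>c v. f (fst c) v * f (snd c) q - f (snd c) v * f (fst c) q) ` (K \<times> K)"
        unfolding G_def by force
    qed (use finK in blast)
    show "g (p + t *\<^sub>R (u - p)) = g p + t * (g u - g p)" if gG: "g \<in> G" for g p u t
    proof -
      obtain a b where g: "g = (\<lambda>v. f a v * f b q - f b v * f a q)"
        using gG unfolding G_def by blast
      show ?thesis unfolding g f_affine by (simp only: algebra_simps)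
    qed
    show "\<exists>u. g u \<noteq> 0" if gG: "g \<in> G" for g
    proof -
      obtain a b where ab: "a \<in> K" "b \<in> K" "hyp a \<noteq> hyp b" "g = (\<lambda>v. f a v * f b q - f b v * f a q)"
        using gG unfolding G_def by blast
      obtain u where "(f a u = 0) \<noteq> (f b u = 0)"
        using ab(3) mem_hyp by blast
      then show ?thesis
        using q0[OF KR[OF ab(1)]] q0[OF KR[OF ab(2)]] ab(4) by (intro exI[of _ u]) auto
    qed
  qed
  then obtain p where p: "p \<in> base_alcove \<Phi>" and generic: "\<And>g. g \<in> G \<Longrightarrow> g p \<noteq> 0" by blast
  have preg: "regular p" by (rule alcove_regular[OF p])
  have p0: "f a p \<noteq> 0" if "fst a \<in> R" for a
    using preg that by (auto simp: regular_def f_def split_beta)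
  have K_iff: "a \<in> K \<longleftrightarrow> (f a p < 0) \<noteq> (f a q < 0)" if "fst a \<in> R" for a
    using that alcove_side(1)[OF p that] alcove_side(1)[OF v0_alcove that] mem_sep_iff[OF v0_regular q that]
    by (cases a) (simp add: K_def f_def)
  \<comment> \<open>The time at which the segment from \<open>p\<close> to \<open>q\<close> meets the hyperplane of \<open>a\<close>.\<close>
  define \<tau> where "\<tau> a = f a p / (f a p - f a q)" for a
  have "K \<noteq> {}"
    using ne sep_hyperplane by (fastforce simp: K_def elim!: hyperplanes_cases)
  then have "Min (\<tau> ` K) \<in> \<tau> ` K" using finK by (intro Min_in) simp_all
  then obtain a where a: "a \<in> K" and amin': "\<tau> a = Min (\<tau> ` K)" by force
  have amin: "\<tau> a \<le> \<tau> b" if "b \<in> K" for b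
    unfolding amin' using finK that by simp
  define t where "t = \<tau> a"
  define r where "r = p + t *\<^sub>R (q - p)"
  have opposite: "f b p < 0 \<and> 0 < f b q \<or> 0 < f b p \<and> f b q < 0" if b: "b \<in> K" for b
  proof -
    have "(f b p < 0) \<noteq> (f b q < 0)" using b by (rule iffD1[OF K_iff[OF KR[OF b]]])
    then show ?thesis using p0[OF KR[OF b]] q0[OF KR[OF b]] by argo
  qed
  have \<tau>01: "0 < \<tau> b \<and> \<tau> b < 1" if "b \<in> K" for b
    using opposite[OF that] by (auto simp: \<tau>_def zero_less_divide_iff divide_less_eq)
  have fr: "f b r = (1 - t) * f b p + t * f b q" for b
    unfolding r_def f_affine by (simp add: algebra_simps)
  have t01: "0 < t" "t < 1" using \<tau>01[OF a] by (simp_all add: t_def)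
  have ar: "f a r = 0"
  proof -
    have "f a p - f a q \<noteq> 0" using opposite[OF a] by linarith
    then show ?thesis by (simp add: fr t_def \<tau>_def field_simps)
  qed
  \<comment> \<open>At \<open>r\<close> no other hyperplane has been reached yet.\<close>
  have other: "0 < f b r * f b p" if b: "fst b \<in> R" "hyp b \<noteq> hyp a" for b
  proof (cases "b \<in> K")
    case False
    then have "(f b p < 0) = (f b q < 0)" using K_iff[OF b(1)] by blast
    then have "f b p > 0 \<and> f b q > 0 \<or> f b p < 0 \<and> f b q < 0"
      using p0[OF b(1)] q0[OF b(1)] by (cases "f b p < 0") simp_all
    then have "0 < f b p * f b p" "0 < f b q * f b p" by (auto simp: zero_less_mult_iff)
    then have "0 < (1 - t) * (f b p * f b p) + t * (f b q * f b p)"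
      using t01 by (simp add: add_pos_pos)
    then show ?thesis by (simp add: fr algebra_simps)
  next
    case True
    have "(\<lambda>v. f a v * f b q - f b v * f a q) \<in> G"
      using a True b(2) unfolding G_def by blast
    from generic[OF this] have g: "f a p * f b q \<noteq> f b p * f a q" by simp
    have d: "f a p - f a q \<noteq> 0" "f b p - f b q \<noteq> 0" 
      using opposite[OF a] opposite[OF True] by linarith+
    have "\<tau> a \<noteq> \<tau> b"
      using g d by (simp add: \<tau>_def frac_eq_eq algebra_simps)
    then have lt: "t < \<tau> b" using amin[OF True] by (simp add: t_def)
    have bd: "f b r = (\<tau> b - t) * (f b p - f b q)"
      using d by (simp add: fr \<tau>_def field_simps)
    have "0 < (f b p - f b q) * f b p"
      using opposite[OF True] by (auto simp: zero_less_mult_iff)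
    then have "0 < (\<tau> b - t) * ((f b p - f b q) * f b p)"
      using lt by (intro mult_pos_pos[of "\<tau> b - t"]) simp
    then show ?thesis unfolding bd mult.assoc .
  qed
  obtain \<alpha> k where ak: "a = (\<alpha>, k)" by (cases a)
  have \<alpha>: "\<alpha> \<in> R" "hyperplane \<Phi> \<alpha> k \<in> sep v0 q" using a by (simp_all add: K_def ak)
  have hypa: "hyp a = hyperplane \<Phi> \<alpha> k" by (simp add: hyp_def ak)
  let ?s = "reflection \<Phi> \<alpha> k"
  have sW: "?s \<in> W" by (rule reflection_W[OF \<alpha>(1)])
  \<comment> \<open>Every point \<open>x\<close> of the hyperplane can be moved into the closed alcove by contracting towards \<open>r\<close>.\<close>
  have near: "\<exists>e>0. r + e *\<^sub>R (x - r) \<in> closure (base_alcove \<Phi>)" if x: "x \<in> hyp a" for x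
  proof -
    have inH: "f a (r + e *\<^sub>R (x - r)) = 0" for e
      using x ar unfolding f_affine mem_hyp by simp
    have one: "\<forall>\<^sub>F e in at_right 0. 0 \<le> f b p * f b (r + e *\<^sub>R (x - r))" if "fst b \<in> R" for b
    proof (cases "hyp b = hyp a")
      case True
      then have "f b (r + e *\<^sub>R (x - r)) = 0" for e using inH mem_hyp by blast
      then show ?thesis by simp
    next
      case False
      have "- (f b r * f b p) < 0" using other[OF that False] by simp
      then have "\<forall>\<^sub>F e in at_right 0. - (f b r * f b p) + e * (f b r * f b p - f b x * f b p) < 0"
        by (rule eventually_affine_less)
      then show ?thesis 
        unfolding f_affine by eventually_elim (simp add: algebra_simps)
    qed
    have "\<forall>\<^sub>F e in at_right 0. \<forall>\<beta>\<in>Rp. 0 \<le> f (\<beta>, 0) p * f (\<beta>, 0) (r + e *\<^sub>R (x - r)) \<and>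
       0 \<le> f (\<beta>, 1) p * f (\<beta>, 1) (r + e *\<^sub>R (x - r))"
      unfolding eventually_ball_finite_distrib[OF finite_pos_roots] eventually_conj_iff
      using one pos_root by simp
    then have "\<forall>\<^sub>F e in at_right 0. 0 < e \<and> r + e *\<^sub>R (x - r) \<in> closure (base_alcove \<Phi>)"
      using eventually_at_right_less[of "0::real"]
    proof eventually_elim
      case (elim e)
      have "0 \<le> pc (r + e *\<^sub>R (x - r)) \<beta> \<and> pc (r + e *\<^sub>R (x - r)) \<beta> \<le> 1" if "\<beta> \<in> Rp" for \<beta>
      proof -
        have "0 < pc p \<beta>" "pc p \<beta> < 1" using p that by (simp_all add: base_alcove_def)
        then show ?thesis
          using bspec[OF elim(1) that] by (simp add: f_def zero_le_mult_iff)
      qed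
      then show ?case using mem_closure_alcove elim(2) by blast
    qed
    then show ?thesis using eventually_happens[of _ "at_right (0::real)"] by auto
  qed
  have "affine hull (hyp a \<inter> closure (base_alcove \<Phi>)) = hyp a" (is "?A = _")
  proof -
    have aff: "affine (hyp a)"
      unfolding affine_def
    proof (intro ballI allI impI)
      fix x y :: 'v and u v :: real
      assume "x \<in> hyp a" "y \<in> hyp a" "u + v = 1"
      then show "u *\<^sub>R x + v *\<^sub>R y \<in> hyp a"
        unfolding mem_hyp ak f_def by (simp flip: distrib_right)
    qed
    have rH: "r \<in> hyp a" using ar mem_hyp by simp
    obtain e where "e > 0" "r + e *\<^sub>R (r - r) \<in> closure (base_alcove \<Phi>)"
      using near[OF rH] by blast
    then have r: "r \<in> hyp a \<inter> closure (base_alcove \<Phi>)" using rH by simp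
    show ?thesis
    proof
      show "?A \<subseteq> hyp a" by (rule hull_minimal) (rule Int_lower1, rule aff)
      show "hyp a \<subseteq> ?A"
      proof
        fix x assume x: "x \<in> hyp a"
        obtain e where e: "e > 0" "r + e *\<^sub>R (x - r) \<in> closure (base_alcove \<Phi>)"
          using near[OF x] by blast
        have "r + e *\<^sub>R (x - r) \<in> hyp a"
          using x rH unfolding mem_hyp f_affine by simp
        then have y: "r + e *\<^sub>R (x - r) \<in> ?A" using e by (intro hull_inc) simp
        \<comment> \<open>Conversely, \<open>x\<close> is recovered from \<open>r\<close> and the contracted point by an affine combination.\<close>
        have "(1 - 1 / e) *\<^sub>R r + (1 / e) *\<^sub>R (r + e *\<^sub>R (x - r)) \<in> ?A"
          using mem_affine[OF affine_affine_hull hull_inc[OF r] y] by simp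
        moreover have "(1 - 1 / e) *\<^sub>R r + (1 / e) *\<^sub>R (r + e *\<^sub>R (x - r)) = x"
          using e by (simp add: algebra_simps)
        ultimately show "x \<in> ?A" by simp
      qed
    qed
  qed
  moreover have "sep v0 (?s v0) = {hyperplane \<Phi> \<alpha> k}"
  proof -
    have side: "hyp b \<in> sep v0 (?s v0) \<longleftrightarrow> (f b p < 0) \<noteq> (f b (?s p) < 0)" if "fst b \<in> R" for b
      using mem_sep_iff[OF v0_regular W_v0_regular[OF sW] that, of "snd b"] 
        alcove_side(1)[OF p that] alcove_side(1)[OF v0_alcove that] 
        alcove_W_side(1)[OF sW imageI[OF p] that]
      by (simp add: f_def hyp_def split_beta)
    have "f a (?s p) = - f a p"
      using \<alpha>(1) by (simp add: f_def ak reflection_def algebra_simps)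
    then have "hyp a \<in> sep v0 (?s v0)"
      using side[of a] p0[of a] \<alpha>(1) ak by auto
    moreover have "hyp b \<notin> sep v0 (?s v0)" if b: "fst b \<in> R" "hyp b \<noteq> hyp a" for b
    proof -
      obtain \<beta> l where bl: "b = (\<beta>, l)" by (cases b)
      obtain \<gamma> c where \<gamma>: "\<gamma> \<in> R" "\<And>v. pc (?s v) \<beta> = pc v \<gamma> + of_int c"
        using W_pull[OF sW, of \<beta>] b bl by auto
      \<comment> \<open>Reflecting \<open>p\<close> amounts to reflecting the level function of \<open>b\<close>; as \<open>r\<close> is fixed, the signs of both
        functions at \<open>p\<close> are the sign of \<open>f b r\<close>.\<close>
      define b' where "b' = (\<gamma>, l - c)"
      have b': "f b (?s v) = f b' v" for v
        by (simp add: f_def b'_def bl \<gamma>)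
      have ss: "?s (?s v) = v" for v by (rule reflection_involution[OF \<alpha>(1)])
      have fas: "f a (?s v) = - f a v" for v
        using \<alpha>(1) by (simp add: f_def ak reflection_def algebra_simps)
      have "hyp b' \<noteq> hyp a"
      proof
        assume eq: "hyp b' = hyp a"
        have "v \<in> hyp b \<longleftrightarrow> v \<in> hyp a" for v
        proof -
          have "v \<in> hyp b \<longleftrightarrow> ?s v \<in> hyp b'" 
            unfolding mem_hyp b'[symmetric] ss ..
          also have "\<dots> \<longleftrightarrow> v \<in> hyp a" unfolding eq mem_hyp fas by simp
          finally show ?thesis .
        qed
        then show False using b(2) by blast
      qed
      then have "0 < f b' r * f b' p" using \<gamma> by (intro other) (simp_all add: b'_def)
      moreover have "?s r = r" using ar by (simp add: reflection_def f_def ak)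
      then have "f b' r = f b r" using b'[of r] by simp
      moreover have "f b' p = f b (?s p)" using b'[of p] by simp
      moreover have "0 < f b r * f b p" using other[OF b] .
      ultimately have "(f b p < 0) = (f b (?s p) < 0)"
        by (auto simp: zero_less_mult_iff)
      then show ?thesis using side[OF b(1)] by simp
    qed
    ultimately have *: "hyp b \<in> sep v0 (?s v0) \<longleftrightarrow> hyp b = hyp a" if "fst b \<in> R" for b
      using that by metis
    have "H \<in> sep v0 (?s v0) \<longleftrightarrow> H = hyp a" if "H \<in> hyperplanes \<Phi>" for H
      using hyperplanes_cases[OF that] *[of "(_, _)"] by (metis fst_conv hyp_def old.prod.case)
    then show ?thesis
      using sep_hyperplane \<open>hyp a \<in> sep v0 (?s v0)\<close> unfolding hypa by blast
  qed
  ultimately show thesis using that[OF \<alpha>] unfolding hypa by blast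
qed

text \<open>
  Passing from \<open>w\<close> to \<open>sw\<close> removes the wall of \<open>s\<close> from the separating hyperplanes and reflects the others.
\<close>

lemma len_reflection:
  assumes \<alpha>: "\<alpha> \<in> R" and w: "w \<in> W" 
    and wall: "sep v0 (reflection \<Phi> \<alpha> k v0) = {hyperplane \<Phi> \<alpha> k}"
    and H: "hyperplane \<Phi> \<alpha> k \<in> sep v0 (w v0)"
  shows "sep (reflection \<Phi> \<alpha> k v0) (w v0) = sep v0 (w v0) - {hyperplane \<Phi> \<alpha> k}"
    and "len \<Phi> (reflection \<Phi> \<alpha> k) + len \<Phi> (reflection \<Phi> \<alpha> k \<circ> w) = len \<Phi> w"
    and "len \<Phi> (reflection \<Phi> \<alpha> k \<circ> w) < len \<Phi> w"
proof -
  let ?s = "reflection \<Phi> \<alpha> k" let ?H = "hyperplane \<Phi> \<alpha> k"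
  have s: "?s \<in> W" by (rule reflection_W[OF \<alpha>])
  have ss: "?s (?s v) = v" for v by (rule reflection_involution[OF \<alpha>])
  note reg = v0_regular W_v0_regular[OF s] W_v0_regular[OF w]
  show d: "sep (?s v0) (w v0) = sep v0 (w v0) - {?H}"
  proof (rule set_eqI)
    fix H
    show "H \<in> sep (?s v0) (w v0) \<longleftrightarrow> H \<in> sep v0 (w v0) - {?H}"
    proof (cases "H \<in> hyperplanes \<Phi>")
      case True
      then show ?thesis
        using sep_diff[OF reg(1,2,3) True] assms(4) by (auto simp: wall)
    next
      case False
      then show ?thesis using sep_hyperplane[of H] by blast
    qed
  qed
  have "len \<Phi> (?s \<circ> w) = card (sep (?s v0) (w v0))"
    using card_sep_W[OF s, of "?s v0" "w v0"] by (simp add: len_eq W_comp[OF s w] ss)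
  also have "\<dots> = len \<Phi> w - 1"
    using d H finite_sep[OF reg(1,3)] by (simp add: len_eq[OF w])
  finally have l: "len \<Phi> (?s \<circ> w) = len \<Phi> w - 1" .
  moreover have "len \<Phi> w > 0"
    using H finite_sep[OF reg(1,3)] by (auto simp: len_eq[OF w] card_gt_0_iff)
  moreover have "len \<Phi> ?s = 1" by (simp add: len_eq[OF s] wall)
  ultimately show "len \<Phi> ?s + len \<Phi> (?s \<circ> w) = len \<Phi> w" "len \<Phi> (?s \<circ> w) < len \<Phi> w"
    by linarith+
qed

end

section \<open>Parabolic subsets and minimal coset representatives\<close>

context root_datum_with_automorphisms
begin

lemma v0_bounds: 
  assumes "\<alpha> \<in> R" 
  shows "- 1 < pc v0 \<alpha>" and "pc v0 \<alpha> < 1"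
  using pos_or_neg[OF assms] v0_pos[of \<alpha>] v0_less[of \<alpha>] v0_pos[of "- \<alpha>"] v0_less[of "- \<alpha>"]
  by (auto simp: pc_minus_root[OF assms])

text \<open>
  A hyperplane of \<open>\<beta> > 0\<close> can only separate if the simple reflection makes \<open>\<beta>\<close> negative. Then \<open>\<beta>\<close> is
  proportional to \<open>\<alpha>\<close> and the level is 0, and proportional roots have the same hyperplane at level 0.
\<close>

lemma sep_v0_simple:
  assumes \<alpha>: "\<alpha> \<in> F0"
  shows "sep v0 (lrefl \<alpha> v0) = {hyperplane \<Phi> \<alpha> 0}"
proof -
  have \<alpha>R: "\<alpha> \<in> R" by (rule simple_root[OF \<alpha>])
  note reg = v0_regular W_v0_regular[OF reflection_W[OF \<alpha>R, of 0]]
  have "pc v0 \<alpha> > 0" by (rule v0_pos[OF simple_pos[OF \<alpha>]])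
  then have "pc (lrefl \<alpha> v0) \<alpha> < 0" using \<alpha>R by (simp add: refl_eq)
  then have mem: "hyperplane \<Phi> \<alpha> 0 \<in> sep v0 (lrefl \<alpha> v0)"
    using \<open>pc v0 \<alpha> > 0\<close> by (simp add: mem_sep_iff[OF reg \<alpha>R])
  have "H = hyperplane \<Phi> \<alpha> 0" if H: "H \<in> sep v0 (lrefl \<alpha> v0)" for H
  proof -
    obtain \<beta> k where \<beta>: "\<beta> \<in> Rp" "H = hyperplane \<Phi> \<beta> k"
      using hyperplanes_cases_pos[OF sep_hyperplane[OF H]] .
    have \<beta>R: "\<beta> \<in> R" by (rule pos_root[OF \<beta>(1)])
    have s: "(pc v0 \<beta> < of_int k) \<noteq> (pc v0 (lrefl \<alpha> \<beta>) < of_int k)"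
      using H unfolding \<beta>(2) mem_sep_iff[OF reg \<beta>R] pc_refl'[OF \<alpha>R \<beta>R] .
    have sR: "lrefl \<alpha> \<beta> \<in> R" by (rule refl_root[OF \<alpha>R \<beta>R])
    have "lrefl \<alpha> \<beta> \<notin> Rp"
      using s unfolding alcove_side(1)[OF v0_alcove \<beta>R] alcove_side(1)[OF v0_alcove sR]
      using \<beta>(1) by (auto split: if_splits)
    then obtain c where c: "c > 0" "\<beta> = c *\<^sub>R \<alpha>" using refl_pos_or_multiple[OF \<alpha> \<beta>(1)] by blast
    have "(1 \<le> k) = (\<not> 0 \<le> k)"
      using s \<beta>(1) \<open>lrefl \<alpha> \<beta> \<notin> Rp\<close> 
      unfolding alcove_side(1)[OF v0_alcove \<beta>R] alcove_side(1)[OF v0_alcove sR] by simp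
    then have "k = 0" by presburger
    moreover have "pc v \<beta> = 0 \<longleftrightarrow> pc v \<alpha> = 0" for v
      unfolding pc_zero_iff[OF \<beta>R] pc_zero_iff[OF \<alpha>R] using c by simp
    ultimately show ?thesis by (simp add: \<beta>(2) hyperplane_def)
  qed
  then show ?thesis using mem by blast
qed

lemma wall_affine_simple:
  assumes \<alpha>: "\<alpha> \<in> R" 
    and wall: "affine hull (hyperplane \<Phi> \<alpha> k \<inter> closure (base_alcove \<Phi>)) = hyperplane \<Phi> \<alpha> k"
  shows "reflection \<Phi> \<alpha> k \<in> affine_simple_refls \<Phi>"
proof -
  from assms have "reflection \<Phi> \<alpha> k = reflection \<Phi> \<alpha> k \<and> \<alpha> \<in> R \<and>
    affine hull (hyperplane \<Phi> \<alpha> k \<inter> closure (base_alcove \<Phi>)) = hyperplane \<Phi> \<alpha> k"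
    by simp
  then show ?thesis
    unfolding affine_simple_refls_def mem_Collect_eq by (intro exI)
qed

text \<open>
  The only hyperplane separating \<open>C\<^sub>0\<close> from its image is that of \<open>\<alpha>\<close>, so it is the wall that
  \<open>wall_exists\<close> provides.
\<close>

lemma simple_affine_simple:
  assumes \<alpha>: "\<alpha> \<in> F0"
  shows "lrefl \<alpha> \<in> affine_simple_refls \<Phi>"
proof -
  have \<alpha>R: "\<alpha> \<in> R" by (rule simple_root[OF \<alpha>])
  have "sep v0 (lrefl \<alpha> v0) \<noteq> {}" by (simp add: sep_v0_simple[OF \<alpha>])
  then obtain \<beta> k where "\<beta> \<in> R" "hyperplane \<Phi> \<beta> k \<in> sep v0 (lrefl \<alpha> v0)"
    "affine hull (hyperplane \<Phi> \<beta> k \<inter> closure (base_alcove \<Phi>)) = hyperplane \<Phi> \<beta> k"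
    "sep v0 (reflection \<Phi> \<beta> k v0) = {hyperplane \<Phi> \<beta> k}"
    by (rule wall_exists[OF W_v0_regular[OF reflection_W[OF \<alpha>R, of 0]]])
  then have "affine hull (hyperplane \<Phi> \<alpha> 0 \<inter> closure (base_alcove \<Phi>)) = hyperplane \<Phi> \<alpha> 0"
    by (simp add: sep_v0_simple[OF \<alpha>])
  then show ?thesis by (rule wall_affine_simple[OF \<alpha>R])
qed

lemma Gamma_pos:
  assumes \<delta>: "\<delta> \<in> \<Gamma>" and \<beta>: "\<beta> \<in> Rp"
  shows "\<delta> \<beta> \<in> Rp"
proof -
  have ba: "based_automorphism \<Phi> \<delta>" by (rule automorphisms[OF \<delta>])
  then have lin: "linear \<delta>" and inj: "inj \<delta>" and F: "\<delta> ` F0 = F0" 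
    by (auto simp: based_automorphism_def bij_is_inj)
  obtain n :: "'v \<Rightarrow> nat" where n: "\<beta> = (\<Sum>\<alpha>\<in>F0. of_nat (n \<alpha>) *\<^sub>R \<alpha>)"
    using \<beta> by (auto simp: pos_roots_def)
  have "\<delta> \<beta> = (\<Sum>\<alpha>\<in>F0. of_nat (n \<alpha>) *\<^sub>R \<delta> \<alpha>)"
    by (simp add: n linear_sum[OF lin] linear_scale[OF lin])
  also have "\<dots> = (\<Sum>\<alpha>\<in>\<delta> ` F0. of_nat (n (inv \<delta> \<alpha>)) *\<^sub>R \<alpha>)"
    by (subst sum.reindex) (use inj in \<open>auto intro: inj_on_subset simp: inv_f_f\<close>)
  finally have "\<delta> \<beta> = (\<Sum>\<alpha>\<in>F0. of_nat (n (inv \<delta> \<alpha>)) *\<^sub>R \<alpha>)" unfolding F .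
  moreover have "\<delta> \<beta> \<in> R" by (rule aut_root[OF Gamma_aut[OF \<delta>] pos_root[OF \<beta>]])
  ultimately show ?thesis
    unfolding pos_roots_def by (intro CollectI conjI exI[of _ "\<lambda>\<alpha>. n (inv \<delta> \<alpha>)"])
qed

lemma sep_v0_alcove:
  assumes p: "p \<in> base_alcove \<Phi>" 
  shows "sep v0 p = {}"
proof -
  have "H \<notin> sep v0 p" for H
  proof
    assume H: "H \<in> sep v0 p"
    obtain \<beta> k where \<beta>: "\<beta> \<in> R" "H = hyperplane \<Phi> \<beta> k"
      using hyperplanes_cases[OF sep_hyperplane[OF H]] .
    show False
      using H unfolding \<beta>(2) mem_sep_iff[OF v0_regular alcove_regular[OF p] \<beta>(1)]
        alcove_side(1)[OF v0_alcove \<beta>(1)] alcove_side(1)[OF p \<beta>(1)] by simp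
  qed
  then show ?thesis by blast
qed

lemma Gamma_alcove:
  assumes \<delta>: "\<delta> \<in> \<Gamma>" 
  shows "\<delta> v0 \<in> base_alcove \<Phi>"
  unfolding base_alcove_def
proof (intro CollectI ballI)
  fix \<beta> assume \<beta>: "\<beta> \<in> Rp"
  have "inv \<delta> \<beta> \<in> Rp" by (rule Gamma_pos[OF inv_automorphism[OF \<delta>] \<beta>])
  then show "0 < pc (\<delta> v0) \<beta> \<and> pc (\<delta> v0) \<beta> < 1"
    using v0_pos v0_less by (simp add: pc_aut'[OF Gamma_aut[OF \<delta>] pos_root[OF \<beta>]])
qed

lemma mem_outer: "\<beta> \<in> outer J \<longleftrightarrow> \<beta> \<in> Rp \<and> \<beta> \<notin> span J"
  by (auto simp: outer_def pos_roots_on_def roots_on_def pos_root)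

lemma refl_group_outer:
  assumes J: "J \<subseteq> F0" and u: "u \<in> refl_group \<Phi> J" and \<beta>: "\<beta> \<in> outer J"
  shows "u \<beta> \<in> outer J"
  using u
proof (induction rule: refl_group.induct)
  case 1
  then show ?case using \<beta> by simp
next
  case (2 \<alpha> w)
  then show ?case using refl_outer[OF J, of \<alpha> "w \<beta>"] by simp
qed

lemma refl_group_span:
  assumes u: "u \<in> refl_group \<Phi> J" and \<beta>: "\<beta> \<in> span J"
  shows "u \<beta> \<in> span J"
  using u
proof (induction rule: refl_group.induct)
  case 1
  then show ?case using \<beta> by simp
next
  case (2 \<alpha> w)
  then show ?case by (simp add: refl_eq span_diff span_scale span_base)
qed

lemma aut_on_outer:
  assumes \<delta>: "\<delta> \<in> aut_on \<Phi> \<Gamma> J" and \<beta>: "\<beta> \<in> outer J"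
  shows "\<delta> \<beta> \<in> outer J"
proof -
  have \<delta>\<Gamma>: "\<delta> \<in> \<Gamma>" and im: "\<delta> ` roots_on \<Phi> J = roots_on \<Phi> J"
    using \<delta> by (auto simp: aut_on_def)
  have \<delta>\<beta>: "\<delta> \<beta> \<in> Rp" using Gamma_pos[OF \<delta>\<Gamma>] \<beta> by (simp add: mem_outer)
  have "\<delta> \<beta> \<notin> span J"
  proof
    assume "\<delta> \<beta> \<in> span J"
    then have "\<delta> \<beta> \<in> \<delta> ` roots_on \<Phi> J"
      unfolding im using pos_root[OF \<delta>\<beta>] by (simp add: roots_on_def)
    then have "\<beta> \<in> roots_on \<Phi> J"
      by (simp add: inj_image_mem_iff[OF bij_is_inj[OF aut_bij[OF Gamma_aut[OF \<delta>\<Gamma>]]]])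
    then show False using \<beta> by (simp add: mem_outer roots_on_def)
  qed
  then show ?thesis using \<delta>\<beta> by (simp add: mem_outer)
qed

text \<open>
  A reflection in \<open>\<alpha> \<in> J\<close> with \<open>(x, \<alpha>) < 0\<close> permutes the positive roots of \<open>R\<^sub>J\<close> not proportional to \<open>\<alpha>\<close>,
  so it decreases the number of positive roots of \<open>R\<^sub>J\<close> with negative product with \<open>x\<close>.
\<close>

lemma dominant_conjugate:
  assumes J: "J \<subseteq> F0"
  shows "\<exists>u \<in> refl_group \<Phi> J. \<forall>\<alpha>\<in>J. 0 \<le> ip (u x) \<alpha>"
proof (induction "card {\<beta> \<in> Rp. \<beta> \<in> span J \<and> ip x \<beta> < 0}" arbitrary: x rule: less_induct)
  case less
  let ?N = "\<lambda>x. {\<beta> \<in> Rp. \<beta> \<in> span J \<and> ip x \<beta> < 0}"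
  show ?case
  proof (cases "\<forall>\<alpha>\<in>J. 0 \<le> ip x \<alpha>")
    case True
    then show ?thesis by (intro bexI[of _ id] refl_group.intros) simp
  next
    case False
    then obtain \<alpha> where \<alpha>: "\<alpha> \<in> J" "ip x \<alpha> < 0" by force
    have \<alpha>F: "\<alpha> \<in> F0" and \<alpha>R: "\<alpha> \<in> R" using \<alpha>(1) J simple_root by auto
    have fin: "finite (?N x)" using finite_pos_roots by simp
    have \<alpha>N: "\<alpha> \<in> ?N x" using \<alpha> simple_pos[OF \<alpha>F] by (simp add: span_base)
    have "lrefl \<alpha> \<beta> \<in> ?N x - {\<alpha>}" if \<beta>: "\<beta> \<in> ?N (lrefl \<alpha> x)" for \<beta>
    proof -
      have "ip x (lrefl \<alpha> \<beta>) < 0" using \<beta> ip_refl'[OF \<alpha>R] by simp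
      moreover have "lrefl \<alpha> \<beta> \<in> Rp"
      proof (rule ccontr)
        assume "lrefl \<alpha> \<beta> \<notin> Rp"
        then obtain c where c: "c > 0" "\<beta> = c *\<^sub>R \<alpha>" 
          using refl_pos_or_multiple[OF \<alpha>F, of \<beta>] \<beta> by blast
        have "ip (lrefl \<alpha> x) \<beta> = c * - ip x \<alpha>"
          using \<alpha>R by (simp add: c ip_refl' refl_self)
        moreover have "c * - ip x \<alpha> > 0" using c(1) \<alpha>(2) by (intro mult_pos_pos) simp_all
        ultimately show False using \<beta> by simp
      qed
      moreover have "lrefl \<alpha> \<beta> \<in> span J"
        using \<beta> \<alpha>(1) by (simp add: refl_eq span_diff span_scale span_base)
      moreover have "lrefl \<alpha> \<beta> \<noteq> \<alpha>"
      proof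
        assume "lrefl \<alpha> \<beta> = \<alpha>"
        then have "\<beta> = lrefl \<alpha> \<alpha>" using reflection_involution[OF \<alpha>R, of 0 \<beta>] by simp
        then have "- \<alpha> \<in> Rp" using \<beta> refl_self[OF \<alpha>R] by simp
        then show False
          using coef_nonneg[OF _ \<alpha>F, of "-\<alpha>"] by (simp add: coef_minus[OF \<alpha>R] coef_simple[OF \<alpha>F])
      qed
      ultimately show ?thesis by simp
    qed
    then have "lrefl \<alpha> ` ?N (lrefl \<alpha> x) \<subseteq> ?N x - {\<alpha>}" by (rule image_subsetI)
    then have "card (lrefl \<alpha> ` ?N (lrefl \<alpha> x)) \<le> card (?N x - {\<alpha>})"
      using fin by (intro card_mono) simp_all
    also have "\<dots> < card (?N x)" using card_Diff1_less[OF fin \<alpha>N] .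
    also have "card (lrefl \<alpha> ` ?N (lrefl \<alpha> x)) = card (?N (lrefl \<alpha> x))"
      by (rule card_image[OF inj_on_subset[OF bij_is_inj[OF aut_bij[OF lrefl_aut[OF \<alpha>R]]] subset_UNIV]])
    finally obtain u where u: "u \<in> refl_group \<Phi> J" "\<forall>\<gamma>\<in>J. 0 \<le> ip (u (lrefl \<alpha> x)) \<gamma>"
      using less.hyps[of "lrefl \<alpha> x"] by blast
    show ?thesis
      by (rule bexI[of _ "u \<circ> lrefl \<alpha>"])
        (use u(2) in simp, rule refl_group_comp[OF u(1) lrefl_refl_group[OF \<alpha>(1)]])
  qed
qed

lemma ip_nonneg_inner:
  assumes J: "J \<subseteq> F0" and x: "\<forall>\<alpha>\<in>J. 0 \<le> ip x \<alpha>" and \<beta>: "\<beta> \<in> Rp" "\<beta> \<in> span J"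
  shows "0 \<le> pc x \<beta>"
proof -
  have \<beta>R: "\<beta> \<in> R" by (rule pos_root[OF \<beta>(1)])
  have "0 \<le> coef \<beta> \<gamma> * ip x \<gamma>" if "\<gamma> \<in> F0" for \<gamma>
    using in_span_iff[OF J \<beta>R] \<beta>(2) x coef_nonneg[OF \<beta>(1) that] that by (cases "\<gamma> \<in> J") auto
  then have "0 \<le> ip x \<beta>" unfolding ip_expansion[OF \<beta>R] by (rule sum_nonneg)
  then show ?thesis using pc_neg_iff[OF \<beta>R, of x] by linarith
qed

text \<open>
  If the hyperplane of \<open>\<alpha> \<in> J\<close> separated \<open>C\<^sub>0\<close> from \<open>zC\<^sub>0\<close>, then \<open>s\<^sub>\<alpha> z\<close> would be a shorter element of the
  coset of \<open>z\<close>. This settles the roots in \<open>J\<close>, and the others follow by expansion in \<open>J\<close>. Evaluated at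
  the base point, the conclusion is the familiar \<open>z\<inverse>\<beta> > 0\<close>.
\<close>

lemma min_coset_rep_pos:
  assumes J: "J \<subseteq> F0" and z: "z \<in> min_coset_reps \<Phi> J" and \<beta>: "\<beta> \<in> Rp" "\<beta> \<in> span J"
  shows "0 < pc (z v0) \<beta>"
proof -
  have zW: "z \<in> W" and zmin: "\<And>u. u \<in> refl_group \<Phi> J \<Longrightarrow> len \<Phi> z \<le> len \<Phi> (u \<circ> z)" 
    using z weyl_W by (auto simp: min_coset_reps_def)
  have simple: "0 < ip (z v0) \<alpha>" if \<alpha>: "\<alpha> \<in> J" for \<alpha>
  proof (rule ccontr)
    assume "\<not> 0 < ip (z v0) \<alpha>"
    have \<alpha>F: "\<alpha> \<in> F0" and \<alpha>R: "\<alpha> \<in> R" using \<alpha> J simple_root by auto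
    have "\<not> 0 < pc (z v0) \<alpha>" using pc_pos_iff[OF \<alpha>R] \<open>\<not> 0 < ip (z v0) \<alpha>\<close> by simp
    moreover have "0 < pc (z v0) \<alpha> \<longleftrightarrow> \<not> pc (z v0) \<alpha> < 0"
      using regular_side[OF W_v0_regular[OF zW] \<alpha>R, of 0] by simp
    ultimately have "hyperplane \<Phi> \<alpha> 0 \<in> sep v0 (z v0)"
      using v0_pos[OF simple_pos[OF \<alpha>F]]
      by (simp add: mem_sep_iff[OF v0_regular W_v0_regular[OF zW] \<alpha>R])
    then have "len \<Phi> (lrefl \<alpha> \<circ> z) < len \<Phi> z"
      by (rule len_reflection(3)[OF \<alpha>R zW sep_v0_simple[OF \<alpha>F]])
    then show False using zmin[OF lrefl_refl_group[OF \<alpha>]] by simp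
  qed
  have \<beta>R: "\<beta> \<in> R" by (rule pos_root[OF \<beta>(1)])
  obtain \<gamma> where \<gamma>: "\<gamma> \<in> F0" "0 < coef \<beta> \<gamma>" using pos_coef_exists[OF \<beta>(1)] .
  have z0: "coef \<beta> \<gamma> = 0" if "\<gamma> \<in> F0 - J" for \<gamma> using in_span_iff[OF J \<beta>R] \<beta>(2) that by blast
  have "0 < ip (z v0) \<beta>"
    unfolding ip_expansion[OF \<beta>R]
  proof (rule sum_pos2[OF finite_simples \<gamma>(1)])
    have "\<gamma> \<in> J" using z0[of \<gamma>] \<gamma> by force
    then show "0 < coef \<beta> \<gamma> * ip (z v0) \<gamma>" using simple \<gamma>(2) by simp
    show "0 \<le> coef \<beta> \<delta> * ip (z v0) \<delta>" if "\<delta> \<in> F0" for \<delta>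
      using that z0[of \<delta>] simple[of \<delta>] coef_nonneg[OF \<beta>(1) that] by (cases "\<delta> \<in> J") auto
  qed
  then show ?thesis using pc_pos_iff[OF \<beta>R] by simp
qed

text \<open>
  The pairing takes no integral values on the alcove, so the strip containing it is found by rounding up
  at one point.
\<close>

lemma alcove_index_eq:
  assumes g: "g \<in> W" and \<alpha>: "\<alpha> \<in> R"
  shows "alcove_index \<Phi> \<alpha> (g ` base_alcove \<Phi>) = \<lceil>pc (g v0) \<alpha>\<rceil>"
  unfolding alcove_index_def ball_conj_distrib alcove_W_all[OF g \<alpha>]
proof (rule the_equality)
  have "pc (g v0) \<alpha> \<noteq> of_int \<lceil>pc (g v0) \<alpha>\<rceil>"
    using W_v0_regular[OF g] \<alpha> unfolding regular_def by blast
  then show "of_int (\<lceil>pc (g v0) \<alpha>\<rceil> - 1) < pc (g v0) \<alpha> \<and> pc (g v0) \<alpha> < of_int \<lceil>pc (g v0) \<alpha>\<rceil>"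
    by linarith
next
  fix k assume "of_int (k - 1) < pc (g v0) \<alpha> \<and> pc (g v0) \<alpha> < of_int k"
  then show "k = \<lceil>pc (g v0) \<alpha>\<rceil>" by linarith
qed

lemma alcove_ge_separating:
  assumes ge: "alcove_ge \<Phi> \<alpha> (w ` base_alcove \<Phi>) (base_alcove \<Phi>)"
    and w: "w \<in> W" and \<alpha>: "\<alpha> \<in> R" and H: "hyperplane \<Phi> \<alpha> k \<in> sep v0 (w v0)"
  shows "pc v0 \<alpha> < of_int k"
proof -
  have le: "\<lceil>pc v0 \<alpha>\<rceil> \<le> \<lceil>pc (w v0) \<alpha>\<rceil>"
    using ge alcove_index_eq[OF w \<alpha>] alcove_index_eq[OF id_W \<alpha>] by (simp add: alcove_ge_def)
  have side: "(pc v0 \<alpha> < of_int k) \<noteq> (pc (w v0) \<alpha> < of_int k)"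
    using H by (simp add: mem_sep_iff[OF v0_regular W_v0_regular[OF w] \<alpha>])
  show ?thesis
  proof (cases "pc v0 \<alpha> < of_int k")
    case False
    then have "of_int k < pc v0 \<alpha>" "pc (w v0) \<alpha> < of_int k"
      using side regular_side[OF v0_regular \<alpha>, of k] by simp_all
    then have "\<lceil>pc (w v0) \<alpha>\<rceil> \<le> k" "k < \<lceil>pc v0 \<alpha>\<rceil>" by linarith+
    with le show ?thesis by linarith
  qed simp
qed

end

section \<open>Inverses in a ring\<close>

definition is_unit_elt :: "'h::ring_1 \<Rightarrow> bool" where
  "is_unit_elt h \<longleftrightarrow> (\<exists>h'. h * h' = 1 \<and> h' * h = 1)"

lemma ring_inverse_eq:
  assumes "h * h' = 1" "h' * h = (1 :: 'h::ring_1)"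
  shows "ring_inverse h = h'"
  unfolding ring_inverse_def
proof (rule the_equality)
  fix k assume "h * k = 1 \<and> k * h = 1"
  then have "k = (h' * h) * k" "h' * (h * k) = h'" using assms by simp_all
  then show "k = h'" by (simp add: mult.assoc)
qed (use assms in simp)

lemma ring_inverse_left: "is_unit_elt h \<Longrightarrow> ring_inverse h * h = 1"
  and ring_inverse_right: "is_unit_elt h \<Longrightarrow> h * ring_inverse h = 1"
  unfolding is_unit_elt_def by (auto simp: ring_inverse_eq)

lemma ring_inverse_left': "is_unit_elt h \<Longrightarrow> ring_inverse h * (h * k) = k"
  and ring_inverse_right': "is_unit_elt h \<Longrightarrow> h * (ring_inverse h * k) = k"
  by (simp_all add: ring_inverse_left ring_inverse_right flip: mult.assoc)

lemma unit_mult: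
  assumes "is_unit_elt g" "is_unit_elt h"
  shows "is_unit_elt (g * h)" and "ring_inverse (g * h) = ring_inverse h * ring_inverse g"
proof -
  have 1: "g * h * (ring_inverse h * ring_inverse g) = 1" 
    "ring_inverse h * ring_inverse g * (g * h) = 1"
    using assms by (simp_all add: mult.assoc ring_inverse_left ring_inverse_right
        ring_inverse_left' ring_inverse_right')
  then show "is_unit_elt (g * h)" unfolding is_unit_elt_def by blast
  show "ring_inverse (g * h) = ring_inverse h * ring_inverse g" by (rule ring_inverse_eq[OF 1])
qed

lemma unit_ring_inverse: "is_unit_elt h \<Longrightarrow> is_unit_elt (ring_inverse h)"
  using ring_inverse_left ring_inverse_right unfolding is_unit_elt_def by blast

lemma ring_inverse_commute:
  assumes "is_unit_elt h" "g * h = h * g"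
  shows "g * ring_inverse h = ring_inverse h * g"
proof -
  have "ring_inverse h * (g * h) * ring_inverse h = ring_inverse h * (h * g) * ring_inverse h"
    using assms(2) by simp
  then show ?thesis
    using assms(1) by (simp add: mult.assoc ring_inverse_right ring_inverse_left')
qed

section \<open>Alcove walks in the Hecke algebra\<close>

context affine_hecke_algebra
begin

lemma sqrt_q_coeff: 
  assumes "s \<in> affine_simple_refls \<Phi>"
  shows "sqrt_q \<Phi> \<Gamma> s \<in> coeff_ring \<Phi> \<Gamma>" and "sqrt_q_inv \<Phi> \<Gamma> s \<in> coeff_ring \<Phi> \<Gamma>"
  using assms by (auto simp: sqrt_q_def sqrt_q_inv_def coeff_ring_def)

lemma coeff_minus: "a \<in> coeff_ring \<Phi> \<Gamma> \<Longrightarrow> - a \<in> coeff_ring \<Phi> \<Gamma>"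
  by (auto simp: coeff_ring_def in_keys_iff)

lemma coeff_zero: "0 \<in> coeff_ring \<Phi> \<Gamma>"
  by (simp add: coeff_ring_def)

lemma sc_zero_left: "sc 0 h = 0"
  using sc_add_left[OF coeff_zero coeff_zero, of h] by simp

lemma sc_minus: 
  assumes "a \<in> coeff_ring \<Phi> \<Gamma>"
  shows "sc (- a) h = - sc a h"
  using sc_add_left[OF assms coeff_minus[OF assms], of h] 
  by (simp add: sc_zero_left eq_neg_iff_add_eq_0 add.commute)

lemma sep_refl: "sep v0 v0 = {}"
  using sep_v0_alcove[OF v0_alcove] .

lemma sep_image_empty: "g \<in> W \<Longrightarrow> sep p q = {} \<Longrightarrow> sep (g p) (g q) = {}"
  by (simp add: sep_W_image)

text \<open>
  Appending an element of length zero crosses no hyperplane.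
\<close>

lemma T_length_zero:
  assumes c: "c \<in> W" and w: "w \<in> W" and e: "sep v0 (w v0) = {}"
  shows "T c * T w = T (c \<circ> w)"
  by (rule T_mult[OF c w len_add[OF c w]]) (simp add: sep_image_empty[OF c e])

text \<open>
  \<open>T\<^sub>1\<close> acts as the identity on the basis, hence on the unit element.
\<close>

lemma T_id: "T id = 1"
proof -
  have id: "T id * T w = T w" if w: "w \<in> W" for w
  proof -
    have "T id * T w = T (id \<circ> w)"
      by (rule T_mult[OF id_W w len_add[OF id_W w]]) (simp add: sep_refl)
    then show ?thesis by simp
  qed
  have "T id * h = h" for h
  proof -
    obtain c where c: "{w. c w \<noteq> 0} \<subseteq> W" "range c \<subseteq> coeff_ring \<Phi> \<Gamma>" 
      "h = (\<Sum>w | c w \<noteq> 0. sc (c w) (T w))"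
      using ex1_implies_ex[OF T_basis[of h]] by (elim exE conjE)
    have "T id * h = (\<Sum>w | c w \<noteq> 0. T id * sc (c w) (T w))"
      unfolding c(3) by (rule sum_distrib_left)
    also have "\<dots> = (\<Sum>w | c w \<noteq> 0. sc (c w) (T w))"
    proof (rule sum.cong[OF HOL.refl])
      fix w assume "w \<in> {w. c w \<noteq> 0}"
      then have "w \<in> W" "c w \<in> coeff_ring \<Phi> \<Gamma>" using c by auto
      then show "T id * sc (c w) (T w) = sc (c w) (T w)" by (simp add: sc_mult_right id)
    qed
    finally show ?thesis using c(3) by simp
  qed
  from this[of 1] show ?thesis by simp
qed

text \<open>
  Expand the quadratic relation; the scalars are central and \<open>q\<^bsup>1/2\<^esup> q\<^bsup>-1/2\<^esup> = 1\<close>.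
\<close>

lemma T_simple_inverse:
  assumes s: "s \<in> affine_simple_refls \<Phi>"
  defines "t \<equiv> T s + sc (sqrt_q_inv \<Phi> \<Gamma> s) 1 - sc (sqrt_q \<Phi> \<Gamma> s) 1"
  shows "T s * t = 1" and "t * T s = 1"
proof -
  define a b where "a = sc (sqrt_q \<Phi> \<Gamma> s) 1" and "b = sc (sqrt_q_inv \<Phi> \<Gamma> s) 1"
  note q = sqrt_q_coeff[OF s]
  have comm: "a * h = h * a" "b * h = h * b" for h
    by (simp_all add: a_def b_def q sc_mult_left sc_mult_right)
  have ab: "a * b = 1"
    unfolding a_def b_def sc_mult_left[OF q(1)] mult_1_left
    using sc_sc[OF q, of 1] by (simp add: sqrt_q_inverse sc_one)
  have "(T s - a) * (T s + b) = 0" using T_quadratic[OF s] by (simp add: a_def b_def)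
  then have "T s * T s + T s * b - T s * a = 1"
    by (simp add: algebra_simps ab comm(1)[of "T s"])
  then show "T s * t = 1" "t * T s = 1"
    by (simp_all add: t_def algebra_simps comm flip: a_def b_def)
qed

lemma T_simple_unit: "s \<in> affine_simple_refls \<Phi> \<Longrightarrow> is_unit_elt (T s)"
  unfolding is_unit_elt_def using T_simple_inverse by blast

text \<open>
  Split off a simple reflection at a wall that separates \<open>C\<^sub>0\<close> from \<open>wC\<^sub>0\<close>; if there is no separating
  hyperplane, \<open>w\<close> has length zero and \<open>T\<close> of its inverse is the inverse.
\<close>

lemma T_unit:
  assumes "w \<in> W"
  shows "is_unit_elt (T w)"
  using assms
proof (induction "len \<Phi> w" arbitrary: w rule: less_induct)
  case less
  show ?case
  proof (cases "sep v0 (w v0) = {}")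
    case True
    have "T (inv w) * T w = 1"
      using T_length_zero[OF W_inv[OF less.prems] less.prems True] 
      by (simp add: comp_inv_bij[OF W_bij[OF less.prems]] T_id)
    moreover have "sep v0 (inv w v0) = {}"
      using sep_image_empty[OF W_inv[OF less.prems] True] 
      by (simp add: W_inv_app[OF less.prems] sep_sym)
    then have "T w * T (inv w) = 1"
      using T_length_zero[OF less.prems W_inv[OF less.prems]] 
      by (simp add: comp_inv_bij[OF W_bij[OF less.prems]] T_id)
    ultimately show ?thesis unfolding is_unit_elt_def by blast
  next
    case False
    obtain \<alpha> k where a: "\<alpha> \<in> R" "hyperplane \<Phi> \<alpha> k \<in> sep v0 (w v0)"
      "affine hull (hyperplane \<Phi> \<alpha> k \<inter> closure (base_alcove \<Phi>)) = hyperplane \<Phi> \<alpha> k"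
      "sep v0 (reflection \<Phi> \<alpha> k v0) = {hyperplane \<Phi> \<alpha> k}"
      using wall_exists[OF W_v0_regular[OF less.prems] False] .
    let ?s = "reflection \<Phi> \<alpha> k"
    note l = len_reflection[OF a(1) less.prems a(4,2)]
    have sW: "?s \<in> W" by (rule reflection_W[OF a(1)])
    have swW: "?s \<circ> w \<in> W" by (rule W_comp[OF sW less.prems])
    have eq: "?s \<circ> (?s \<circ> w) = w" 
      using reflection_involution[OF a(1)] by (simp add: fun_eq_iff)
    have "T ?s * T (?s \<circ> w) = T w" using T_mult[OF sW swW] l(2) unfolding eq by simp
    moreover have "is_unit_elt (T ?s)"
      by (rule T_simple_unit[OF wall_affine_simple[OF a(1,3)]])
    moreover have "is_unit_elt (T (?s \<circ> w))" by (rule less.hyps[OF l(3) swW])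
    ultimately show ?thesis using unit_mult(1) by metis
  qed
qed

text \<open>
  This element is attached to the gallery from \<open>C\<^sub>0\<close> to \<open>wC\<^sub>0\<close>, with hyperplanes oriented away from
  \<open>c\<inverse>C\<^sub>0\<close>. In this form the cocycle rule \<open>walk_comp\<close> and invertibility are immediate, and no
  orientations at infinity have to be introduced: a sufficiently dominant translation \<open>c\<close> has the
  same effect.
\<close>

definition walk :: "('v \<Rightarrow> 'v) \<Rightarrow> ('v \<Rightarrow> 'v) \<Rightarrow> 'h" where
  "walk c w = ring_inverse (T c) * T (c \<circ> w)"

lemma T_walk: "c \<in> W \<Longrightarrow> T c * walk c w = T (c \<circ> w)"
  by (simp add: walk_def ring_inverse_right' T_unit)

lemma walk_comp: "c \<in> W \<Longrightarrow> v \<in> W \<Longrightarrow> walk c (v \<circ> w) = walk c v * walk (c \<circ> v) w"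
  by (simp add: walk_def mult.assoc ring_inverse_right' T_unit W_comp comp_assoc)

lemma walk_id: "walk id w = T w"
  using T_walk[OF id_W, of w] by (simp add: T_id)

lemma walk_unit: "c \<in> W \<Longrightarrow> w \<in> W \<Longrightarrow> is_unit_elt (walk c w)"
  unfolding walk_def by (intro unit_mult unit_ring_inverse T_unit W_comp)

lemma walk_length_zero: "c \<in> W \<Longrightarrow> w \<in> W \<Longrightarrow> sep v0 (w v0) = {} \<Longrightarrow> walk c w = T w"
  unfolding walk_def by (simp add: ring_inverse_left' T_unit flip: T_length_zero)

text \<open>
  The only hyperplane between \<open>cC\<^sub>0\<close> and \<open>csC\<^sub>0\<close> is \<open>cH\<close>, and it has not been crossed before.
\<close>

lemma T_step_up:
  assumes c: "c \<in> W" and s: "s \<in> W" and wall: "sep v0 (s v0) = {H}" 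
    and H: "H \<notin> sep v0 (inv c v0)"
  shows "T c * T s = T (c \<circ> s)"
proof (rule T_mult[OF c s len_add[OF c s]])
  fix H' assume H': "H' \<in> sep v0 (c v0)" "H' \<in> sep (c v0) (c (s v0))"
  then have "H' = c ` H" unfolding sep_W_image[OF c] wall by simp
  with H'(1) have "c ` H \<in> sep (c (inv c v0)) (c v0)" by (simp add: W_inv_app[OF c])
  then have "H \<in> sep (inv c v0) v0" unfolding image_mem_sep[OF c] .
  then show False using H sep_sym by simp
qed

text \<open>
  If \<open>H\<close> does not separate \<open>C\<^sub>0\<close> from \<open>c\<inverse>C\<^sub>0\<close> then the length increases from \<open>c\<close> to \<open>cs\<close>. Otherwise it
  increases from \<open>cs\<close> to \<open>c\<close>, as the alcoves \<open>C\<^sub>0\<close> and \<open>(cs)\<inverse>C\<^sub>0\<close> are then not separated by \<open>H\<close>.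
\<close>

lemma walk_reflection:
  assumes c: "c \<in> W" and \<alpha>: "\<alpha> \<in> R" 
    and wall: "sep v0 (reflection \<Phi> \<alpha> k v0) = {hyperplane \<Phi> \<alpha> k}" 
  shows "walk c (reflection \<Phi> \<alpha> k) = (if hyperplane \<Phi> \<alpha> k \<in> sep v0 (inv c v0) 
    then ring_inverse (T (reflection \<Phi> \<alpha> k)) else T (reflection \<Phi> \<alpha> k))"
proof -
  let ?s = "reflection \<Phi> \<alpha> k" let ?H = "hyperplane \<Phi> \<alpha> k"
  have s: "?s \<in> W" by (rule reflection_W[OF \<alpha>])
  have ss: "?s (?s v) = v" for v by (rule reflection_involution[OF \<alpha>])
  show ?thesis
  proof (cases "?H \<in> sep v0 (inv c v0)")
    case False
    then show ?thesis
      using T_step_up[OF c s wall False] ring_inverse_left'[OF T_unit[OF c]]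
      by (simp add: walk_def flip: T_step_up[OF c s wall False])
  next
    case True
    have cs: "c \<circ> ?s \<in> W" by (rule W_comp[OF c s])
    have inv: "inv (c \<circ> ?s) v0 = ?s (inv c v0)"
      by (simp add: W_inv_comp[OF c s] inv_reflection[OF \<alpha>])
    have "?s ` ?H = ?H"
      by (auto simp: hyperplane_def reflection_def image_iff)
    then have "?H \<in> sep v0 (?s (inv c v0)) \<longleftrightarrow> ?H \<in> sep (?s v0) (inv c v0)"
      using image_mem_sep[OF s, of ?H "?s v0" "inv c v0"] by (simp add: ss)
    also have "\<dots> \<longleftrightarrow> (?H \<in> sep (?s v0) v0) \<noteq> (?H \<in> sep v0 (inv c v0))"
      by (rule sep_diff[OF W_v0_regular[OF s] v0_regular W_v0_regular[OF W_inv[OF c]] 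
            sep_hyperplane[OF True]])
    also have "\<dots> \<longleftrightarrow> False" using True wall by (simp add: sep_sym[of "?s v0"])
    finally have "T (c \<circ> ?s) * T ?s = T (c \<circ> ?s \<circ> ?s)"
      by (intro T_step_up[OF cs s wall]) (simp add: inv)
    also have "c \<circ> ?s \<circ> ?s = c" by (simp add: fun_eq_iff ss)
    finally have e: "T (c \<circ> ?s) * T ?s = T c" .
    have "T (c \<circ> ?s) = T c * ring_inverse (T ?s)"
      unfolding e[symmetric] mult.assoc ring_inverse_right[OF T_unit[OF s]] by simp
    then show ?thesis
      using True by (simp add: walk_def ring_inverse_left' T_unit[OF c])
  qed
qed

text \<open>
  Follow a gallery from \<open>C\<^sub>0\<close> to \<open>wC\<^sub>0\<close>, splitting off simple reflections \<open>s\<close> from the left. The factor for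
  the first step depends on the side of the wall of \<open>s\<close> on which \<open>c\<inverse>C\<^sub>0\<close> lies (\<open>walk_reflection\<close>). For
  the rest of the gallery \<open>c\<close> is replaced by \<open>cs\<close>, and the orientation is reflected along with it.
\<close>

lemma walk_cong:
  assumes "c \<in> W" "d \<in> W" "w \<in> W"
    and "\<And>H. H \<in> sep v0 (w v0) \<Longrightarrow> H \<notin> sep (inv c v0) (inv d v0)"
  shows "walk c w = walk d w"
  using assms
proof (induction "len \<Phi> w" arbitrary: c d w rule: less_induct)
  case less
  note c = less.prems(1) and d = less.prems(2) and w = less.prems(3) and orient = less.prems(4)
  show ?case
  proof (cases "sep v0 (w v0) = {}")
    case True
    then show ?thesis by (simp add: walk_length_zero c d w)
  next
    case False
    obtain \<alpha> k where a: "\<alpha> \<in> R" "hyperplane \<Phi> \<alpha> k \<in> sep v0 (w v0)"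
      "affine hull (hyperplane \<Phi> \<alpha> k \<inter> closure (base_alcove \<Phi>)) = hyperplane \<Phi> \<alpha> k"
      "sep v0 (reflection \<Phi> \<alpha> k v0) = {hyperplane \<Phi> \<alpha> k}"
      using wall_exists[OF W_v0_regular[OF w] False] .
    let ?s = "reflection \<Phi> \<alpha> k"
    note l = len_reflection[OF a(1) w a(4,2)]
    have s: "?s \<in> W" by (rule reflection_W[OF a(1)])
    have ss: "?s (?s v) = v" for v by (rule reflection_involution[OF a(1)])
    have sw: "?s \<circ> w \<in> W" by (rule W_comp[OF s w])
    have eq: "?s \<circ> (?s \<circ> w) = w" by (simp add: fun_eq_iff ss)
    have "hyperplane \<Phi> \<alpha> k \<in> sep v0 (inv c v0) \<longleftrightarrow> hyperplane \<Phi> \<alpha> k \<in> sep v0 (inv d v0)"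
      using sep_diff[OF v0_regular W_v0_regular[OF W_inv[OF c]] W_v0_regular[OF W_inv[OF d]] 
          sep_hyperplane[OF a(2)]] orient[OF a(2)] by simp
    then have 1: "walk c ?s = walk d ?s"
      by (simp add: walk_reflection[OF _ a(1,4)] c d)
    have 2: "walk (c \<circ> ?s) (?s \<circ> w) = walk (d \<circ> ?s) (?s \<circ> w)"
    proof (rule less.hyps[OF l(3) W_comp[OF c s] W_comp[OF d s] sw])
      fix H assume "H \<in> sep v0 ((?s \<circ> w) v0)"
      then have "?s ` H \<in> sep (?s v0) (?s (?s (w v0)))"
        unfolding image_mem_sep[OF s] by simp
      then have "?s ` H \<in> sep v0 (w v0)" unfolding ss l(1) by simp
      then have "?s ` H \<notin> sep (inv c v0) (inv d v0)" by (rule orient)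
      then have "?s ` H \<notin> sep (?s (?s (inv c v0))) (?s (?s (inv d v0)))" unfolding ss .
      then have "H \<notin> sep (?s (inv c v0)) (?s (inv d v0))" unfolding image_mem_sep[OF s] .
      then show "H \<notin> sep (inv (c \<circ> ?s) v0) (inv (d \<circ> ?s) v0)"
        by (simp add: W_inv_comp[OF _ s] c d inv_reflection[OF a(1)])
    qed
    have "walk c w = walk c ?s * walk (c \<circ> ?s) (?s \<circ> w)"
      using walk_comp[OF c s, of "?s \<circ> w"] unfolding eq .
    also have "\<dots> = walk d w"
      using walk_comp[OF d s, of "?s \<circ> w"] unfolding eq 1 2 by simp
    finally show ?thesis .
  qed
qed

section \<open>Bernstein elements\<close>

text \<open>
  Both translations move upwards in every positive direction, so no hyperplane is crossed twice.
\<close>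

lemma T_translation_add:
  assumes x: "dominant \<Phi> x" and y: "dominant \<Phi> y"
  shows "T (translation x) * T (translation y) = T (translation (x + y))"
proof -
  have xW: "translation x \<in> W" and yW: "translation y \<in> W"
    using x y translation_W by (auto simp: dominant_def)
  have "T (translation x) * T (translation y) = T (translation x \<circ> translation y)"
  proof (rule T_mult[OF xW yW len_add[OF xW yW]])
    fix H assume H: "H \<in> sep v0 (translation x v0)" 
      "H \<in> sep (translation x v0) (translation x (translation y v0))"
    note reg = v0_regular W_v0_regular[OF xW] regular_W[OF xW W_v0_regular[OF yW]]
    obtain \<beta> k where \<beta>: "\<beta> \<in> Rp" "H = hyperplane \<Phi> \<beta> k"
      using hyperplanes_cases_pos[OF sep_hyperplane[OF H(1)]] .
    have "0 \<le> pc x \<beta>" "0 \<le> pc y \<beta>" using x y \<beta>(1) by (auto simp: dominant_def)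
    then show False
      using H unfolding \<beta>(2) mem_sep_iff[OF reg(1,2) pos_root[OF \<beta>(1)]]
        mem_sep_iff[OF reg(2,3) pos_root[OF \<beta>(1)]]
      by (auto simp: translation_def)
  qed
  also have "translation x \<circ> translation y = translation (x + y)"
    by (simp add: translation_def fun_eq_iff add.assoc)
  finally show ?thesis .
qed

text \<open>
  The elements \<open>T\<close> of dominant translations commute and are multiplicative. So the quotient defining
  \<open>\<theta>\<close> depends on the difference only, and its factors can be interchanged.
\<close>

lemma theta_eq:
  assumes x: "dominant \<Phi> x" and x': "dominant \<Phi> x'"
  shows "theta \<Phi> T (x - x') = walk (translation x') (translation (x - x'))"
proof -
  have unit: "is_unit_elt (T (translation y))" if "dominant \<Phi> y" for y
    using that T_unit translation_W by (auto simp: dominant_def)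
  have comm: "T (translation y) * T (translation y') = T (translation y') * T (translation y)"
    if "dominant \<Phi> y" "dominant \<Phi> y'" for y y'
    using that by (simp add: T_translation_add add.commute)
  have icomm: "T (translation y) * ring_inverse (T (translation y')) = 
      ring_inverse (T (translation y')) * T (translation y)" if "dominant \<Phi> y" "dominant \<Phi> y'" for y y'
    by (rule ring_inverse_commute[OF unit[OF that(2)] comm[OF that]])
  have "theta \<Phi> T (x - x') = T (translation x) * ring_inverse (T (translation x'))"
    unfolding theta_def
  proof (rule the_equality)
    show "\<exists>y y'. dominant \<Phi> y \<and> dominant \<Phi> y' \<and> x - x' = y - y' \<and>
      T (translation x) * ring_inverse (T (translation x')) = 
      T (translation y) * ring_inverse (T (translation y'))"
      by (rule exI[of _ x], rule exI[of _ x']) (simp add: x x')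
  next
    fix h assume "\<exists>y y'. dominant \<Phi> y \<and> dominant \<Phi> y' \<and> x - x' = y - y' \<and>
      h = T (translation y) * ring_inverse (T (translation y'))"
    then obtain y y' where y: "dominant \<Phi> y" "dominant \<Phi> y'" "x - x' = y - y'" 
      and h: "h = T (translation y) * ring_inverse (T (translation y'))"
      by (elim exE conjE)
    let ?X = "T (translation x)" let ?X' = "T (translation x')"
    let ?Y = "T (translation y)" let ?Y' = "T (translation y')"
    have "x + y' = y + x'" using y(3) by (simp add: algebra_simps)
    then have XY: "?X * ?Y' = ?Y * ?X'" using x x' y by (simp add: T_translation_add)
    have "h = ?Y * (?X' * ring_inverse ?X') * ring_inverse ?Y'"
      by (simp add: h ring_inverse_right[OF unit[OF x']])
    also have "\<dots> = ?X * (?Y' * ring_inverse ?X') * ring_inverse ?Y'"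
      by (simp add: XY flip: mult.assoc)
    also have "\<dots> = ?X * ring_inverse ?X' * (?Y' * ring_inverse ?Y')"
      by (simp add: icomm[OF y(2) x'] mult.assoc)
    also have "\<dots> = ?X * ring_inverse ?X'" by (simp add: ring_inverse_right[OF unit[OF y(2)]])
    finally show "h = ?X * ring_inverse ?X'" .
  qed
  also have "\<dots> = walk (translation x') (translation (x - x'))"
    unfolding walk_def icomm[OF x x'] by (simp add: translation_def o_def)
  finally show ?thesis .
qed

end

section \<open>The parabolic subalgebra\<close>

context affine_hecke_algebra
begin

abbreviation "HJ J \<equiv> hecke_on \<Phi> \<Gamma> sc T J"

lemma hecke_on_mult: "x \<in> HJ J \<Longrightarrow> y \<in> HJ J \<Longrightarrow> x * y \<in> HJ J"
  unfolding hecke_on_def by (rule algebra_generated.intros)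

lemma T_hecke_on: "u \<in> refl_group \<Phi> J \<Longrightarrow> \<delta> \<in> aut_on \<Phi> \<Gamma> J \<Longrightarrow> T (u \<circ> \<delta>) \<in> HJ J"
  unfolding hecke_on_def by (rule algebra_generated.intros(2), rule UnI2) blast

lemma theta_hecke_on: "x \<in> X \<Longrightarrow> theta \<Phi> T x \<in> HJ J"
  unfolding hecke_on_def by (intro algebra_generated.intros(2) UnI1 imageI)

lemma id_aut_on: "id \<in> aut_on \<Phi> \<Gamma> J"
  by (simp add: aut_on_def id_automorphism)

lemma ring_inverse_simple_hecke_on:
  assumes J: "J \<subseteq> F0" and \<alpha>: "\<alpha> \<in> J"
  shows "ring_inverse (T (lrefl \<alpha>)) \<in> HJ J"
proof -
  have s: "lrefl \<alpha> \<in> affine_simple_refls \<Phi>"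
    using simple_affine_simple J \<alpha> by (simp add: subset_iff)
  note q = sqrt_q_coeff[OF s]
  have "T (lrefl \<alpha>) \<in> HJ J"
    using T_hecke_on[OF lrefl_refl_group[OF \<alpha>] id_aut_on] by simp
  moreover have "ring_inverse (T (lrefl \<alpha>)) = 
      T (lrefl \<alpha>) + sc (sqrt_q_inv \<Phi> \<Gamma> (lrefl \<alpha>)) 1 + sc (- sqrt_q \<Phi> \<Gamma> (lrefl \<alpha>)) 1"
    using ring_inverse_eq[OF T_simple_inverse[OF s]] by (simp add: sc_minus[OF q(1)])
  ultimately show ?thesis
    unfolding hecke_on_def
    by (simp add: algebra_generated.intros q coeff_minus)
qed

text \<open>
  By the cocycle rule, a product of factors \<open>T\<^sub>s\<close> and \<open>T\<^sub>s\<inverse>\<close> with \<open>s \<in> J\<close>.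
\<close>

lemma walk_inner:
  assumes J: "J \<subseteq> F0" and c: "c \<in> W" and u: "u \<in> refl_group \<Phi> J"
  shows "walk c u \<in> HJ J"
  using u c
proof (induction arbitrary: c rule: refl_group.induct)
  case 1
  have w: "walk c id = T id" by (rule walk_length_zero[OF 1 id_W]) (simp add: sep_refl)
  show ?case 
    using T_hecke_on[OF refl_group.intros(1) id_aut_on] unfolding w by (simp only: comp_id)
next
  case (2 \<alpha> w)
  have \<alpha>F: "\<alpha> \<in> F0" and \<alpha>R: "\<alpha> \<in> R" using J 2(1) simple_root by auto
  have sW: "lrefl \<alpha> \<in> W" by (rule reflection_W[OF \<alpha>R])
  have "walk c (lrefl \<alpha>) \<in> HJ J"
    using ring_inverse_simple_hecke_on[OF J 2(1)] 
      T_hecke_on[OF lrefl_refl_group[OF 2(1)] id_aut_on]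
    by (simp add: walk_reflection[OF 2(4) \<alpha>R sep_v0_simple[OF \<alpha>F]])
  moreover have "walk (c \<circ> lrefl \<alpha>) w \<in> HJ J" by (rule 2(3)[OF W_comp[OF 2(4) sW]])
  ultimately show ?case unfolding walk_comp[OF 2(4) sW] by (rule hecke_on_mult)
qed

lemma walk_automorphism:
  assumes c: "c \<in> W" and \<delta>: "\<delta> \<in> aut_on \<Phi> \<Gamma> J"
  shows "walk c \<delta> \<in> HJ J"
proof -
  have "\<delta> \<in> \<Gamma>" using \<delta> by (simp add: aut_on_def)
  then have "walk c \<delta> = T \<delta>"
    by (intro walk_length_zero[OF c] Gamma_W sep_v0_alcove Gamma_alcove)
  then show ?thesis using T_hecke_on[OF refl_group.intros(1) \<delta>] by simp
qed

lemma inv_translation: "inv (translation x) v = v - x"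
  by (rule inv_f_eq) (simp_all add: translation_def inj_def)

lemma inv_translation_comp:
  assumes "g \<in> W" "x \<in> X"
  shows "inv (translation x \<circ> g) v = inv g (v - x)"
  by (simp add: W_inv_comp translation_W assms inv_translation)

section \<open>Alcove elements modulo commutators\<close>

definition pc_bound :: "'v \<Rightarrow> real" where
  "pc_bound x = (\<Sum>\<beta>\<in>R. \<bar>pc x \<beta>\<bar>)"

lemma abs_pc_le_bound: "\<beta> \<in> R \<Longrightarrow> \<bar>pc x \<beta>\<bar> \<le> pc_bound x"
  unfolding pc_bound_def by (rule member_le_sum) (simp_all add: finite_roots)

lemma pc_bound_nonneg: "0 \<le> pc_bound x"
  unfolding pc_bound_def by (simp add: sum_nonneg)

text \<open>
  By definition \<open>\<theta>\<^sub>x\<close> is the walk for \<open>t\<^sup>x\<close> oriented away from \<open>C\<^sub>0 - \<nu>\<close> with \<open>\<nu>\<close> very dominant, which lies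
  below all hyperplanes crossed. The same holds for the alcove \<open>u\<inverse>(C\<^sub>0 - \<mu>)\<close> with \<open>\<mu>\<close> a large multiple
  of \<open>\<rho>\<^sub>J\<close>. In the outer directions this is because \<open>\<mu>\<close> is large and \<open>u\<close> permutes them. A
  hyperplane of \<open>\<beta> \<in> R\<^sub>J\<^sup>+\<close> is crossed at a level at least 1, because \<open>x\<close> is dominant for \<open>R\<^sub>J\<close>, while the
  values of \<open>\<beta>\<close> on \<open>u\<inverse>(C\<^sub>0 - \<mu>)\<close> are less than 1, because \<open>\<mu>\<close> is orthogonal to \<open>R\<^sub>J\<close>.
\<close>

lemma walk_translation:
  assumes J: "J \<subseteq> F0" and u: "u \<in> refl_group \<Phi> J" and x: "x \<in> X"
    and dom: "\<And>\<beta>. \<beta> \<in> Rp \<Longrightarrow> \<beta> \<in> span J \<Longrightarrow> 0 \<le> pc x \<beta>"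
    and N: "2 + pc_bound x \<le> of_int N"
  shows "walk (translation (of_int N *\<^sub>R rho J) \<circ> u) (translation x) = theta \<Phi> T x"
proof -
  define \<mu> where "\<mu> = of_int N *\<^sub>R rho J"
  define \<nu> where "\<nu> = of_int N *\<^sub>R rho {}"
  have X: "\<mu> \<in> X" "\<nu> \<in> X" by (simp_all add: \<mu>_def \<nu>_def latX_scale rho_latX)
  have N1: "1 \<le> real_of_int N" using N pc_bound_nonneg[of x] by linarith
  have \<nu>: "N \<le> pc \<nu> \<beta>" if "\<beta> \<in> Rp" for \<beta>
    using mult_left_mono[OF pc_rho_outer[of "{}" \<beta>], of "real_of_int N"] that N1
    by (simp add: outer_empty \<nu>_def)
  have \<mu>: "N \<le> pc \<mu> \<beta>" if "\<beta> \<in> outer J" for \<beta>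
    using mult_left_mono[OF pc_rho_outer[OF J that], of "real_of_int N"] N1
    by (simp add: \<mu>_def)
  have d\<nu>: "dominant \<Phi> \<nu>" 
    using X \<nu> N1 by (force simp: dominant_def)
  have dx\<nu>: "dominant \<Phi> (x + \<nu>)"
    unfolding dominant_def
  proof (intro conjI ballI)
    fix \<beta> assume "\<beta> \<in> Rp"
    then show "0 \<le> pc (x + \<nu>) \<beta>"
      using \<nu>[of \<beta>] abs_pc_le_bound[OF pos_root[of \<beta>], of x] N by simp
  qed (simp add: X x latX_add)
  have uW: "u \<in> W" and uaut: "u \<in> aut" 
    using refl_group_mono[OF u, of R] refl_group_aut[OF u] J simples_roots weyl_W by auto
  have tW: "translation \<mu> \<in> W" "translation \<nu> \<in> W" "translation x \<in> W"
    by (simp_all add: translation_W X x)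
  have cW: "translation \<mu> \<circ> u \<in> W" by (rule W_comp[OF tW(1) uW])
  have "walk (translation \<mu> \<circ> u) (translation x) = walk (translation \<nu>) (translation x)"
  proof (rule walk_cong[OF cW tW(2,3)])
    fix H assume H: "H \<in> sep v0 (translation x v0)"
    obtain \<beta> k where \<beta>: "\<beta> \<in> Rp" "H = hyperplane \<Phi> \<beta> k"
      using hyperplanes_cases_pos[OF sep_hyperplane[OF H]] .
    have \<beta>R: "\<beta> \<in> R" by (rule pos_root[OF \<beta>(1)])
    have s: "(pc v0 \<beta> < k) \<noteq> (pc v0 \<beta> + pc x \<beta> < k)"
      using H unfolding \<beta>(2) mem_sep_iff[OF v0_regular W_v0_regular[OF tW(3)] \<beta>R]
      by (simp add: translation_def add.commute)
    note v = v0_pos[OF \<beta>(1)] v0_less[OF \<beta>(1)] abs_pc_le_bound[OF \<beta>R, of x]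
    have low: "- pc_bound x < k" using s v by linarith
    have "pc (inv (translation \<nu>) v0) \<beta> < k"
      using \<nu>[OF \<beta>(1)] low v N by (simp add: inv_translation)
    moreover have "pc (inv (translation \<mu> \<circ> u) v0) \<beta> < k"
    proof -
      have val: "pc (inv (translation \<mu> \<circ> u) v0) \<beta> = pc v0 (u \<beta>) - pc \<mu> (u \<beta>)"
        using pc_aut[OF uaut \<beta>R, of "inv u (v0 - \<mu>)"]
        by (simp add: inv_translation_comp[OF uW X(1)] W_inv_app[OF uW])
      have u\<beta>: "u \<beta> \<in> R" by (rule aut_root[OF uaut \<beta>R])
      show ?thesis
      proof (cases "\<beta> \<in> span J")
        case True
        have "pc \<mu> (u \<beta>) = 0" 
          using pc_rho_inner[OF J u\<beta> refl_group_span[OF u True]] by (simp add: \<mu>_def)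
        moreover have "1 \<le> k"
        proof -
          have "pc v0 \<beta> < k" using s dom[OF \<beta>(1) True] by linarith
          then show ?thesis using v(1) by linarith
        qed
        ultimately show ?thesis unfolding val using v0_bounds[OF u\<beta>] by simp
      next
        case False
        then have "u \<beta> \<in> outer J" using refl_group_outer[OF J u] \<beta>(1) by (simp add: mem_outer)
        from \<mu>[OF this] show ?thesis unfolding val using v0_bounds[OF u\<beta>] low N by linarith
      qed
    qed
    ultimately show "H \<notin> sep (inv (translation \<mu> \<circ> u) v0) (inv (translation \<nu>) v0)"
      unfolding \<beta>(2) mem_sep_iff[OF W_v0_regular[OF W_inv[OF cW]] W_v0_regular[OF W_inv[OF tW(2)]] \<beta>R]
      by simp
  qed
  also have "\<dots> = theta \<Phi> T x"
    using theta_eq[OF dx\<nu> d\<nu>] by simp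
  finally show ?thesis unfolding \<mu>_def .
qed

text \<open>
  Conjugating \<open>x\<close> into the \<open>J\<close>-dominant cone by \<open>v \<in> W\<^sub>J\<close> writes the element as
  \<open>v\<inverse> t\<^bsup>vx\<^esup> (vu) \<delta>\<close>. The cocycle rule splits the walk accordingly, and every factor is in the
  subalgebra.
\<close>

lemma walk_parabolic:
  assumes J: "J \<subseteq> F0" and x: "x \<in> X" and u: "u \<in> refl_group \<Phi> J" and \<delta>: "\<delta> \<in> aut_on \<Phi> \<Gamma> J"
  shows "\<exists>M. \<forall>N. M \<le> real_of_int N \<longrightarrow>
    walk (translation (of_int N *\<^sub>R rho J)) (translation x \<circ> u \<circ> \<delta>) \<in> HJ J"
proof -
  have JR: "J \<subseteq> R" using J simples_roots by blast
  obtain v where v: "v \<in> refl_group \<Phi> J" "\<forall>\<alpha>\<in>J. 0 \<le> ip (v x) \<alpha>"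
    using dominant_conjugate[OF J] by blast
  have vaut: "v \<in> aut" by (rule refl_group_aut[OF v(1) JR])
  have iv: "inv v \<in> refl_group \<Phi> J" by (rule refl_group_inv[OF v(1) JR])
  define \<nu> where "\<nu> = v x"
  have \<nu>X: "\<nu> \<in> X" unfolding \<nu>_def by (rule aut_latX[OF vaut x])
  have W: "translation \<nu> \<in> W" "inv v \<in> W" "v \<circ> u \<in> W" "\<delta> \<in> W"
    using translation_W[OF \<nu>X] weyl_W[OF refl_group_mono[OF iv JR]] 
      weyl_W[OF refl_group_mono[OF refl_group_comp[OF v(1) u] JR]] Gamma_W \<delta>
    by (simp_all add: aut_on_def)
  have eq: "translation x \<circ> u \<circ> \<delta> = inv v \<circ> (translation \<nu> \<circ> ((v \<circ> u) \<circ> \<delta>))"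
  proof
    fix p
    have "inv v (v x + v (u (\<delta> p))) = inv v (v (x + u (\<delta> p)))"
      by (simp add: linear_add[OF aut_linear[OF vaut]])
    then show "(translation x \<circ> u \<circ> \<delta>) p = (inv v \<circ> (translation \<nu> \<circ> ((v \<circ> u) \<circ> \<delta>))) p"
      by (simp add: translation_def \<nu>_def inv_app(2)[OF aut_bij[OF vaut]])
  qed
  have "walk (translation (of_int N *\<^sub>R rho J)) (translation x \<circ> u \<circ> \<delta>) \<in> HJ J"
    if N: "2 + pc_bound \<nu> \<le> of_int N" for N
  proof -
    define a where "a = translation (of_int N *\<^sub>R rho J)"
    have a: "a \<in> W" unfolding a_def by (intro translation_W latX_scale rho_latX)
    have c: "a \<circ> inv v \<in> W" "a \<circ> inv v \<circ> translation \<nu> \<in> W" 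
        "a \<circ> inv v \<circ> translation \<nu> \<circ> (v \<circ> u) \<in> W"
      using W_comp[OF W_comp[OF W_comp[OF a W(2)] W(1)] W(3)] 
        W_comp[OF W_comp[OF a W(2)] W(1)] W_comp[OF a W(2)] by simp_all
    have "walk (a \<circ> inv v) (translation \<nu>) = theta \<Phi> T \<nu>"
      unfolding a_def
      by (rule walk_translation[OF J iv \<nu>X _ N]) (unfold \<nu>_def, rule ip_nonneg_inner[OF J v(2)])
    then have "walk a (translation x \<circ> u \<circ> \<delta>) = walk a (inv v) * (theta \<Phi> T \<nu> * 
        (walk (a \<circ> inv v \<circ> translation \<nu>) (v \<circ> u) * 
         walk (a \<circ> inv v \<circ> translation \<nu> \<circ> (v \<circ> u)) \<delta>))"
      unfolding eq walk_comp[OF a W(2)] walk_comp[OF c(1) W(1)] walk_comp[OF c(2) W(3)] by simp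
    then show ?thesis
      unfolding a_def[symmetric]
      by (simp only: hecke_on_mult walk_inner[OF J a iv] theta_hecke_on[OF \<nu>X] 
          walk_inner[OF J c(2) refl_group_comp[OF v(1) u]] walk_automorphism[OF c(3) \<delta>])
  qed
  then show ?thesis by (intro exI[of _ "2 + pc_bound \<nu>"] allI impI)
qed

text \<open>
  The alcoves \<open>(t\<^sup>\<mu> z)\<inverse>C\<^sub>0\<close> and \<open>C\<^sub>0\<close> are on the same side of every hyperplane separating \<open>C\<^sub>0\<close> from \<open>wC\<^sub>0\<close>,
  where \<open>\<mu>\<close> is a positive multiple of \<open>\<rho>\<^sub>J\<close>. Let \<open>\<gamma>\<close> be a root with \<open>z\<gamma> > 0\<close> for such a hyperplane. If
  \<open>z\<gamma> \<in> R\<^sub>J\<close>, then \<open>\<gamma> > 0\<close> by minimality of \<open>z\<close>, and both alcoves lie in the strip between levels 0 and 1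
  of \<open>\<gamma>\<close>. If \<open>z\<gamma>\<close> is outer, then \<open>C\<^sub>0\<close> is below the hyperplane by the alcove condition, and the other
  alcove has negative values of \<open>\<gamma>\<close>, while the level of the hyperplane is at least 0.
\<close>

lemma walk_alcove_element:
  assumes J: "J \<subseteq> F0" and z: "z \<in> min_coset_reps \<Phi> J" 
    and w: "alcove_element \<Phi> \<Gamma> J z w" and N: "1 \<le> N"
  shows "walk (translation (of_int N *\<^sub>R rho J) \<circ> z) w = T w"
proof -
  define \<mu> where "\<mu> = of_int N *\<^sub>R rho J"
  have \<mu>X: "\<mu> \<in> X" by (simp add: \<mu>_def latX_scale rho_latX)
  have z0: "z \<in> weyl_group \<Phi>" using z by (simp add: min_coset_reps_def)
  have zW: "z \<in> W" by (rule weyl_W[OF z0])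
  have zaut: "z \<in> aut" by (rule refl_group_aut[OF z0 subset_refl])
  have wW: "w \<in> W" using w by (simp add: alcove_element_def)
  have cW: "translation \<mu> \<circ> z \<in> W" by (rule W_comp[OF translation_W[OF \<mu>X] zW])
  have "walk (translation \<mu> \<circ> z) w = walk id w"
  proof (rule walk_cong[OF cW id_W wW])
    fix H assume H: "H \<in> sep v0 (w v0)"
    \<comment> \<open>The pairs \<open>(\<gamma>, k)\<close> and \<open>(-\<gamma>, -k)\<close> define the same hyperplane, so \<open>z\<gamma>\<close> can be taken positive.\<close>
    obtain \<gamma> k where \<gamma>: "\<gamma> \<in> R" "H = hyperplane \<Phi> \<gamma> k" "z \<gamma> \<in> Rp"
    proof -
      obtain \<gamma> k where \<gamma>: "\<gamma> \<in> R" "H = hyperplane \<Phi> \<gamma> k"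
        using hyperplanes_cases[OF sep_hyperplane[OF H]] .
      have "z (- \<gamma>) = - z \<gamma>" by (rule linear_neg[OF aut_linear[OF zaut]])
      then show thesis
        using pos_or_neg[OF aut_root[OF zaut \<gamma>(1)]] that[OF \<gamma>] 
          that[OF minus_root[OF \<gamma>(1)], of "- k"] hyperplane_minus[OF \<gamma>(1), of k] \<gamma>(2) by auto
    qed
    have val: "pc (inv (translation \<mu> \<circ> z) v0) \<gamma> = pc v0 (z \<gamma>) - pc \<mu> (z \<gamma>)"
      using pc_aut[OF zaut \<gamma>(1), of "inv z (v0 - \<mu>)"]
      by (simp add: inv_translation_comp[OF zW \<mu>X] W_inv_app[OF zW])
    have "(pc (inv (translation \<mu> \<circ> z) v0) \<gamma> < k) = (pc v0 \<gamma> < k)"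
    proof (cases "z \<gamma> \<in> span J")
      case True
      have "pc \<mu> (z \<gamma>) = 0" 
        using pc_rho_inner[OF J pos_root[OF \<gamma>(3)] True] by (simp add: \<mu>_def)
      moreover have "0 < pc v0 (z \<gamma>)" "pc v0 (z \<gamma>) < 1" using v0_pos v0_less \<gamma>(3) by auto
      moreover have "0 < pc v0 \<gamma>"
        using min_coset_rep_pos[OF J z \<gamma>(3) True] by (simp add: pc_aut[OF zaut \<gamma>(1)])
      moreover have "pc v0 \<gamma> < 1" by (rule v0_bounds[OF \<gamma>(1)])
      moreover have "a < real_of_int k \<longleftrightarrow> 1 \<le> k" if "0 < a" "a < 1" for a
        using that by (auto; linarith)
      ultimately show ?thesis unfolding val by simp
    next
      case False
      have out: "z \<gamma> \<in> outer J" using \<gamma>(3) False by (simp add: mem_outer)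
      have "inv z (z \<gamma>) = \<gamma>" by (rule inv_app(2)[OF aut_bij[OF zaut]])
      moreover have "alcove_ge \<Phi> (inv z (z \<gamma>)) (w ` base_alcove \<Phi>) (base_alcove \<Phi>)"
        using w out by (simp add: alcove_element_def outer_def)
      ultimately have "alcove_ge \<Phi> \<gamma> (w ` base_alcove \<Phi>) (base_alcove \<Phi>)" by simp
      then have lt: "pc v0 \<gamma> < k"
        by (rule alcove_ge_separating[OF _ wW \<gamma>(1) H[unfolded \<gamma>(2)]])
      moreover have "-1 < real_of_int k" using lt v0_bounds(1)[OF \<gamma>(1)] by linarith
      then have "0 \<le> real_of_int k" by simp
      moreover have "real_of_int N \<le> pc \<mu> (z \<gamma>)"
        using mult_left_mono[OF pc_rho_outer[OF J out], of "real_of_int N"] N by (simp add: \<mu>_def)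
      ultimately show ?thesis unfolding val using v0_less[OF \<gamma>(3)] N by simp
    qed
    then show "H \<notin> sep (inv (translation \<mu> \<circ> z) v0) (inv id v0)"
      unfolding \<gamma>(2) mem_sep_iff[OF W_v0_regular[OF W_inv[OF cW]] 
          W_v0_regular[OF W_inv[OF id_W]] \<gamma>(1)] by simp
  qed
  then show ?thesis by (simp add: walk_id \<mu>_def)
qed

text \<open>
  The hyperplanes separating \<open>C\<^sub>0\<close> from \<open>zC\<^sub>0\<close> belong to outer roots \<open>\<beta>\<close> at level 0, by minimality of \<open>z\<close>.
  Both orientations come from alcoves below them: with \<open>g = u\<delta>\<close>, the values of \<open>\<beta>\<close> on \<open>g\<inverse>(C\<^sub>0 - \<mu> - x)\<close>
  are those of the outer root \<open>g\<beta>\<close> on \<open>C\<^sub>0 - \<mu> - x\<close>, hence negative if \<open>\<mu>\<close> is a large multiple of \<open>\<rho>\<^sub>J\<close>.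
\<close>

lemma walk_outer_cong:
  assumes J: "J \<subseteq> F0" and z: "z \<in> min_coset_reps \<Phi> J" 
    and x: "x \<in> X" and u: "u \<in> refl_group \<Phi> J" and \<delta>: "\<delta> \<in> aut_on \<Phi> \<Gamma> J"
    and N: "1 + pc_bound x \<le> of_int N"
  shows "walk (translation (of_int N *\<^sub>R rho J) \<circ> (translation x \<circ> u \<circ> \<delta>)) z = 
    walk (translation (of_int N *\<^sub>R rho J)) z"
proof -
  define \<mu> where "\<mu> = of_int N *\<^sub>R rho J"
  have \<mu>X: "\<mu> \<in> X" by (simp add: \<mu>_def latX_scale rho_latX)
  have N1: "1 \<le> real_of_int N" using N pc_bound_nonneg[of x] by linarith
  have \<mu>: "N \<le> pc \<mu> \<beta>" if "\<beta> \<in> outer J" for \<beta>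
    using mult_left_mono[OF pc_rho_outer[OF J that], of "real_of_int N"] N1
    by (simp add: \<mu>_def)
  have JR: "J \<subseteq> R" using J simples_roots by blast
  have z0: "z \<in> weyl_group \<Phi>" using z by (simp add: min_coset_reps_def)
  have zW: "z \<in> W" by (rule weyl_W[OF z0])
  have zaut: "z \<in> aut" by (rule refl_group_aut[OF z0 subset_refl])
  have \<delta>\<Gamma>: "\<delta> \<in> \<Gamma>" using \<delta> by (simp add: aut_on_def)
  define g where "g = u \<circ> \<delta>"
  have gaut: "g \<in> aut" unfolding g_def by (rule aut_comp[OF refl_group_aut[OF u JR] Gamma_aut[OF \<delta>\<Gamma>]])
  have gW: "g \<in> W" unfolding g_def by (rule W_comp[OF weyl_W[OF refl_group_mono[OF u JR]] Gamma_W[OF \<delta>\<Gamma>]])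
  have eq: "translation \<mu> \<circ> (translation x \<circ> u \<circ> \<delta>) = translation (\<mu> + x) \<circ> g"
    by (simp add: g_def translation_def fun_eq_iff add.assoc)
  have X: "\<mu> + x \<in> X" by (rule latX_add[OF \<mu>X x])
  have W: "translation \<mu> \<in> W" "translation (\<mu> + x) \<circ> g \<in> W"
    by (rule translation_W[OF \<mu>X], rule W_comp[OF translation_W[OF X] gW])
  have "walk (translation (\<mu> + x) \<circ> g) z = walk (translation \<mu>) z"
  proof (rule walk_cong[OF W(2,1) zW])
    fix H assume H: "H \<in> sep v0 (z v0)"
    obtain \<beta> k where \<beta>: "\<beta> \<in> Rp" "H = hyperplane \<Phi> \<beta> k"
      using hyperplanes_cases_pos[OF sep_hyperplane[OF H]] .
    have \<beta>R: "\<beta> \<in> R" by (rule pos_root[OF \<beta>(1)])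
    have s: "(pc v0 \<beta> < k) \<noteq> (pc (z v0) \<beta> < k)"
      using H by (simp add: \<beta>(2) mem_sep_iff[OF v0_regular W_v0_regular[OF zW] \<beta>R])
    note v = v0_pos[OF \<beta>(1)] v0_less[OF \<beta>(1)]
    have i\<beta>: "inv z \<beta> \<in> R" by (rule aut_root[OF aut_inv[OF zaut] \<beta>R])
    have zv: "-1 < pc (z v0) \<beta>" "pc (z v0) \<beta> < 1"
      using v0_bounds[OF i\<beta>] by (simp_all add: pc_aut'[OF zaut \<beta>R])
    have k: "k = 0" and neg: "pc (z v0) \<beta> < 0"
    proof -
      show "k = 0"
      proof (rule ccontr)
        assume "k \<noteq> 0"
        then have "1 \<le> k \<or> k \<le> - 1" by linarith
        then have "1 \<le> real_of_int k \<or> real_of_int k \<le> - 1" by linarith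
        then show False using s v zv by linarith
      qed
      then show "pc (z v0) \<beta> < 0" using s v by simp
    qed
    have out: "\<beta> \<in> outer J"
      using min_coset_rep_pos[OF J z \<beta>(1)] neg \<beta>(1) by (auto simp: mem_outer)
    have out': "g \<beta> \<in> outer J"
      unfolding g_def o_apply by (rule refl_group_outer[OF J u aut_on_outer[OF \<delta> out]])
    then have g\<beta>: "g \<beta> \<in> Rp" "g \<beta> \<in> R" by (simp_all add: mem_outer pos_root)
    have "pc (inv (translation \<mu>) v0) \<beta> < k"
      using \<mu>[OF out] N1 v by (simp add: inv_translation k)
    moreover have "pc (inv (translation (\<mu> + x) \<circ> g) v0) \<beta> = pc v0 (g \<beta>) - pc \<mu> (g \<beta>) - pc x (g \<beta>)"
      using pc_aut[OF gaut \<beta>R, of "inv g (v0 - (\<mu> + x))"]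
      by (simp add: inv_translation_comp[OF gW X] W_inv_app[OF gW])
    then have "pc (inv (translation (\<mu> + x) \<circ> g) v0) \<beta> < k"
      using \<mu>[OF out'] N v0_less[OF g\<beta>(1)] abs_pc_le_bound[OF g\<beta>(2), of x] by (simp add: k)
    ultimately show "H \<notin> sep (inv (translation (\<mu> + x) \<circ> g) v0) (inv (translation \<mu>) v0)"
      unfolding \<beta>(2) mem_sep_iff[OF W_v0_regular[OF W_inv[OF W(2)]] W_v0_regular[OF W_inv[OF W(1)]] \<beta>R]
      by simp
  qed
  then show ?thesis using eq by (simp add: \<mu>_def)
qed

lemma conjugate_cocenter:
  assumes "is_unit_elt e"
  shows "ring_inverse e * (h * e) - h \<in> commutator_module \<Phi> \<Gamma> sc"
proof -
  have eq: "ring_inverse e * (h * e) - h = ring_inverse e * (h * e) - (h * e) * ring_inverse e"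
    by (simp add: mult.assoc ring_inverse_right[OF assms])
  show ?thesis
    unfolding commutator_module_def eq by (rule module_generated.intros(2)) blast
qed

lemma alcove_element_cocenter:
  assumes J: "J \<subseteq> F0" and z: "z \<in> min_coset_reps \<Phi> J" and w: "alcove_element \<Phi> \<Gamma> J z w"
  shows "\<exists>h \<in> HJ J. T w - h \<in> commutator_module \<Phi> \<Gamma> sc"
proof -
  define y where "y = z \<circ> w \<circ> inv z"
  have "y \<in> ext_affine_weyl_on \<Phi> \<Gamma> J" using w by (simp add: alcove_element_def y_def)
  then obtain x u \<delta> where y: "y = translation x \<circ> u \<circ> \<delta>" 
    and x: "x \<in> X" and u: "u \<in> refl_group \<Phi> J" and \<delta>: "\<delta> \<in> aut_on \<Phi> \<Gamma> J"
    unfolding ext_affine_weyl_on_def by (elim CollectE exE conjE)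
  obtain M where M: "\<forall>N. M \<le> real_of_int N \<longrightarrow>
    walk (translation (of_int N *\<^sub>R rho J)) (translation x \<circ> u \<circ> \<delta>) \<in> HJ J"
    using walk_parabolic[OF J x u \<delta>] by (elim exE)
  \<comment> \<open>One multiple of \<open>\<rho>\<^sub>J\<close> that is large enough for all three walk lemmas.\<close>
  obtain N where N: "max M (1 + pc_bound x) \<le> real_of_int N"
    using ex_le_of_int by blast
  define a where "a = translation (of_int N *\<^sub>R rho J)"
  have aW: "a \<in> W" unfolding a_def by (intro translation_W latX_scale rho_latX)
  have wW: "w \<in> W" using w by (simp add: alcove_element_def)
  have zW: "z \<in> W" using z by (intro weyl_W) (simp add: min_coset_reps_def)
  have yW: "y \<in> W" unfolding y_def by (intro W_comp W_inv zW wW)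
  have zw: "z \<circ> w = y \<circ> z" by (simp add: y_def fun_eq_iff W_inv_app[OF zW])
  define e where "e = walk a z"
  have e: "is_unit_elt e" unfolding e_def by (rule walk_unit[OF aW zW])
  have ey: "walk (a \<circ> y) z = e"
    unfolding e_def a_def y by (rule walk_outer_cong[OF J z x u \<delta>]) (use N in simp)
  have "1 \<le> N" using N pc_bound_nonneg[of x] by simp
  then have "T w = walk (a \<circ> z) w"
    unfolding a_def by (rule walk_alcove_element[OF J z w, symmetric])
  also have "\<dots> = ring_inverse e * (walk a z * walk (a \<circ> z) w)"
    unfolding e_def by (simp add: ring_inverse_left' walk_unit[OF aW zW])
  also have "\<dots> = ring_inverse e * (walk a y * e)"
    unfolding walk_comp[OF aW zW, symmetric] zw walk_comp[OF aW yW] ey ..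
  finally have "T w - walk a y \<in> commutator_module \<Phi> \<Gamma> sc"
    using conjugate_cocenter[OF e] by simp
  moreover have "walk a y \<in> HJ J" unfolding a_def y by (rule M[rule_format]) (use N in simp)
  ultimately show ?thesis by blast
qed

end

theorem theoremA:
  fixes \<Phi> :: "('v::real_normed_vector, 'u::real_vector) root_datum"
    and \<Gamma> :: "('v \<Rightarrow> 'v) set"
    and sc :: "('v \<Rightarrow> 'v) set laurent \<Rightarrow> 'h::ring_1 \<Rightarrow> 'h"
    and T :: "('v \<Rightarrow> 'v) \<Rightarrow> 'h"
    and J :: "'v set" and z w :: "'v \<Rightarrow> 'v"
  assumes "affine_hecke_algebra \<Phi> \<Gamma> sc T"
    and "J \<subseteq> simples \<Phi>"
    and "z \<in> min_coset_reps \<Phi> J"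
    and "alcove_element \<Phi> \<Gamma> J z w"
  shows "T w \<in> {h + c | h c. h \<in> hecke_on \<Phi> \<Gamma> sc T J \<and> c \<in> commutator_module \<Phi> \<Gamma> sc}"
proof -
  interpret affine_hecke_algebra \<Phi> \<Gamma> sc T by (rule assms(1))
  obtain h where h: "h \<in> hecke_on \<Phi> \<Gamma> sc T J" "T w - h \<in> commutator_module \<Phi> \<Gamma> sc"
    using alcove_element_cocenter[OF assms(2-4)] by blast
  show ?thesis
    by (rule CollectI, rule exI[of _ h], rule exI[of _ "T w - h"]) (simp add: h)
qed

end
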